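(* Let $\nu>0$ and let $u$ be a smooth solution of the Navier-Stokes equation $\partial_t u+\mathbb{P}(\operatorname{curl}u\times u)+\nu\operatorname{curl}^2u=0$, $\operatorname{div}u=0$, on $[0,T)\times\mathbb{R}^3$. Then for all $t\in[0,T)$ $$N_+(u,t)-N_-(u,t)=N_+(u,0)-N_-(u,0).$$
   Context: $\mathbb{P}$ is the Leray projection (orthogonal projection of $L^2(\mathbb{R}^3)$ onto divergence-free fields). A smooth solution on $[0,T)$ is a real-valued solution, smooth in $(t,x)$ and of finite energy, with $u\in C([0,T);H^s(\mathbb{R}^3))$ for every $s\ge0$. Let $|D|=(-\Delta)^{1/2}$, the Fourier multiplier of symbol $|\xi|$, and let $\mathbf{C}=\operatorname{curl}$, the Fourier multiplier whose symbol is the matrix of $\eta\mapsto i\xi\times\eta$ on $\mathbb{C}^3$. Define the Fourier multipliers $\mathbb{Q}_\pm=\tfrac12(\mathbb{P}\pm\mathbf{C}|D|^{-1})$ and, for $s\in\mathbb{R}$, $\mathbf{C}_\pm^{s}=|D|^{s}\mathbb{Q}_\pm$. Define $$N_\pm(u,t)=\|\mathbf{C}_\pm^{1/2}u(t)\|_{L^2}^2+2\nu\int_0^t\|\mathbf{C}_\pm^{3/2}u(t')\|_{L^2}^2\,dt'.$$ *)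

theory Defs
  imports "HOL-Analysis.Analysis"
begin

section \<open>Square-integrable complex vector fields\<close>

type_synonym cfield = "real^3 \<Rightarrow> complex^3"

text \<open>Elements of \<open>L\<^sup>2(\<real>\<^sup>3;\<complex>\<^sup>3)\<close> are represented by functions; operators below return some
  representative, and equations between \<open>L\<^sup>2\<close> fields are understood almost everywhere.\<close>

definition L2 :: "cfield \<Rightarrow> bool" where
  "L2 f \<longleftrightarrow> f \<in> borel_measurable lborel \<and> integrable lborel (\<lambda>x. (norm (f x))\<^sup>2)"

definition L2_norm :: "cfield \<Rightarrow> real" where
  "L2_norm f = sqrt (LINT x|lborel. (norm (f x))\<^sup>2)"

definition L2_inner :: "cfield \<Rightarrow> cfield \<Rightarrow> complex" where
  "L2_inner f g = (LINT x|lborel. (\<Sum>i\<in>UNIV. f x $ i * cnj (g x $ i)))"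

definition complexify :: "(real^3 \<Rightarrow> real^3) \<Rightarrow> cfield" where
  "complexify v x = (\<chi> i. complex_of_real (v x $ i))"


section \<open>Fourier transform and Fourier multipliers\<close>

definition truncated_fourier :: "real \<Rightarrow> real \<Rightarrow> cfield \<Rightarrow> cfield" where
  "truncated_fourier \<sigma> R f \<xi> =
     (2 * pi) powr (-3/2) *\<^sub>R (LINT x:cball 0 R|lborel. cis (\<sigma> * (\<xi> \<bullet> x)) *s f x)"

text \<open>The unitary Fourier transform on \<open>L\<^sup>2\<close> (Plancherel): the limit in \<open>L\<^sup>2\<close> of the truncated
  integrals as \<open>R \<rightarrow> \<infinity>\<close>; \<open>\<sigma> = -1\<close> gives the transform and \<open>\<sigma> = 1\<close> its inverse.
  The extended integral ensures that the condition fails if the difference is not in \<open>L\<^sup>2\<close>.\<close>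

definition plancherel :: "real \<Rightarrow> cfield \<Rightarrow> cfield" where
  "plancherel \<sigma> f = (SOME g. L2 g \<and>
     ((\<lambda>R. \<integral>\<^sup>+\<xi>. ennreal ((norm (g \<xi> - truncated_fourier \<sigma> R f \<xi>))\<^sup>2) \<partial>lborel) \<longlongrightarrow> 0) at_top)"

definition fourier :: "cfield \<Rightarrow> cfield" where
  "fourier = plancherel (-1)"

definition inverse_fourier :: "cfield \<Rightarrow> cfield" where
  "inverse_fourier = plancherel 1"

text \<open>Meaningful for those \<open>f\<close> in \<open>L\<^sup>2\<close> for which \<open>m(\<xi>) fourier f(\<xi>)\<close> is in \<open>L\<^sup>2\<close>.\<close>

definition fourier_multiplier :: "(real^3 \<Rightarrow> complex^3^3) \<Rightarrow> cfield \<Rightarrow> cfield" where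
  "fourier_multiplier m f = inverse_fourier (\<lambda>\<xi>. m \<xi> *v fourier f \<xi>)"

text \<open>The matrix of \<open>\<eta> \<mapsto> i \<xi> \<times> \<eta>\<close>: its \<open>j\<close>-th column is \<open>i \<xi> \<times> e\<^sub>j\<close>.\<close>

definition curl_symbol :: "real^3 \<Rightarrow> complex^3^3" where
  "curl_symbol \<xi> = (\<chi> i j. \<i> * complex_of_real (cross3 \<xi> (axis j 1) $ i))"

definition abs_D_power :: "real \<Rightarrow> cfield \<Rightarrow> cfield" where
  "abs_D_power s = fourier_multiplier (\<lambda>\<xi>. mat (complex_of_real (norm \<xi> powr s)))"

text \<open>\<open>curl |D|\<^sup>-\<^sup>1\<close> is a single multiplier with bounded symbol; \<open>|D|\<^sup>-\<^sup>1 f\<close> alone need not be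
  in \<open>L\<^sup>2\<close>.\<close>

definition curl_inverse_abs_D :: "cfield \<Rightarrow> cfield" where
  "curl_inverse_abs_D = fourier_multiplier (\<lambda>\<xi>. norm \<xi> powr (-1) *\<^sub>R curl_symbol \<xi>)"


section \<open>Sobolev spaces\<close>

definition sobolev :: "real \<Rightarrow> cfield \<Rightarrow> bool" where
  "sobolev s f \<longleftrightarrow> L2 f \<and>
     integrable lborel (\<lambda>\<xi>. (1 + (norm \<xi>)\<^sup>2) powr s * (norm (fourier f \<xi>))\<^sup>2)"

definition sobolev_norm :: "real \<Rightarrow> cfield \<Rightarrow> real" where
  "sobolev_norm s f =
     sqrt (LINT \<xi>|lborel. (1 + (norm \<xi>)\<^sup>2) powr s * (norm (fourier f \<xi>))\<^sup>2)"

definition continuous_in_sobolev :: "real \<Rightarrow> real set \<Rightarrow> (real \<Rightarrow> cfield) \<Rightarrow> bool" where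
  "continuous_in_sobolev s I f \<longleftrightarrow> (\<forall>t\<in>I. sobolev s (f t)) \<and>
     (\<forall>t\<in>I. ((\<lambda>r. sobolev_norm s (\<lambda>x. f r x - f t x)) \<longlongrightarrow> 0) (at t within I))"


section \<open>Classical differential operators\<close>

text \<open>\<open>C\<^sup>k\<close> regularity on a set such as \<open>[0,T) \<times> \<real>\<^sup>3\<close>: derivatives are taken within the set,
  hence are one-sided in time at \<open>t = 0\<close>.\<close>

primrec Ck_on :: "nat \<Rightarrow> ('a::euclidean_space \<Rightarrow> 'b::real_normed_vector) \<Rightarrow> 'a set \<Rightarrow> bool" where
  "Ck_on 0 f S \<longleftrightarrow> continuous_on S f"
| "Ck_on (Suc k) f S \<longleftrightarrow>
     (\<exists>f'. (\<forall>x\<in>S. (f has_derivative f' x) (at x within S)) \<and> (\<forall>v. Ck_on k (\<lambda>x. f' x v) S))"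

definition smooth_on :: "('a::euclidean_space \<Rightarrow> 'b::real_normed_vector) \<Rightarrow> 'a set \<Rightarrow> bool" where
  "smooth_on f S \<longleftrightarrow> (\<forall>k. Ck_on k f S)"

definition partial :: "3 \<Rightarrow> (real^3 \<Rightarrow> 'b::real_normed_vector) \<Rightarrow> real^3 \<Rightarrow> 'b" where
  "partial i f x = frechet_derivative f (at x) (axis i 1)"

definition divergence :: "(real^3 \<Rightarrow> real^3) \<Rightarrow> real^3 \<Rightarrow> real" where
  "divergence v x = (\<Sum>i\<in>UNIV. partial i v x $ i)"

definition curl :: "(real^3 \<Rightarrow> real^3) \<Rightarrow> real^3 \<Rightarrow> real^3" where
  "curl v x = vector
     [partial 2 v x $ 3 - partial 3 v x $ 2,
      partial 3 v x $ 1 - partial 1 v x $ 3,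
      partial 1 v x $ 2 - partial 2 v x $ 1]"


section \<open>Leray projection\<close>

text \<open>Vanishing divergence in the sense of distributions.\<close>

definition divergence_free :: "cfield \<Rightarrow> bool" where
  "divergence_free f \<longleftrightarrow>
     (\<forall>\<phi> :: real^3 \<Rightarrow> real. smooth_on \<phi> UNIV \<and> compact (closure {x. \<phi> x \<noteq> 0}) \<longrightarrow>
        (LINT x|lborel. (\<Sum>i\<in>UNIV. f x $ i * complex_of_real (partial i \<phi> x))) = 0)"

definition leray :: "cfield \<Rightarrow> cfield" where
  "leray f = (SOME g. L2 g \<and> divergence_free g \<and>
     (\<forall>h. L2 h \<and> divergence_free h \<longrightarrow> L2_inner (\<lambda>x. f x - g x) h = 0))"


section \<open>Smooth Navier-Stokes solutions\<close>

definition time_interval :: "ereal \<Rightarrow> real set" where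
  "time_interval T = {t. 0 \<le> t \<and> ereal t < T}"

definition navier_stokes :: "real \<Rightarrow> ereal \<Rightarrow> (real \<Rightarrow> real^3 \<Rightarrow> real^3) \<Rightarrow> bool" where
  "navier_stokes \<nu> T u \<longleftrightarrow>
     (\<forall>t\<in>time_interval T.
        (AE x in lborel.
           complexify (\<lambda>x. vector_derivative (\<lambda>r. u r x) (at t within time_interval T)) x
           + leray (complexify (\<lambda>x. cross3 (curl (u t) x) (u t x))) x
           + \<nu> *\<^sub>R complexify (curl (curl (u t))) x = 0) \<and>
        (\<forall>x. divergence (u t) x = 0))"

definition smooth_solution :: "real \<Rightarrow> ereal \<Rightarrow> (real \<Rightarrow> real^3 \<Rightarrow> real^3) \<Rightarrow> bool" where
  "smooth_solution \<nu> T u \<longleftrightarrow>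
     smooth_on (\<lambda>(t, x). u t x) (time_interval T \<times> UNIV) \<and>
     (\<forall>t\<in>time_interval T. L2 (complexify (u t))) \<and>
     (\<forall>s\<ge>0. continuous_in_sobolev s (time_interval T) (\<lambda>t. complexify (u t))) \<and>
     navier_stokes \<nu> T u"


section \<open>Helical components\<close>

text \<open>The parameter \<open>\<sigma> = 1\<close> or \<open>\<sigma> = -1\<close> is the sign in the index \<open>\<plusminus>\<close>.\<close>

definition helical_Q :: "real \<Rightarrow> cfield \<Rightarrow> cfield" where
  "helical_Q \<sigma> f = (\<lambda>x. (1/2) *\<^sub>R (leray f x + \<sigma> *\<^sub>R curl_inverse_abs_D f x))"

definition helical_C :: "real \<Rightarrow> real \<Rightarrow> cfield \<Rightarrow> cfield" where
  "helical_C \<sigma> s f = abs_D_power s (helical_Q \<sigma> f)"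

definition helical_N :: "real \<Rightarrow> real \<Rightarrow> (real \<Rightarrow> real^3 \<Rightarrow> real^3) \<Rightarrow> real \<Rightarrow> real" where
  "helical_N \<sigma> \<nu> u t =
     (L2_norm (helical_C \<sigma> (1/2) (complexify (u t))))\<^sup>2
     + 2 * \<nu> * (LINT t':{0..t}|lborel. (L2_norm (helical_C \<sigma> (3/2) (complexify (u t'))))\<^sup>2)"

abbreviation "N_plus \<equiv> helical_N 1"
abbreviation "N_minus \<equiv> helical_N (-1)"

end

theory Submission
  imports Defs "HOL-Probability.Probability"
begin

text \<open>
  Why the theorem holds. Write \<open>\<omega> = curl u\<close>. For the helical components one has pointwise on the
  Fourier side \<open>|Q\<^sub>+ z|\<^sup>2 - |Q\<^sub>- z|\<^sup>2 = z \<bullet> (i \<xi> \<times> z) / |\<xi>|\<close>, because \<open>Q\<^sub>\<plusminus> z = (z \<plusminus> i \<xi> \<times> z / |\<xi>|) / 2\<close>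
  on fields that the Leray projection fixes. Integrated against \<open>|\<xi>|\<close> and \<open>|\<xi>|\<^sup>3\<close>, this turns
  \<open>N\<^sub>+ - N\<^sub>-\<close> into \<open>H(t) + 2 \<nu> \<integral> G\<close>, where \<open>H = \<langle>u, \<omega>\<rangle>\<close> is the helicity and
  \<open>G = \<langle>curl \<omega>, \<omega>\<rangle>\<close> is its dissipation. The claim is therefore the helicity balance
  \<open>H' = - 2 \<nu> G\<close>. It holds since curl is symmetric, so that \<open>H' = 2 \<langle>\<partial>\<^sub>t u, \<omega>\<rangle>\<close>; the Leray projection
  disappears against the divergence-free field \<open>\<omega>\<close>; and \<open>\<omega> \<times> u\<close> is pointwise orthogonal to \<open>\<omega>\<close>.

  The balance is derived from the increments
  \<open>H(b) - H(a) = \<langle>u(b) - u(a), \<omega>(b) + \<omega>(a)\<rangle> = \<integral>\<^sub>a\<^sup>b \<langle>\<partial>\<^sub>t u(r), \<omega>(b) + \<omega>(a)\<rangle> dr\<close>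
  (\<open>helicity_difference\<close>, \<open>l2_inner_increment\<close>). Inserting the equation for \<open>\<partial>\<^sub>t u(r)\<close> and replacing
  \<open>\<omega>(a)\<close> and \<open>\<omega>(b)\<close> by \<open>\<omega>(r)\<close> makes an error that is controlled by the continuity of the solution in
  a Sobolev space (\<open>helicity_increment_estimate\<close>); in this way \<open>\<omega>\<close> is never differentiated in time.

  Three pieces of analysis carry this argument.

  Plancherel's theorem (\<open>plancherel_norm\<close>, \<open>plancherel_inversion\<close>). Regularizing
  \<open>\<integral> |F f|\<^sup>2\<close> by a Gaussian gives a Gaussian average of the autocorrelation of \<open>f\<close>; hence the Fourier
  integral is a contraction of \<open>L\<^sup>2\<close>, and it preserves the norm of the indicator of an open set. The
  functions whose norm is preserved form a closed subspace, so these are all of \<open>L\<^sup>1 \<inter> L\<^sup>2\<close>. The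
  extension to \<open>L\<^sup>2\<close> is an isometry whose adjoint is the transform of opposite sign, and an adjoint
  of an isometry inverts it.

  The Leray projection (\<open>leray_properties\<close>). Divergence-free fields are an orthogonal complement,
  so that the projection theorem in the complete space \<open>L\<^sup>2\<close> applies.

  The classical derivatives of the velocity (\<open>curl_represented\<close>). Seven Sobolev derivatives bound four
  moments of the Fourier transform in \<open>L\<^sup>1\<close>, so \<open>u\<close> is an absolutely convergent Fourier
  integral that may be differentiated under the integral sign. Classical curls are thereby Fourier
  multipliers, to which Plancherel's theorem applies.
\<close>

section \<open>The Hilbert space of square-integrable functions\<close>

definition square_integrable :: "('a::euclidean_space \<Rightarrow> 'b::euclidean_space) \<Rightarrow> bool" where
  "square_integrable f \<longleftrightarrow> f \<in> borel_measurable lborel \<and> integrable lborel (\<lambda>x. (norm (f x))\<^sup>2)"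

text \<open>The inner product is real. On complex vectors it is the real part of the Hermitian one, whose
  imaginary part is recovered by multiplying one argument with \<open>\<i>\<close>.\<close>

definition l2_inner :: "('a::euclidean_space \<Rightarrow> 'b::euclidean_space) \<Rightarrow> ('a \<Rightarrow> 'b) \<Rightarrow> real" where
  "l2_inner f g = (LINT x|lborel. f x \<bullet> g x)"

definition l2_norm :: "('a::euclidean_space \<Rightarrow> 'b::euclidean_space) \<Rightarrow> real" where
  "l2_norm f = sqrt (LINT x|lborel. (norm (f x))\<^sup>2)"

lemma square_integrable_measurable [measurable_dest]:
  "square_integrable f \<Longrightarrow> f \<in> borel_measurable borel"
  by (simp add: square_integrable_def)

lemma square_integrable_integrable: "square_integrable f \<Longrightarrow> integrable lborel (\<lambda>x. (norm (f x))\<^sup>2)"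
  by (simp add: square_integrable_def)

lemma square_integrable_dominated:
  fixes f :: "'a::euclidean_space \<Rightarrow> 'b::euclidean_space"
  assumes f: "f \<in> borel_measurable borel" and "integrable lborel g" and "\<And>x. (norm (f x))\<^sup>2 \<le> g x"
  shows "square_integrable f"
  unfolding square_integrable_def
proof
  show "f \<in> borel_measurable lborel" using f by simp
  show "integrable lborel (\<lambda>x. (norm (f x))\<^sup>2)"
    by (rule Bochner_Integration.integrable_bound[OF assms(2)]) (use assms in \<open>auto intro: order_trans[OF _ abs_ge_self]\<close>)
qed

lemma square_integrable_bound:
  fixes f :: "'a::euclidean_space \<Rightarrow> 'b::euclidean_space" and g :: "'a \<Rightarrow> 'c::euclidean_space"
  assumes "f \<in> borel_measurable borel" and g: "square_integrable g" and le: "\<And>x. norm (f x) \<le> C * norm (g x)"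
  shows "square_integrable f"
proof (rule square_integrable_dominated[OF assms(1)])
  show "integrable lborel (\<lambda>x. C\<^sup>2 * (norm (g x))\<^sup>2)"
    using g by (simp add: square_integrable_def)
  show "(norm (f x))\<^sup>2 \<le> C\<^sup>2 * (norm (g x))\<^sup>2" for x
    using power_mono[OF le[of x], of 2] by (simp add: power_mult_distrib)
qed

lemma square_integrable_zero [simp]: "square_integrable (\<lambda>x. 0)"
  by (simp add: square_integrable_def)

lemma square_integrable_scaleR: "square_integrable f \<Longrightarrow> square_integrable (\<lambda>x. c *\<^sub>R f x)"
  by (rule square_integrable_bound[where g=f and C="\<bar>c\<bar>"]) (auto intro: square_integrable_measurable)

lemma square_integrable_uminus: "square_integrable f \<Longrightarrow> square_integrable (\<lambda>x. - f x)"
  by (rule square_integrable_bound[where g=f and C=1]) (auto intro: square_integrable_measurable)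

lemma square_integrable_add:
  assumes f: "square_integrable f" and g: "square_integrable g"
  shows "square_integrable (\<lambda>x. f x + g x)"
proof (rule square_integrable_dominated)
  show "(\<lambda>x. f x + g x) \<in> borel_measurable borel"
    using f g by measurable
  show "integrable lborel (\<lambda>x. 2 * (norm (f x))\<^sup>2 + 2 * (norm (g x))\<^sup>2)"
    using f g by (simp add: square_integrable_def)
  show "(norm (f x + g x))\<^sup>2 \<le> 2 * (norm (f x))\<^sup>2 + 2 * (norm (g x))\<^sup>2" for x
    using power_mono[OF norm_triangle_ineq[of "f x" "g x"], of 2]
      sum_squares_bound[of "norm (f x)" "norm (g x)"] by (simp add: power2_sum)
qed

lemma square_integrable_diff:
  "square_integrable f \<Longrightarrow> square_integrable g \<Longrightarrow> square_integrable (\<lambda>x. f x - g x)"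
  using square_integrable_add[OF _ square_integrable_uminus, of f g] by simp

lemmas square_integrable_intros =
  square_integrable_add square_integrable_diff square_integrable_scaleR square_integrable_uminus

lemma square_integrable_norm_mult:
  assumes f: "square_integrable f" and g: "square_integrable g"
  shows "integrable lborel (\<lambda>x. norm (f x) * norm (g x))"
proof (rule Bochner_Integration.integrable_bound)
  show "integrable lborel (\<lambda>x. (norm (f x))\<^sup>2 + (norm (g x))\<^sup>2)"
    using f g by (simp add: square_integrable_def)
  show "(\<lambda>x. norm (f x) * norm (g x)) \<in> borel_measurable lborel"
    using f g by measurable
  have "norm (f x) * norm (g x) \<le> (norm (f x))\<^sup>2 + (norm (g x))\<^sup>2" for x
  proof -
    have "0 \<le> norm (f x) * norm (g x)" by simp
    then show ?thesis
      using sum_squares_bound[of "norm (f x)" "norm (g x)"] by linarith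
  qed
  then show "AE x in lborel. norm (norm (f x) * norm (g x)) \<le> norm ((norm (f x))\<^sup>2 + (norm (g x))\<^sup>2)"
    by auto
qed

lemma square_integrable_inner:
  assumes f: "square_integrable f" and g: "square_integrable g"
  shows "integrable lborel (\<lambda>x. f x \<bullet> g x)"
proof (rule Bochner_Integration.integrable_bound[OF square_integrable_norm_mult[OF f g]])
  show "(\<lambda>x. f x \<bullet> g x) \<in> borel_measurable lborel"
    using f g by measurable
qed (auto simp: Cauchy_Schwarz_ineq2)

lemma l2_inner_commute: "l2_inner f g = l2_inner g f"
  by (simp add: l2_inner_def inner_commute)

lemma l2_inner_add_left:
  "\<lbrakk>square_integrable f; square_integrable g; square_integrable h\<rbrakk>
    \<Longrightarrow> l2_inner (\<lambda>x. f x + g x) h = l2_inner f h + l2_inner g h"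
  by (simp add: l2_inner_def inner_add_left square_integrable_inner)

lemma l2_inner_diff_left:
  "\<lbrakk>square_integrable f; square_integrable g; square_integrable h\<rbrakk>
    \<Longrightarrow> l2_inner (\<lambda>x. f x - g x) h = l2_inner f h - l2_inner g h"
  by (simp add: l2_inner_def inner_diff_left square_integrable_inner)

lemma l2_inner_scaleR_left: "l2_inner (\<lambda>x. c *\<^sub>R f x) h = c * l2_inner f h"
  by (simp add: l2_inner_def)

lemma l2_inner_uminus_left: "l2_inner (\<lambda>x. - f x) h = - l2_inner f h"
  by (simp add: l2_inner_def)

lemma l2_inner_add_right:
  "\<lbrakk>square_integrable f; square_integrable g; square_integrable h\<rbrakk>
    \<Longrightarrow> l2_inner h (\<lambda>x. f x + g x) = l2_inner h f + l2_inner h g"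
  by (simp add: l2_inner_def inner_add_right square_integrable_inner)

lemma l2_inner_diff_right:
  "\<lbrakk>square_integrable f; square_integrable g; square_integrable h\<rbrakk>
    \<Longrightarrow> l2_inner h (\<lambda>x. f x - g x) = l2_inner h f - l2_inner h g"
  by (simp add: l2_inner_def inner_diff_right square_integrable_inner)

lemma l2_inner_scaleR_right: "l2_inner h (\<lambda>x. c *\<^sub>R f x) = c * l2_inner h f"
  by (simp add: l2_inner_def)

lemma l2_inner_uminus_right: "l2_inner h (\<lambda>x. - f x) = - l2_inner h f"
  by (simp add: l2_inner_def)

lemmas l2_inner_simps = l2_inner_add_left l2_inner_diff_left l2_inner_scaleR_left l2_inner_uminus_left
  l2_inner_add_right l2_inner_diff_right l2_inner_scaleR_right l2_inner_uminus_right

lemma l2_inner_cong_AE: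
  assumes "AE x in lborel. f x = f' x" "AE x in lborel. g x = g' x"
    "f \<in> borel_measurable borel" "f' \<in> borel_measurable borel"
    "g \<in> borel_measurable borel" "g' \<in> borel_measurable borel"
  shows "l2_inner f g = l2_inner f' g'"
  unfolding l2_inner_def by (rule integral_cong_AE) (use assms in auto)

lemma l2_norm_cong_AE:
  assumes "AE x in lborel. f x = f' x" "f \<in> borel_measurable borel" "f' \<in> borel_measurable borel"
  shows "l2_norm f = l2_norm f'"
  unfolding l2_norm_def by (intro arg_cong[of _ _ sqrt] integral_cong_AE) (use assms in auto)

lemma square_integrable_cong_AE:
  assumes "AE x in lborel. f x = f' x" "square_integrable f" "f' \<in> borel_measurable borel"
  shows "square_integrable f'"
proof -
  have [measurable]: "f' \<in> borel_measurable borel" "f \<in> borel_measurable borel"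
    using assms square_integrable_measurable by auto
  have "integrable lborel (\<lambda>x. (norm (f x))\<^sup>2) \<longleftrightarrow> integrable lborel (\<lambda>x. (norm (f' x))\<^sup>2)"
    using assms(1) by (intro integrable_cong_AE) auto
  with assms show ?thesis by (simp add: square_integrable_def)
qed

lemma l2_norm_nonneg [simp]: "0 \<le> l2_norm f"
  by (simp add: l2_norm_def)

lemma l2_norm_sq: "(l2_norm f)\<^sup>2 = (LINT x|lborel. (norm (f x))\<^sup>2)"
  by (simp add: l2_norm_def)

lemma l2_norm_sq_inner: "(l2_norm f)\<^sup>2 = l2_inner f f"
  by (simp add: l2_norm_sq l2_inner_def power2_norm_eq_inner)

lemma l2_norm_mono:
  assumes "f \<in> borel_measurable borel" "square_integrable g" "\<And>x. norm (f x) \<le> C * norm (g x)" "0 \<le> C"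
  shows "l2_norm f \<le> C * l2_norm g"
proof -
  have "square_integrable f" using assms square_integrable_bound by blast
  then have "(LINT x|lborel. (norm (f x))\<^sup>2) \<le> (LINT x|lborel. C\<^sup>2 * (norm (g x))\<^sup>2)"
    using assms power_mono[OF assms(3) norm_ge_zero, of _ 2]
    by (intro integral_mono) (auto simp: power_mult_distrib square_integrable_def)
  then have "(l2_norm f)\<^sup>2 \<le> (C * l2_norm g)\<^sup>2"
    by (simp add: l2_norm_sq power_mult_distrib)
  then show ?thesis
    using assms(4) by (meson l2_norm_nonneg mult_nonneg_nonneg power2_le_imp_le)
qed

lemma nn_integral_norm_sq:
  "square_integrable f \<Longrightarrow> (\<integral>\<^sup>+x. ennreal ((norm (f x))\<^sup>2) \<partial>lborel) = ennreal ((l2_norm f)\<^sup>2)"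
  by (simp add: l2_norm_sq square_integrable_def nn_integral_eq_integral)

lemma square_integrable_nn_bound:
  assumes "f \<in> borel_measurable borel" "(\<integral>\<^sup>+x. ennreal ((norm (f x))\<^sup>2) \<partial>lborel) \<le> ennreal (c\<^sup>2)" "0 \<le> c"
  shows "square_integrable f" and "l2_norm f \<le> c"
proof -
  show *: "square_integrable f"
    unfolding square_integrable_def
    using assms by (auto intro!: integrableI_bounded intro: le_less_trans)
  have "(l2_norm f)\<^sup>2 \<le> c\<^sup>2"
    using assms(2) by (simp add: nn_integral_norm_sq[OF *])
  then show "l2_norm f \<le> c" using assms(3) power2_le_imp_le by blast
qed

text \<open>Cauchy--Schwarz comes from the discriminant of \<open>c \<mapsto> \<parallel>|f| - c |g|\<parallel>\<^sup>2\<close>.\<close>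

lemma l2_Cauchy_Schwarz_norm:
  assumes f: "square_integrable f" and g: "square_integrable g"
  shows "(LINT x|lborel. norm (f x) * norm (g x)) \<le> l2_norm f * l2_norm g"
proof -
  let ?I = "LINT x|lborel. norm (f x) * norm (g x)" and ?a = "(l2_norm f)\<^sup>2" and ?b = "(l2_norm g)\<^sup>2"
  have quad: "0 \<le> ?a - 2 * c * ?I + c\<^sup>2 * ?b" for c
  proof -
    have "0 \<le> (LINT x|lborel. (norm (f x) - c * norm (g x))\<^sup>2)"
      by simp
    also have "\<dots> = (LINT x|lborel. (norm (f x))\<^sup>2 - 2 * c * (norm (f x) * norm (g x)) + c\<^sup>2 * (norm (g x))\<^sup>2)"
      by (intro Bochner_Integration.integral_cong) (auto simp: power2_eq_square algebra_simps)
    also have "\<dots> = ?a - 2 * c * ?I + c\<^sup>2 * ?b"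
      using square_integrable_integrable[OF f] square_integrable_integrable[OF g]
        square_integrable_norm_mult[OF f g] by (simp add: l2_norm_sq)
    finally show ?thesis .
  qed
  have I0: "0 \<le> ?I" by simp
  have "?I\<^sup>2 \<le> ?a * ?b"
  proof (cases "?b = 0")
    case True
    show ?thesis
    proof (rule ccontr)
      assume "\<not> ?thesis"
      then have "?I > 0" using True I0 by (auto simp: less_le)
      then show False
        using quad[of "(?a + 1) / (2 * ?I)"] True by simp
    qed
  next
    case False
    then have "?b > 0" using zero_le_power2[of "l2_norm g"] by linarith
    have "?a - 2 * (?I / ?b) * ?I + (?I / ?b)\<^sup>2 * ?b = ?a - ?I\<^sup>2 / ?b"
      using False by (simp add: power2_eq_square divide_simps)
    then have "?I\<^sup>2 / ?b \<le> ?a"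
      using quad[of "?I / ?b"] by linarith
    then show ?thesis
      using \<open>?b > 0\<close> by (simp add: pos_divide_le_eq)
  qed
  then have "?I\<^sup>2 \<le> (l2_norm f * l2_norm g)\<^sup>2"
    by (simp add: power_mult_distrib)
  then show ?thesis
    by (rule power2_le_imp_le) simp
qed

lemma l2_Cauchy_Schwarz:
  assumes f: "square_integrable f" and g: "square_integrable g"
  shows "\<bar>l2_inner f g\<bar> \<le> l2_norm f * l2_norm g"
proof -
  have "\<bar>l2_inner f g\<bar> \<le> (LINT x|lborel. \<bar>f x \<bullet> g x\<bar>)"
    unfolding l2_inner_def by (rule integral_abs_bound)
  also have "\<dots> \<le> (LINT x|lborel. norm (f x) * norm (g x))"
    using f g by (intro integral_mono square_integrable_norm_mult integrable_abs square_integrable_inner)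
      (auto simp: Cauchy_Schwarz_ineq2)
  also have "\<dots> \<le> l2_norm f * l2_norm g"
    by (rule l2_Cauchy_Schwarz_norm[OF f g])
  finally show ?thesis .
qed

lemma l2_norm_scaleR: "l2_norm (\<lambda>x. c *\<^sub>R f x) = \<bar>c\<bar> * l2_norm f"
  by (simp add: l2_norm_def power_mult_distrib real_sqrt_mult)

lemma l2_norm_minus_commute: "l2_norm (\<lambda>x. f x - g x) = l2_norm (\<lambda>x. g x - f x)"
  by (simp add: l2_norm_def norm_minus_commute)

lemma l2_norm_add_sq:
  assumes "square_integrable f" "square_integrable g"
  shows "(l2_norm (\<lambda>x. f x + g x))\<^sup>2 = (l2_norm f)\<^sup>2 + 2 * l2_inner f g + (l2_norm g)\<^sup>2"
  using assms by (simp add: l2_norm_sq_inner l2_inner_simps square_integrable_intros l2_inner_commute[of g f])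

lemma l2_norm_diff_sq:
  assumes "square_integrable f" "square_integrable g"
  shows "(l2_norm (\<lambda>x. f x - g x))\<^sup>2 = (l2_norm f)\<^sup>2 - 2 * l2_inner f g + (l2_norm g)\<^sup>2"
  using assms by (simp add: l2_norm_sq_inner l2_inner_simps square_integrable_intros l2_inner_commute[of g f])

lemma l2_norm_triangle:
  assumes "square_integrable f" "square_integrable g"
  shows "l2_norm (\<lambda>x. f x + g x) \<le> l2_norm f + l2_norm g"
proof (rule power2_le_imp_le)
  show "(l2_norm (\<lambda>x. f x + g x))\<^sup>2 \<le> (l2_norm f + l2_norm g)\<^sup>2"
    using l2_Cauchy_Schwarz[OF assms] by (simp add: l2_norm_add_sq[OF assms] power2_sum)
qed simp

lemma l2_norm_triangle_diff:
  assumes "square_integrable f" "square_integrable g" "square_integrable h"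
  shows "l2_norm (\<lambda>x. f x - h x) \<le> l2_norm (\<lambda>x. f x - g x) + l2_norm (\<lambda>x. g x - h x)"
  using l2_norm_triangle[of "\<lambda>x. f x - g x" "\<lambda>x. g x - h x"] assms by (simp add: square_integrable_intros)

lemma l2_norm_triangle_rev:
  assumes "square_integrable f" "square_integrable g"
  shows "\<bar>l2_norm f - l2_norm g\<bar> \<le> l2_norm (\<lambda>x. f x - g x)"
  using l2_norm_triangle[of "\<lambda>x. f x - g x" g] l2_norm_triangle[of "\<lambda>x. g x - f x" f] assms
  by (simp add: square_integrable_intros l2_norm_minus_commute[of f g] abs_le_iff)

lemma l2_norm_eq_0_AE:
  assumes "square_integrable f" "l2_norm f = 0"
  shows "AE x in lborel. f x = 0"
proof -
  have "(LINT x|lborel. (norm (f x))\<^sup>2) = 0"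
    using assms(2) l2_norm_sq[of f] by simp
  then have "AE x in lborel. (norm (f x))\<^sup>2 = 0"
    using integral_nonneg_eq_0_iff_AE[of lborel "\<lambda>x. (norm (f x))\<^sup>2"] assms(1)
    by (simp add: square_integrable_def)
  then show ?thesis by simp
qed

text \<open>A bound on the distance to a sequence passes to pointwise limits of the sequence: this is
  Fatou's lemma.\<close>

lemma nn_integral_norm_sq_Fatou:
  fixes f :: "nat \<Rightarrow> 'a::euclidean_space \<Rightarrow> 'b::euclidean_space"
  assumes [measurable]: "\<And>n. f n \<in> borel_measurable borel"
    and lim: "AE x in lborel. (\<lambda>n. f n x) \<longlonglongrightarrow> g x"
    and le: "eventually (\<lambda>n. (\<integral>\<^sup>+x. ennreal ((norm (f n x))\<^sup>2) \<partial>lborel) \<le> c) sequentially"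
  shows "(\<integral>\<^sup>+x. ennreal ((norm (g x))\<^sup>2) \<partial>lborel) \<le> c"
proof -
  have "(\<integral>\<^sup>+x. ennreal ((norm (g x))\<^sup>2) \<partial>lborel)
      = (\<integral>\<^sup>+x. liminf (\<lambda>n. ennreal ((norm (f n x))\<^sup>2)) \<partial>lborel)"
  proof (rule nn_integral_cong_AE, use lim in eventually_elim)
    case (elim x)
    then have "(\<lambda>n. ennreal ((norm (f n x))\<^sup>2)) \<longlonglongrightarrow> ennreal ((norm (g x))\<^sup>2)"
      by (intro tendsto_intros)
    then show ?case by (metis lim_imp_Liminf sequentially_bot)
  qed
  also have "\<dots> \<le> liminf (\<lambda>n. \<integral>\<^sup>+x. ennreal ((norm (f n x))\<^sup>2) \<partial>lborel)"
    by (rule nn_integral_liminf) simp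
  also have "\<dots> \<le> limsup (\<lambda>n. \<integral>\<^sup>+x. ennreal ((norm (f n x))\<^sup>2) \<partial>lborel)"
    by (simp add: Liminf_le_Limsup)
  also have "\<dots> \<le> c"
    by (rule Limsup_bounded[OF le])
  finally show ?thesis .
qed

text \<open>Completeness. Along a subsequence with \<open>\<parallel>d\<^sub>k\<parallel>\<^sup>2 \<le> 4\<^sup>-\<^sup>k\<close> for the increments \<open>d\<^sub>k\<close>, the function
  \<open>\<Sum>k. 2\<^sup>k |d\<^sub>k|\<^sup>2\<close> has finite integral, so that \<open>|d\<^sub>k| \<le> 2\<^sup>-\<^sup>k + 2\<^sup>k |d\<^sub>k|\<^sup>2\<close> is summable almost
  everywhere; the pointwise limit is the limit in \<open>L\<^sup>2\<close> by Fatou's lemma.\<close>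

theorem l2_complete:
  fixes f :: "nat \<Rightarrow> 'a::euclidean_space \<Rightarrow> 'b::euclidean_space"
  assumes f: "\<And>n. square_integrable (f n)"
    and cauchy: "\<And>e. 0 < e \<Longrightarrow> \<exists>N. \<forall>m\<ge>N. \<forall>n\<ge>N. l2_norm (\<lambda>x. f m x - f n x) \<le> e"
  shows "\<exists>g. square_integrable g \<and> (\<lambda>n. l2_norm (\<lambda>x. f n x - g x)) \<longlonglongrightarrow> 0"
proof -
  have [measurable]: "\<And>n. f n \<in> borel_measurable borel"
    using f square_integrable_measurable by blast
  have "\<exists>N. \<forall>k. \<forall>m\<ge>N k. \<forall>n\<ge>N k. l2_norm (\<lambda>x. f m x - f n x) \<le> (1/2)^k"
    using cauchy by (intro choice allI) simp
  then obtain N where N: "\<And>k m n. m \<ge> N k \<Longrightarrow> n \<ge> N k \<Longrightarrow> l2_norm (\<lambda>x. f m x - f n x) \<le> (1/2)^k"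
    by blast
  \<comment> \<open>the sum of all earlier thresholds makes \<open>r\<close> monotone and large enough at every stage\<close>
  define r where "r k = k + (\<Sum>j\<le>k. N j)" for k
  have rN: "r k \<ge> N k" for k
    unfolding r_def by (simp add: member_le_sum trans_le_add2)
  have rS: "r k \<le> r (Suc k)" for k
    by (simp add: r_def)
  have rk: "r k \<ge> k" for k
    by (simp add: r_def)
  define d where "d k x = f (r (Suc k)) x - f (r k) x" for k x
  have [measurable]: "\<And>k. d k \<in> borel_measurable borel"
    unfolding d_def by measurable
  have dsq: "square_integrable (d k)" for k
    unfolding d_def by (intro square_integrable_intros f)
  have dn: "l2_norm (d k) \<le> (1/2)^k" for k
    unfolding d_def using N[of k "r (Suc k)" "r k"] rN[of k] rS[of k] by linarith
  have "(\<integral>\<^sup>+x. (\<Sum>k. ennreal (2^k * (norm (d k x))\<^sup>2)) \<partial>lborel)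
      = (\<Sum>k. \<integral>\<^sup>+x. ennreal (2^k * (norm (d k x))\<^sup>2) \<partial>lborel)"
    by (rule nn_integral_suminf) simp
  also have "\<dots> = (\<Sum>k. ennreal (2^k * (l2_norm (d k))\<^sup>2))"
    by (simp add: ennreal_mult nn_integral_cmult nn_integral_norm_sq[OF dsq])
  also have "\<dots> \<le> (\<Sum>k. ennreal ((1/2)^k))"
  proof (intro suminf_le ennreal_leI)
    fix k
    have "(l2_norm (d k))\<^sup>2 \<le> ((1/2)^k)\<^sup>2" by (rule power_mono[OF dn]) simp
    then have "2^k * (l2_norm (d k))\<^sup>2 \<le> 2^k * ((1/2)^k)\<^sup>2" by simp
    also have "\<dots> = (2 * (1/2) * (1/2))^k"
      by (simp only: power2_eq_square power_mult_distrib mult.assoc)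
    finally show "2^k * (l2_norm (d k))\<^sup>2 \<le> (1/2)^k" by simp
  qed auto
  also have "\<dots> = ennreal (\<Sum>k. (1/2)^k)"
    by (intro suminf_ennreal2) (auto intro: summable_geometric)
  finally have "(\<integral>\<^sup>+x. (\<Sum>k. ennreal (2^k * (norm (d k x))\<^sup>2)) \<partial>lborel) \<noteq> \<infinity>"
    by (auto simp: top_unique)
  then have fin: "AE x in lborel. (\<Sum>k. ennreal (2^k * (norm (d k x))\<^sup>2)) \<noteq> \<infinity>"
    by (intro nn_integral_PInf_AE) auto
  have conv: "AE x in lborel. convergent (\<lambda>k. f (r k) x)"
    using fin
  proof eventually_elim
    case (elim x)
    then have sm: "summable (\<lambda>k. 2^k * (norm (d k x))\<^sup>2)"
      by (intro summable_suminf_not_top) auto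
    have "summable (\<lambda>k. (1/2)^k + 2^k * (norm (d k x))\<^sup>2)"
      by (intro summable_add sm summable_geometric) simp
    moreover have "norm (d k x) \<le> (1/2)^k + 2^k * (norm (d k x))\<^sup>2" for k
    proof (cases "norm (d k x) \<le> (1/2)^k")
      case False
      then have "1 \<le> 2^k * norm (d k x)" by (simp add: field_simps)
      then have "1 * norm (d k x) \<le> 2^k * norm (d k x) * norm (d k x)"
        by (rule mult_right_mono) simp
      then show ?thesis by (simp add: power2_eq_square mult.assoc add_increasing)
    qed (simp add: add_increasing2)
    ultimately have "summable (\<lambda>k. d k x)"
      by (rule summable_comparison_test'[where N=0])
    then have "(\<lambda>n. \<Sum>k<n. d k x) \<longlonglongrightarrow> (\<Sum>k. d k x)"
      by (rule summable_LIMSEQ)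
    moreover have "(\<Sum>k<n. d k x) = f (r n) x - f (r 0) x" for n
      unfolding d_def by (rule sum_lessThan_telescope)
    ultimately have "(\<lambda>n. (f (r n) x - f (r 0) x) + f (r 0) x) \<longlonglongrightarrow> (\<Sum>k. d k x) + f (r 0) x"
      by (intro tendsto_add tendsto_const) simp
    then show ?case by (auto intro: convergentI)
  qed
  define g where "g x = lim (\<lambda>k. f (r k) x)" for x
  have [measurable]: "g \<in> borel_measurable borel"
    unfolding g_def by (rule borel_measurable_lim_metric) simp
  have lim: "AE x in lborel. (\<lambda>k. f (r k) x) \<longlonglongrightarrow> g x"
    using conv by eventually_elim (simp add: g_def convergent_LIMSEQ_iff)
  have bound: "\<exists>M. \<forall>n\<ge>M. square_integrable (\<lambda>x. f n x - g x) \<and> l2_norm (\<lambda>x. f n x - g x) \<le> e" if e: "e > 0" for e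
  proof -
    obtain M where M: "\<And>m n. m \<ge> M \<Longrightarrow> n \<ge> M \<Longrightarrow> l2_norm (\<lambda>x. f m x - f n x) \<le> e"
      using cauchy[OF e] by blast
    have "square_integrable (\<lambda>x. f n x - g x) \<and> l2_norm (\<lambda>x. f n x - g x) \<le> e" if n: "n \<ge> M" for n
    proof -
      have "(\<integral>\<^sup>+x. ennreal ((norm (f n x - g x))\<^sup>2) \<partial>lborel) \<le> ennreal (e\<^sup>2)"
      proof (rule nn_integral_norm_sq_Fatou[where f="\<lambda>k x. f n x - f (r k) x"])
        show "AE x in lborel. (\<lambda>k. f n x - f (r k) x) \<longlonglongrightarrow> f n x - g x"
          using lim by eventually_elim (intro tendsto_intros)
        show "\<forall>\<^sub>F k in sequentially. (\<integral>\<^sup>+x. ennreal ((norm (f n x - f (r k) x))\<^sup>2) \<partial>lborel) \<le> ennreal (e\<^sup>2)"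
        proof (rule eventually_sequentiallyI[of M])
          fix k assume "k \<ge> M"
          then have "r k \<ge> M" using rk[of k] by linarith
          then have "l2_norm (\<lambda>x. f n x - f (r k) x) \<le> e" using M n by blast
          then show "(\<integral>\<^sup>+x. ennreal ((norm (f n x - f (r k) x))\<^sup>2) \<partial>lborel) \<le> ennreal (e\<^sup>2)"
            by (simp add: nn_integral_norm_sq square_integrable_intros f power_mono)
        qed
      qed simp
      from square_integrable_nn_bound[OF _ this] e show ?thesis by simp
    qed
    then show ?thesis by blast
  qed
  obtain M where "square_integrable (\<lambda>x. f M x - g x)"
    using bound[of 1] by auto
  from square_integrable_diff[OF f[of M] this] have "square_integrable g"
    by simp
  moreover have "(\<lambda>n. l2_norm (\<lambda>x. f n x - g x)) \<longlonglongrightarrow> 0"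
  proof (rule LIMSEQ_I)
    fix e :: real assume "0 < e"
    then obtain M where "\<forall>n\<ge>M. l2_norm (\<lambda>x. f n x - g x) \<le> e / 2"
      using bound[of "e/2"] by auto
    then show "\<exists>M. \<forall>n\<ge>M. norm (l2_norm (\<lambda>x. f n x - g x) - 0) < e"
      using \<open>0 < e\<close> by (intro exI[of _ M]) fastforce
  qed
  ultimately show ?thesis by blast
qed

section \<open>Gaussians and their Fourier transforms\<close>

lemma integrable_lborel_prod_Basis:
  fixes f :: "'a::euclidean_space \<Rightarrow> real \<Rightarrow> 'c::{real_normed_field,banach,second_countable_topology}"
  assumes f: "\<And>b. b \<in> Basis \<Longrightarrow> integrable lborel (f b)"
  shows "integrable lborel (\<lambda>x::'a. \<Prod>b\<in>Basis. f b (x \<bullet> b))"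
    and "(LINT x|lborel. (\<Prod>b\<in>Basis. f b ((x::'a) \<bullet> b))) = (\<Prod>b\<in>Basis. (LINT x|lborel. f b x))"
proof -
  interpret product_sigma_finite "\<lambda>_::'a. lborel :: real measure" ..
  let ?T = "\<lambda>g. \<Sum>b\<in>Basis. g b *\<^sub>R (b::'a)"
  have [measurable]: "\<And>b. b \<in> Basis \<Longrightarrow> f b \<in> borel_measurable borel"
    using borel_measurable_integrable[OF f] by simp
  have T [measurable]: "?T \<in> measurable (Pi\<^sub>M (Basis::'a set) (\<lambda>_. lborel :: real measure)) borel"
    by measurable
  have F [measurable]: "(\<lambda>x::'a. \<Prod>b\<in>Basis. f b (x \<bullet> b)) \<in> borel_measurable borel"
    by measurable
  have eq: "(\<Prod>b\<in>Basis. f b (?T g \<bullet> b)) = (\<Prod>b\<in>Basis. f b (g b))" for g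
    by (intro prod.cong refl) (simp add: inner_sum_left inner_Basis if_distrib cong: if_cong)
  have "integrable (Pi\<^sub>M (Basis::'a set) (\<lambda>_. lborel :: real measure)) (\<lambda>g. \<Prod>b\<in>(Basis::'a set). f b (g b))"
    by (rule product_integrable_prod) (simp_all add: f)
  then show "integrable lborel (\<lambda>x::'a. \<Prod>b\<in>Basis. f b (x \<bullet> b))"
    by (subst lborel_eq) (simp add: integrable_distr_eq[OF T F] eq)
  have "(LINT x|lborel. (\<Prod>b\<in>Basis. f b ((x::'a) \<bullet> b)))
      = (LINT g|(Pi\<^sub>M (Basis::'a set) (\<lambda>_. lborel :: real measure)). (\<Prod>b\<in>(Basis::'a set). f b (g b)))"
    by (subst lborel_eq) (simp add: integral_distr[OF T F] eq)
  also have "\<dots> = (\<Prod>b\<in>Basis. (LINT x|lborel. f b x))"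
    by (rule product_integral_prod) (simp_all add: f)
  finally show "(LINT x|lborel. (\<Prod>b\<in>Basis. f b ((x::'a) \<bullet> b))) = (\<Prod>b\<in>Basis. (LINT x|lborel. f b x))" .
qed

text \<open>The density of the centered normal distribution with standard deviation \<open>\<delta>\<close> in every coordinate.
  In this form its Fourier transform and its total mass reduce to dimension one.\<close>

definition gaussian :: "real \<Rightarrow> 'a::euclidean_space \<Rightarrow> real" where
  "gaussian \<delta> z = (\<Prod>b\<in>Basis. normal_density 0 \<delta> (z \<bullet> b))"

lemma gaussian_measurable [measurable]: "gaussian \<delta> \<in> borel_measurable borel"
  unfolding gaussian_def by measurable

lemma gaussian_nonneg [simp]: "0 \<le> gaussian \<delta> z"
  unfolding gaussian_def by (intro prod_nonneg) auto

lemma gaussian_minus [simp]: "gaussian \<delta> (- z) = gaussian \<delta> z"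
  by (simp add: gaussian_def normal_density_def)

lemma gaussian_scale:
  assumes "\<delta> > 0"
  shows "gaussian \<delta> (\<delta> *\<^sub>R z) * \<delta> ^ DIM('a) = gaussian 1 (z::'a::euclidean_space)"
proof -
  have "normal_density 0 \<delta> (\<delta> * t) * \<delta> = normal_density 0 1 t" for t
    using assms by (simp add: normal_density_def real_sqrt_mult power_mult_distrib)
  then have "(\<Prod>b\<in>Basis. normal_density 0 \<delta> (\<delta> * (z \<bullet> b)) * \<delta>) = gaussian 1 z"
    by (simp add: gaussian_def)
  then show ?thesis
    by (simp add: gaussian_def prod.distrib)
qed

lemma nn_integral_gaussian_translate:
  assumes "\<delta> > 0"
  shows "(\<integral>\<^sup>+y. ennreal (gaussian \<delta> (x - (y::'a::euclidean_space))) \<partial>lborel) = 1"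
proof -
  have "(\<integral>\<^sup>+y. ennreal (gaussian \<delta> (x - y)) \<partial>lborel)
      = (\<integral>\<^sup>+y. (\<Prod>b\<in>Basis. ennreal (normal_density (x \<bullet> b) \<delta> (y \<bullet> b))) \<partial>lborel)"
    by (intro nn_integral_cong)
      (simp add: gaussian_def prod_ennreal normal_density_def inner_diff_left power2_commute)
  also have "\<dots> = (\<Prod>b\<in>Basis. \<integral>\<^sup>+y. ennreal (normal_density (x \<bullet> b) \<delta> y) \<partial>lborel)"
    by (rule nn_integral_lborel_prod) auto
  also have "\<dots> = 1"
    using assms by (simp add: nn_integral_eq_integral)
  finally show ?thesis .
qed

text \<open>The characteristic function of the standard normal distribution, rescaled by \<open>\<delta>\<close>.\<close>

lemma integral_cis_gaussian_real:
  assumes "\<delta> > 0"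
  shows "integrable lborel (\<lambda>x::real. cis (t * x) * complex_of_real (exp (- (\<delta> * x)\<^sup>2 / 2)))"
    and "(LINT x|lborel. cis (t * x) * complex_of_real (exp (- (\<delta> * x)\<^sup>2 / 2))) = complex_of_real (2 * pi * normal_density 0 \<delta> t)"
proof -
  let ?f = "\<lambda>x. std_normal_density x *\<^sub>R iexp ((t / \<delta>) * x)"
  have i: "integrable lborel ?f"
    by (rule Bochner_Integration.integrable_bound[OF integrable_normal_density[of 1 0]]) auto
  have "integrable lborel (\<lambda>x. ?f (0 + \<delta> * x))"
    by (rule lborel_integrable_real_affine[OF i]) (use assms in simp)
  then have i2: "integrable lborel (\<lambda>x. sqrt (2 * pi) *\<^sub>R ?f (\<delta> * x))"
    by (simp only: add_0 integrable_scaleR_right)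
  have eq: "sqrt (2 * pi) *\<^sub>R ?f (\<delta> * x) = cis (t * x) * complex_of_real (exp (- (\<delta> * x)\<^sup>2 / 2))" for x
    using assms by (simp add: std_normal_density_def cis_conv_exp scaleR_conv_of_real field_simps)
  show "integrable lborel (\<lambda>x::real. cis (t * x) * complex_of_real (exp (- (\<delta> * x)\<^sup>2 / 2)))"
    using i2 unfolding eq .
  have "complex_of_real (exp (- ((t / \<delta>)^2) / 2)) = char std_normal_distribution (t / \<delta>)"
    by (simp add: char_std_normal_distribution)
  also have "\<dots> = (LINT x|lborel. ?f x)"
    unfolding char_def by (subst integral_density) auto
  also have "\<dots> = \<delta> *\<^sub>R (LINT x|lborel. ?f (\<delta> * x))"
    using lborel_integral_real_affine[of \<delta> ?f 0] assms by simp
  finally have *: "complex_of_real (exp (- ((t / \<delta>)^2) / 2)) = \<delta> *\<^sub>R (LINT x|lborel. ?f (\<delta> * x))" .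
  have "(LINT x|lborel. cis (t * x) * complex_of_real (exp (- (\<delta> * x)\<^sup>2 / 2)))
      = (LINT x|lborel. sqrt (2 * pi) *\<^sub>R ?f (\<delta> * x))"
    unfolding eq ..
  also have "\<dots> = sqrt (2 * pi) *\<^sub>R (LINT x|lborel. ?f (\<delta> * x))"
    by (rule integral_scaleR_right)
  also have "(LINT x|lborel. ?f (\<delta> * x)) = (1 / \<delta>) *\<^sub>R complex_of_real (exp (- ((t / \<delta>)^2) / 2))"
    using assms by (simp only: *) (simp del: of_real_exp)
  also have "sqrt (2 * pi) *\<^sub>R \<dots> = complex_of_real (sqrt (2 * pi) * (1 / \<delta>) * exp (- ((t / \<delta>)^2) / 2))"
    by (simp add: scaleR_conv_of_real)
  also have "sqrt (2 * pi) * (1 / \<delta>) * exp (- ((t / \<delta>)^2) / 2) = 2 * pi * normal_density 0 \<delta> t"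
  proof -
    have "sqrt (2 * pi) * sqrt (2 * pi) = 2 * pi" by simp
    then have "sqrt (2 * pi) = 2 * pi / sqrt (2 * pi)" by (simp add: divide_simps)
    then show ?thesis
      using assms by (simp add: normal_density_def real_sqrt_mult power_divide field_simps)
  qed
  finally show "(LINT x|lborel. cis (t * x) * complex_of_real (exp (- (\<delta> * x)\<^sup>2 / 2))) = complex_of_real (2 * pi * normal_density 0 \<delta> t)" .
qed

lemma cis_sum: "finite A \<Longrightarrow> cis (\<Sum>a\<in>A. h a) = (\<Prod>a\<in>A. cis (h a))"
  by (induction A rule: finite_induct) (simp_all add: cis_mult[symmetric])

lemma integral_cis_gaussian:
  fixes z :: "'a::euclidean_space"
  assumes "\<delta> > 0"
  shows "integrable lborel (\<lambda>\<xi>. cis (\<xi> \<bullet> z) * complex_of_real (exp (- (\<delta> * norm \<xi>)\<^sup>2 / 2)))"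
    and "(LINT \<xi>|lborel. cis (\<xi> \<bullet> z) * complex_of_real (exp (- (\<delta> * norm \<xi>)\<^sup>2 / 2)))
      = complex_of_real ((2 * pi) ^ DIM('a) * gaussian \<delta> z)"
proof -
  let ?f = "\<lambda>b x. cis ((z \<bullet> b) * x) * complex_of_real (exp (- (\<delta> * x)\<^sup>2 / 2))"
  have eq: "cis (\<xi> \<bullet> z) * complex_of_real (exp (- (\<delta> * norm \<xi>)\<^sup>2 / 2)) = (\<Prod>b\<in>Basis. ?f b (\<xi> \<bullet> b))" for \<xi>
  proof -
    have "cis (\<xi> \<bullet> z) = (\<Prod>b\<in>Basis. cis ((z \<bullet> b) * (\<xi> \<bullet> b)))"
      by (simp add: cis_sum[symmetric] euclidean_inner[of \<xi> z] mult.commute)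
    moreover have "- (\<delta> * norm \<xi>)\<^sup>2 / 2 = (\<Sum>b\<in>Basis. - (\<delta> * (\<xi> \<bullet> b))\<^sup>2 / 2)"
      by (simp add: power_mult_distrib sum_negf sum_divide_distrib[symmetric] sum_distrib_left[symmetric]
          power2_norm_eq_inner euclidean_inner[of \<xi> \<xi>] power2_eq_square[of "_ \<bullet> _"])
    ultimately show ?thesis
      by (simp add: exp_sum prod.distrib)
  qed
  show "integrable lborel (\<lambda>\<xi>. cis (\<xi> \<bullet> z) * complex_of_real (exp (- (\<delta> * norm \<xi>)\<^sup>2 / 2)))"
    unfolding eq by (rule integrable_lborel_prod_Basis) (rule integral_cis_gaussian_real[OF assms])
  show "(LINT \<xi>|lborel. cis (\<xi> \<bullet> z) * complex_of_real (exp (- (\<delta> * norm \<xi>)\<^sup>2 / 2)))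
      = complex_of_real ((2 * pi) ^ DIM('a) * gaussian \<delta> z)"
    unfolding eq
    by (subst integrable_lborel_prod_Basis(2)[OF integral_cis_gaussian_real(1)[OF assms]])
      (simp_all only: integral_cis_gaussian_real(2)[OF assms], simp add: gaussian_def prod.distrib power_mult_distrib)
qed

lemma integrable_exp_norm:
  assumes "\<delta> > 0"
  shows "integrable lborel (\<lambda>\<xi>::'a::euclidean_space. exp (- (\<delta> * norm \<xi>)\<^sup>2 / 2))"
proof -
  have "integrable lborel (\<lambda>\<xi>::'a. complex_of_real (exp (- (\<delta> * norm \<xi>)\<^sup>2 / 2)))"
    using integral_cis_gaussian(1)[OF assms, of "0::'a"] by simp
  then show ?thesis by (simp only: complex_of_real_integrable_eq)
qed

section \<open>The Fourier integral of integrable functions and Plancherel's identity\<close>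

definition fourier_integral :: "real \<Rightarrow> ('a::euclidean_space \<Rightarrow> complex) \<Rightarrow> 'a \<Rightarrow> complex" where
  "fourier_integral \<sigma> f \<xi> = (2 * pi) powr (- real DIM('a) / 2) *\<^sub>R (LINT x|lborel. cis (\<sigma> * (\<xi> \<bullet> x)) * f x)"

lemma fst_snd_borel_measurable [measurable]:
  "fst \<in> borel_measurable (borel :: ('a::topological_space \<times> 'b::topological_space) measure)"
  "snd \<in> borel_measurable (borel :: ('a::topological_space \<times> 'b::topological_space) measure)"
  by (intro borel_measurable_continuous_onI continuous_intros)+

lemma cis_measurable [measurable]: "cis \<in> borel_measurable borel"
  by (intro borel_measurable_continuous_onI continuous_intros)

lemma integrable_cis_mult:
  fixes f :: "'a::euclidean_space \<Rightarrow> complex"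
  assumes "integrable lborel f" "h \<in> borel_measurable borel"
  shows "integrable lborel (\<lambda>x. cis (h x) * f x)"
proof -
  have [measurable]: "f \<in> borel_measurable borel" "h \<in> borel_measurable borel"
    using borel_measurable_integrable[OF assms(1)] assms by auto
  show ?thesis
    using assms(1) by (intro Bochner_Integration.integrable_bound[OF assms(1)]) (auto simp: norm_mult)
qed

lemma fourier_integral_measurable [measurable]:
  assumes [measurable]: "f \<in> borel_measurable borel"
  shows "fourier_integral \<sigma> f \<in> borel_measurable borel"
  unfolding fourier_integral_def by measurable

lemma fourier_integral_add:
  assumes "integrable lborel f" "integrable lborel g"
  shows "fourier_integral \<sigma> (\<lambda>x. f x + g x) \<xi> = fourier_integral \<sigma> f \<xi> + fourier_integral \<sigma> g \<xi>"
  using assms by (simp add: fourier_integral_def distrib_left integrable_cis_mult scaleR_add_right)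

lemma fourier_integral_diff:
  assumes "integrable lborel f" "integrable lborel g"
  shows "fourier_integral \<sigma> (\<lambda>x. f x - g x) \<xi> = fourier_integral \<sigma> f \<xi> - fourier_integral \<sigma> g \<xi>"
  using assms by (simp add: fourier_integral_def right_diff_distrib integrable_cis_mult scaleR_diff_right)

lemma fourier_integral_cmult:
  "fourier_integral \<sigma> (\<lambda>x. c * f x) \<xi> = c * fourier_integral \<sigma> f \<xi>"
  by (simp add: fourier_integral_def mult.left_commute[of _ c])

lemma norm_fourier_integral_le:
  fixes f :: "'a::euclidean_space \<Rightarrow> complex"
  shows "norm (fourier_integral \<sigma> f \<xi>) \<le> (2 * pi) powr (- real DIM('a) / 2) * (LINT x|lborel. norm (f x))"
proof -
  have "norm (LINT x|lborel. cis (\<sigma> * (\<xi> \<bullet> x)) * f x) \<le> (LINT x|lborel. norm (cis (\<sigma> * (\<xi> \<bullet> x)) * f x))"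
    by (rule integral_norm_bound)
  then show ?thesis
    by (simp add: fourier_integral_def norm_mult)
qed

lemma integrable_product_lborel:
  fixes a :: "'a::euclidean_space \<Rightarrow> complex" and b :: "'b::euclidean_space \<Rightarrow> complex"
  assumes a: "integrable lborel a" and b: "integrable lborel b"
  shows "integrable lborel (\<lambda>p. a (fst p) * b (snd p))"
    and "(LINT p|lborel. a (fst p) * b (snd p)) = (LINT x|lborel. a x) * (LINT y|lborel. b y)"
proof -
  have [measurable]: "a \<in> borel_measurable borel" "b \<in> borel_measurable borel"
    using borel_measurable_integrable a b by auto
  have i: "integrable (lborel \<Otimes>\<^sub>M lborel) (\<lambda>(x, y). a x * b y)"
    by (rule lborel_pair.Fubini_integrable) (use a b in \<open>auto simp: norm_mult\<close>)
  then show "integrable lborel (\<lambda>p. a (fst p) * b (snd p))"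
    by (simp add: lborel_prod case_prod_unfold)
  from lborel_pair.integral_fst[OF i]
  show "(LINT p|lborel. a (fst p) * b (snd p)) = (LINT x|lborel. a x) * (LINT y|lborel. b y)"
    by (simp add: lborel_prod case_prod_unfold)
qed

text \<open>The energy of the Fourier integral, regularized by a Gaussian, is a Gaussian average of the
  autocorrelation of the function: the integral over \<open>\<xi>\<close> is carried out first.\<close>

lemma fourier_energy_identity:
  fixes f :: "'a::euclidean_space \<Rightarrow> complex"
  assumes f: "integrable lborel f" and \<delta>: "\<delta> > 0" and \<sigma>: "\<bar>\<sigma>\<bar> = 1"
  shows "(LINT \<xi>|lborel. complex_of_real (exp (- (\<delta> * norm \<xi>)\<^sup>2 / 2) * (norm (fourier_integral \<sigma> f \<xi>))\<^sup>2))
    = (LINT p|lborel. f (fst p) * cnj (f (snd p)) * complex_of_real (gaussian \<delta> (fst p - snd p)))"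
proof -
  have [measurable]: "f \<in> borel_measurable borel" using borel_measurable_integrable f by auto
  let ?C = "(2 * pi) powr (- real DIM('a) / 2)"
  let ?w = "\<lambda>\<xi>::'a. complex_of_real (exp (- (\<delta> * norm \<xi>)\<^sup>2 / 2))"
  let ?P = "\<lambda>p. f (fst p) * cnj (f (snd p))"
  let ?K = "\<lambda>\<xi> p. cis (\<sigma> * (\<xi> \<bullet> (fst p - snd p))) * (?w \<xi> * ?P p)"
  have C2: "?C * ?C * (2 * pi) ^ DIM('a) = 1"
  proof -
    have "(2 * pi) ^ DIM('a) = (2 * pi) powr DIM('a)" by (simp add: powr_realpow)
    then show ?thesis by (simp only: powr_add[symmetric]) simp
  qed
  have w: "integrable lborel ?w"
    using integrable_exp_norm[OF \<delta>] by (simp only: complex_of_real_integrable_eq)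
  have P: "integrable lborel ?P"
    by (rule integrable_product_lborel) (use f in auto)
  have "integrable lborel (\<lambda>q. ?w (fst q) * ?P (snd q))"
    by (rule integrable_product_lborel[OF w P])
  then have "integrable lborel (\<lambda>q. cis (\<sigma> * (fst q \<bullet> (fst (snd q) - snd (snd q)))) * (?w (fst q) * ?P (snd q)))"
    by (rule integrable_cis_mult)
      (intro borel_measurable_continuous_onI continuous_intros)
  then have K: "integrable (lborel \<Otimes>\<^sub>M lborel) (\<lambda>(\<xi>, p). ?K \<xi> p)"
    by (simp add: lborel_prod case_prod_unfold)
  have e: "complex_of_real (exp (- (\<delta> * norm \<xi>)\<^sup>2 / 2) * (norm (fourier_integral \<sigma> f \<xi>))\<^sup>2)
      = complex_of_real (?C * ?C) * (LINT p|lborel. ?K \<xi> p)" for \<xi>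
  proof -
    let ?a = "\<lambda>x. cis (\<sigma> * (\<xi> \<bullet> x)) * f x"
    have a: "integrable lborel ?a" by (rule integrable_cis_mult[OF f]) simp
    have "complex_of_real ((norm (fourier_integral \<sigma> f \<xi>))\<^sup>2)
        = complex_of_real (?C * ?C) * ((LINT x|lborel. ?a x) * (LINT x|lborel. cnj (?a x)))"
      by (simp only: complex_norm_square fourier_integral_def Bochner_Integration.integral_cnj complex_cnj_scaleR)
        (simp only: scaleR_conv_of_real of_real_mult mult_ac)
    also have "\<dots> = complex_of_real (?C * ?C) * (LINT p|lborel. ?a (fst p) * cnj (?a (snd p)))"
      by (subst integrable_product_lborel(2)[OF a]) (use integrable_cnj[of lborel ?a] a in blast)+
    finally have "complex_of_real ((norm (fourier_integral \<sigma> f \<xi>))\<^sup>2)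
       = complex_of_real (?C * ?C) * (LINT p|lborel. ?a (fst p) * cnj (?a (snd p)))" .
    moreover
    have K: "?K \<xi> p = ?w \<xi> * (?a (fst p) * cnj (?a (snd p)))" for p
    proof -
      have "cis (\<sigma> * (\<xi> \<bullet> (fst p - snd p))) = cis (\<sigma> * (\<xi> \<bullet> fst p)) * cnj (cis (\<sigma> * (\<xi> \<bullet> snd p)))"
        by (simp add: cis_cnj cis_mult inner_diff_right right_diff_distrib)
      then show ?thesis by (simp only: complex_cnj_mult mult_ac)
    qed
    have "(LINT p|lborel. ?K \<xi> p) = ?w \<xi> * (LINT p|lborel. ?a (fst p) * cnj (?a (snd p)))"
      by (simp only: K integral_mult_right_zero)
    ultimately show ?thesis
      by (simp only: of_real_mult mult.left_commute)
  qed
  have inner: "(LINT \<xi>|lborel. ?K \<xi> p) = complex_of_real ((2 * pi) ^ DIM('a)) * (?P p * complex_of_real (gaussian \<delta> (fst p - snd p)))" for p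
  proof -
    have "(LINT \<xi>|lborel. ?K \<xi> p) = (LINT \<xi>|lborel. ?P p * (cis (\<xi> \<bullet> (\<sigma> *\<^sub>R (fst p - snd p))) * ?w \<xi>))"
      by (simp add: mult.commute mult.left_commute)
    also have "\<dots> = ?P p * complex_of_real ((2 * pi) ^ DIM('a) * gaussian \<delta> (\<sigma> *\<^sub>R (fst p - snd p)))"
      by (subst integral_mult_right_zero) (simp only: integral_cis_gaussian(2)[OF \<delta>])
    also have "gaussian \<delta> (\<sigma> *\<^sub>R (fst p - snd p)) = gaussian \<delta> (fst p - snd p)"
      using \<sigma> gaussian_minus[of \<delta> "fst p - snd p"] by (auto simp: abs_if split: if_splits)
    finally show ?thesis by simp
  qed
  have "(LINT \<xi>|lborel. complex_of_real (exp (- (\<delta> * norm \<xi>)\<^sup>2 / 2) * (norm (fourier_integral \<sigma> f \<xi>))\<^sup>2))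
      = complex_of_real (?C * ?C) * (LINT \<xi>|lborel. LINT p|lborel. ?K \<xi> p)"
    by (simp only: e integral_mult_right_zero)
  also have "(LINT \<xi>|lborel. LINT p|lborel. ?K \<xi> p) = (LINT p|lborel. LINT \<xi>|lborel. ?K \<xi> p)"
    by (rule lborel_pair.Fubini_integral[OF K, symmetric])
  also have "\<dots> = complex_of_real ((2 * pi) ^ DIM('a)) * (LINT p|lborel. ?P p * complex_of_real (gaussian \<delta> (fst p - snd p)))"
    by (simp only: inner integral_mult_right_zero)
  also have "complex_of_real (?C * ?C) * \<dots> = complex_of_real (?C * ?C * (2 * pi) ^ DIM('a)) * (LINT p|lborel. ?P p * complex_of_real (gaussian \<delta> (fst p - snd p)))"
    by (simp only: of_real_mult mult.assoc)
  finally show ?thesis by (simp only: C2 of_real_1 mult_1_left)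
qed

text \<open>The left-hand side is a nonnegative real number, so the complex integral on the right equals its
  own norm.\<close>

lemma nn_integral_fourier_energy:
  fixes f :: "'a::euclidean_space \<Rightarrow> complex"
  assumes f: "integrable lborel f" and \<delta>: "\<delta> > 0" and \<sigma>: "\<bar>\<sigma>\<bar> = 1"
  shows "(\<integral>\<^sup>+\<xi>. ennreal (exp (- (\<delta> * norm \<xi>)\<^sup>2 / 2) * (norm (fourier_integral \<sigma> f \<xi>))\<^sup>2) \<partial>lborel)
    = ennreal (norm (LINT p|lborel. f (fst p) * cnj (f (snd p)) * complex_of_real (gaussian \<delta> (fst p - snd p))))"
proof -
  have [measurable]: "f \<in> borel_measurable borel" using borel_measurable_integrable f by auto
  let ?h = "\<lambda>\<xi>. exp (- (\<delta> * norm \<xi>)\<^sup>2 / 2) * (norm (fourier_integral \<sigma> f \<xi>))\<^sup>2"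
  obtain B where B: "\<And>\<xi>. norm (fourier_integral \<sigma> f \<xi>) \<le> B"
    using norm_fourier_integral_le by blast
  have "integrable lborel (\<lambda>\<xi>. exp (- (\<delta> * norm \<xi>)\<^sup>2 / 2) * B\<^sup>2)"
    by (intro integrable_mult_left integrable_exp_norm[OF \<delta>])
  then have "integrable lborel ?h"
    by (rule Bochner_Integration.integrable_bound) (auto intro!: power_mono B)
  then have "(\<integral>\<^sup>+\<xi>. ennreal (?h \<xi>) \<partial>lborel) = ennreal (LINT \<xi>|lborel. ?h \<xi>)"
    by (intro nn_integral_eq_integral) auto
  also have "(LINT \<xi>|lborel. ?h \<xi>) = norm (complex_of_real (LINT \<xi>|lborel. ?h \<xi>))"
    by (simp only: norm_of_real) (rule abs_of_nonneg[symmetric], simp)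
  also have "complex_of_real (LINT \<xi>|lborel. ?h \<xi>) = (LINT \<xi>|lborel. complex_of_real (?h \<xi>))"
    by (rule integral_complex_of_real[symmetric])
  finally show ?thesis
    by (simp only: fourier_energy_identity[OF assms])
qed

lemma nn_integral_fst_gaussian:
  fixes h :: "'a::euclidean_space \<Rightarrow> ennreal"
  assumes [measurable]: "h \<in> borel_measurable borel" and \<delta>: "\<delta> > 0"
  shows "(\<integral>\<^sup>+p. h (fst p) * ennreal (gaussian \<delta> (fst p - snd p)) \<partial>lborel) = (\<integral>\<^sup>+x. h x \<partial>lborel)"
    and "(\<integral>\<^sup>+p. h (snd p) * ennreal (gaussian \<delta> (fst p - snd p)) \<partial>lborel) = (\<integral>\<^sup>+x. h x \<partial>lborel)"
proof -
  have "(\<integral>\<^sup>+p. h (fst p) * ennreal (gaussian \<delta> (fst p - snd p)) \<partial>(lborel \<Otimes>\<^sub>M lborel))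
      = (\<integral>\<^sup>+x. \<integral>\<^sup>+y. h x * ennreal (gaussian \<delta> (x - y)) \<partial>lborel \<partial>lborel)"
    by (subst lborel.nn_integral_fst[symmetric]) auto
  then show "(\<integral>\<^sup>+p. h (fst p) * ennreal (gaussian \<delta> (fst p - snd p)) \<partial>lborel) = (\<integral>\<^sup>+x. h x \<partial>lborel)"
    by (simp add: lborel_prod nn_integral_cmult nn_integral_gaussian_translate[OF \<delta>])
  have sym: "gaussian \<delta> (x - y) = gaussian \<delta> (y - x)" for x y :: 'a
    using gaussian_minus[of \<delta> "x - y"] by simp
  have "(\<integral>\<^sup>+p. h (snd p) * ennreal (gaussian \<delta> (fst p - snd p)) \<partial>(lborel \<Otimes>\<^sub>M lborel))
      = (\<integral>\<^sup>+y. \<integral>\<^sup>+x. h y * ennreal (gaussian \<delta> (y - x)) \<partial>lborel \<partial>lborel)"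
    by (subst lborel_pair.nn_integral_snd[symmetric]) (auto simp: sym)
  then show "(\<integral>\<^sup>+p. h (snd p) * ennreal (gaussian \<delta> (fst p - snd p)) \<partial>lborel) = (\<integral>\<^sup>+x. h x \<partial>lborel)"
    by (simp add: lborel_prod nn_integral_cmult nn_integral_gaussian_translate[OF \<delta>])
qed

text \<open>Bound \<open>|f(x) f(y)|\<close> by \<open>(|f(x)|\<^sup>2 + |f(y)|\<^sup>2) / 2\<close>; the Gaussian has unit mass in each of the two
  variables.\<close>

lemma fourier_energy_le:
  fixes f :: "'a::euclidean_space \<Rightarrow> complex"
  assumes f: "integrable lborel f" and f2: "square_integrable f" and \<delta>: "\<delta> > 0" and \<sigma>: "\<bar>\<sigma>\<bar> = 1"
  shows "(\<integral>\<^sup>+\<xi>. ennreal (exp (- (\<delta> * norm \<xi>)\<^sup>2 / 2) * (norm (fourier_integral \<sigma> f \<xi>))\<^sup>2) \<partial>lborel)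
    \<le> ennreal ((l2_norm f)\<^sup>2)"
proof -
  have [measurable]: "f \<in> borel_measurable borel" using borel_measurable_integrable f by auto
  let ?g = "\<lambda>p. gaussian \<delta> (fst p - snd p)" and ?q = "\<lambda>x. ennreal ((norm (f x))\<^sup>2)"
  let ?F = "\<lambda>p. f (fst p) * cnj (f (snd p)) * complex_of_real (?g p)"
  have "ennreal (norm (LINT p|lborel. ?F p)) \<le> (\<integral>\<^sup>+p. ennreal (norm (?F p)) \<partial>lborel)"
    by (cases "integrable lborel ?F") (auto simp: not_integrable_integral_eq integral_norm_bound_ennreal)
  also have "\<dots> \<le> (\<integral>\<^sup>+p. ennreal (1/2) * (?q (fst p) * ennreal (?g p) + ?q (snd p) * ennreal (?g p)) \<partial>lborel)"
  proof (rule nn_integral_mono)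
    fix p :: "'a \<times> 'a"
    have "norm (f (fst p)) * norm (f (snd p)) \<le> 1/2 * ((norm (f (fst p)))\<^sup>2 + (norm (f (snd p)))\<^sup>2)"
      using sum_squares_bound[of "norm (f (fst p))" "norm (f (snd p))"] by simp
    then have "norm (?F p) \<le> 1/2 * ((norm (f (fst p)))\<^sup>2 + (norm (f (snd p)))\<^sup>2) * ?g p"
      by (simp only: norm_mult complex_mod_cnj norm_of_real abs_of_nonneg[OF gaussian_nonneg])
        (intro mult_right_mono, auto)
    then have "ennreal (norm (?F p)) \<le> ennreal (1/2 * ((norm (f (fst p)))\<^sup>2 * ?g p + (norm (f (snd p)))\<^sup>2 * ?g p))"
      by (intro ennreal_leI) (simp add: algebra_simps)
    also have "\<dots> = ennreal (1/2) * (?q (fst p) * ennreal (?g p) + ?q (snd p) * ennreal (?g p))"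
      by (simp only: ennreal_mult[symmetric] zero_le_power2 gaussian_nonneg ennreal_plus[symmetric] mult_nonneg_nonneg
          add_nonneg_nonneg)
    finally show "ennreal (norm (?F p)) \<le> \<dots>" .
  qed
  also have "\<dots> = ennreal (1/2) * ((\<integral>\<^sup>+x. ?q x \<partial>lborel) + (\<integral>\<^sup>+x. ?q x \<partial>lborel))"
    by (subst nn_integral_cmult, simp, subst nn_integral_add) (simp_all add: nn_integral_fst_gaussian[OF _ \<delta>, of ?q])
  also have "\<dots> = ennreal (1/2 * ((l2_norm f)\<^sup>2 + (l2_norm f)\<^sup>2))"
    by (simp only: nn_integral_norm_sq[OF f2] ennreal_plus[symmetric] zero_le_power2 ennreal_mult[symmetric])
      (subst ennreal_mult[symmetric], auto)
  finally show ?thesis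
    by (simp only: nn_integral_fourier_energy[OF f \<delta> \<sigma>]) simp
qed

text \<open>The Gaussian weights tend to one, and Fatou's lemma removes them.\<close>

lemma fourier_integral_contraction:
  fixes f :: "'a::euclidean_space \<Rightarrow> complex"
  assumes f: "integrable lborel f" and f2: "square_integrable f" and \<sigma>: "\<bar>\<sigma>\<bar> = 1"
  shows "square_integrable (fourier_integral \<sigma> f)" and "l2_norm (fourier_integral \<sigma> f) \<le> l2_norm f"
proof -
  have [measurable]: "f \<in> borel_measurable borel" using borel_measurable_integrable f by auto
  define \<delta> where "\<delta> n = 1 / real (Suc n)" for n
  have \<delta>: "\<delta> n > 0" for n by (simp add: \<delta>_def)
  have \<delta>0: "\<delta> \<longlonglongrightarrow> 0" unfolding \<delta>_def by (rule LIMSEQ_Suc[OF lim_1_over_n])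
  let ?h = "\<lambda>n \<xi>. exp (- (\<delta> n * norm \<xi>)\<^sup>2 / 4) *\<^sub>R fourier_integral \<sigma> f \<xi>"
  have "(\<integral>\<^sup>+\<xi>. ennreal ((norm (fourier_integral \<sigma> f \<xi>))\<^sup>2) \<partial>lborel) \<le> ennreal ((l2_norm f)\<^sup>2)"
  proof (rule nn_integral_norm_sq_Fatou[where f="?h"])
    have "(\<lambda>n. ?h n \<xi>) \<longlonglongrightarrow> exp (- (0 * norm \<xi>)\<^sup>2 / 4) *\<^sub>R fourier_integral \<sigma> f \<xi>" for \<xi>
      by (intro tendsto_intros \<delta>0) simp
    then show "AE \<xi> in lborel. (\<lambda>n. ?h n \<xi>) \<longlonglongrightarrow> fourier_integral \<sigma> f \<xi>"
      by simp
    have "(norm (?h n \<xi>))\<^sup>2 = exp (- (\<delta> n * norm \<xi>)\<^sup>2 / 2) * (norm (fourier_integral \<sigma> f \<xi>))\<^sup>2" for n \<xi>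
      by (simp add: power_mult_distrib exp_double[symmetric])
    then show "\<forall>\<^sub>F n in sequentially. (\<integral>\<^sup>+\<xi>. ennreal ((norm (?h n \<xi>))\<^sup>2) \<partial>lborel) \<le> ennreal ((l2_norm f)\<^sup>2)"
      using fourier_energy_le[OF f f2 \<delta> \<sigma>] by (simp del: norm_scaleR)
  qed measurable
  from square_integrable_nn_bound[OF _ this]
  show "square_integrable (fourier_integral \<sigma> f)" and "l2_norm (fourier_integral \<sigma> f) \<le> l2_norm f"
    by simp_all
qed

text \<open>The substitution \<open>y = x + \<delta> z\<close> turns the integrand into \<open>1\<^sub>U(x + \<delta> z)\<close> times a fixed Gaussian. Since \<open>U\<close> is
  open, the first factor is eventually one.\<close>

lemma nn_integral_gaussian_open_liminf:
  fixes U :: "'a::euclidean_space set"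
  assumes U: "open U" "x \<in> U" and \<delta>: "\<And>n. \<delta> n > 0" "\<delta> \<longlonglongrightarrow> 0"
  shows "1 \<le> liminf (\<lambda>n::nat. \<integral>\<^sup>+y. indicator U y * ennreal (gaussian (\<delta> n) (x - y)) \<partial>lborel)"
proof -
  have [measurable]: "U \<in> sets borel" using U by simp
  have eq: "(\<integral>\<^sup>+y. indicator U y * ennreal (gaussian (\<delta> n) (x - y)) \<partial>lborel)
      = (\<integral>\<^sup>+z. indicator U (x + \<delta> n *\<^sub>R z) * ennreal (gaussian 1 z) \<partial>lborel)" for n
  proof -
    let ?c = "ennreal (\<delta> n ^ DIM('a))"
    have "(\<integral>\<^sup>+y. indicator U y * ennreal (gaussian (\<delta> n) (x - y)) \<partial>lborel)
        = (\<integral>\<^sup>+z. ?c * (indicator U (x + \<delta> n *\<^sub>R z) * ennreal (gaussian (\<delta> n) (- (\<delta> n *\<^sub>R z)))) \<partial>lborel)"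
      using \<delta>(1)[of n]
      by (subst lborel_affine[of "\<delta> n" x]) (simp_all add: nn_integral_density nn_integral_distr)
    also have "\<dots> = (\<integral>\<^sup>+z. indicator U (x + \<delta> n *\<^sub>R z) * ennreal (gaussian 1 z) \<partial>lborel)"
    proof -
      have "ennreal (gaussian 1 z) = ?c * ennreal (gaussian (\<delta> n) (- (\<delta> n *\<^sub>R z)))" for z :: 'a
        using \<delta>(1)[of n] by (simp add: gaussian_scale[OF \<delta>(1)[of n], symmetric] ennreal_mult mult.commute)
      then show ?thesis by (simp only: mult_ac)
    qed
    finally show ?thesis .
  qed
  have "1 = (\<integral>\<^sup>+z. ennreal (gaussian 1 (z::'a)) \<partial>lborel)"
    using nn_integral_gaussian_translate[of 1 "0::'a"] by simp
  also have "\<dots> = (\<integral>\<^sup>+z. liminf (\<lambda>n. indicator U (x + \<delta> n *\<^sub>R z) * ennreal (gaussian 1 z)) \<partial>lborel)"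
  proof (intro nn_integral_cong)
    fix z :: 'a
    have "(\<lambda>n. x + \<delta> n *\<^sub>R z) \<longlonglongrightarrow> x + 0 *\<^sub>R z"
      by (intro tendsto_intros \<delta>)
    then have "\<forall>\<^sub>F n in sequentially. x + \<delta> n *\<^sub>R z \<in> U"
      using U by (intro topological_tendstoD[of _ x]) auto
    then have "\<forall>\<^sub>F n in sequentially. indicator U (x + \<delta> n *\<^sub>R z) * ennreal (gaussian 1 z) = ennreal (gaussian 1 z)"
      by eventually_elim simp
    then have "(\<lambda>n. indicator U (x + \<delta> n *\<^sub>R z) * ennreal (gaussian 1 z)) \<longlonglongrightarrow> ennreal (gaussian 1 z)"
      by (rule tendsto_eventually)
    then show "ennreal (gaussian 1 z) = liminf (\<lambda>n. indicator U (x + \<delta> n *\<^sub>R z) * ennreal (gaussian 1 z))"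
      by (metis lim_imp_Liminf sequentially_bot)
  qed
  also have "\<dots> \<le> liminf (\<lambda>n. \<integral>\<^sup>+z. indicator U (x + \<delta> n *\<^sub>R z) * ennreal (gaussian 1 z) \<partial>lborel)"
    by (rule nn_integral_liminf) simp
  finally show ?thesis by (simp only: eq)
qed

lemma integrable_indicator_complex:
  assumes "A \<in> sets borel" "emeasure lborel A < \<infinity>"
  shows "integrable lborel (indicator A :: 'a::euclidean_space \<Rightarrow> complex)"
    and "square_integrable (indicator A :: 'a \<Rightarrow> complex)"
    and "(l2_norm (indicator A :: 'a \<Rightarrow> complex))\<^sup>2 = measure lborel A"
proof -
  have e: "(norm (indicator A x :: complex))\<^sup>2 = indicator A x" for x
    by (simp add: indicator_def)
  show "integrable lborel (indicator A :: 'a \<Rightarrow> complex)"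
    using integrable_indicator[of A lborel "1::complex"] assms
    by (simp add: scaleR_conv_of_real of_real_indicator)
  show "square_integrable (indicator A :: 'a \<Rightarrow> complex)"
    using assms by (auto simp: square_integrable_def e intro!: borel_measurable_indicator)
  show "(l2_norm (indicator A :: 'a \<Rightarrow> complex))\<^sup>2 = measure lborel A"
    by (simp add: l2_norm_sq e)
qed

text \<open>One inequality is the contraction property. For the other, the regularized energy is the Gaussian
  mass of pairs of points of \<open>U\<close>, and in the limit every point of \<open>U\<close> has its nearby points in \<open>U\<close>.
  Boundary points do not enter, which is why open sets are the convenient class.\<close>

lemma fourier_integral_indicator_open:
  fixes U :: "'a::euclidean_space set"
  assumes U: "open U" "emeasure lborel U < \<infinity>" and \<sigma>: "\<bar>\<sigma>\<bar> = 1"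
  shows "l2_norm (fourier_integral \<sigma> (indicator U)) = l2_norm (indicator U :: 'a \<Rightarrow> complex)"
proof (rule antisym)
  have Ub [measurable]: "U \<in> sets borel" using U by simp
  note ind = integrable_indicator_complex[OF Ub U(2)]
  show "l2_norm (fourier_integral \<sigma> (indicator U)) \<le> l2_norm (indicator U :: 'a \<Rightarrow> complex)"
    by (rule fourier_integral_contraction(2)[OF ind(1,2) \<sigma>])
  define \<delta> where "\<delta> n = 1 / real (Suc n)" for n
  have \<delta>: "\<delta> n > 0" for n by (simp add: \<delta>_def)
  have \<delta>0: "\<delta> \<longlonglongrightarrow> 0" unfolding \<delta>_def by (rule LIMSEQ_Suc[OF lim_1_over_n])
  let ?E = "\<integral>\<^sup>+\<xi>. ennreal ((norm (fourier_integral \<sigma> (indicator U) \<xi>))\<^sup>2) \<partial>(lborel :: 'a measure)"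
  let ?I = "\<lambda>n x. \<integral>\<^sup>+y. indicator U y * ennreal (gaussian (\<delta> n) (x - y)) \<partial>lborel"
  have le: "(\<integral>\<^sup>+x. indicator U x * ?I n x \<partial>lborel) \<le> ?E" for n
  proof -
    let ?r = "\<lambda>p. indicator U (fst p) * indicator U (snd p) * gaussian (\<delta> n) (fst p - snd p)"
    have er: "ennreal (?r p) = indicator U (fst p) * (indicator U (snd p) * ennreal (gaussian (\<delta> n) (fst p - snd p)))" for p
      by (auto simp: indicator_def)
    have "(\<integral>\<^sup>+p. ennreal (?r p) \<partial>lborel) \<le> (\<integral>\<^sup>+p. indicator U (fst p) * ennreal (gaussian (\<delta> n) (fst p - snd p)) \<partial>lborel)"
      unfolding er by (intro nn_integral_mono) (auto simp: indicator_def)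
    also have "\<dots> = emeasure lborel U"
      by (simp add: nn_integral_fst_gaussian(1)[OF _ \<delta>])
    finally have fin: "(\<integral>\<^sup>+p. ennreal (?r p) \<partial>lborel) < \<infinity>"
      using U(2) by (rule le_less_trans)
    have ir: "integrable lborel ?r"
      by (rule integrableI_nonneg) (use fin in auto)
    have "(\<integral>\<^sup>+y. ennreal (?r (x, y)) \<partial>lborel) = indicator U x * ?I n x" for x
      unfolding er by (simp add: nn_integral_cmult)
    then have "(\<integral>\<^sup>+x. indicator U x * ?I n x \<partial>lborel) = (\<integral>\<^sup>+x. \<integral>\<^sup>+y. ennreal (?r (x, y)) \<partial>lborel \<partial>lborel)"
      by (simp only:)
    also have "\<dots> = (\<integral>\<^sup>+p. ennreal (?r p) \<partial>(lborel \<Otimes>\<^sub>M lborel))"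
      by (rule lborel.nn_integral_fst) simp
    also have "\<dots> = ennreal (LINT p|lborel. ?r p)"
      unfolding lborel_prod by (rule nn_integral_eq_integral[OF ir]) simp
    also have "(LINT p|lborel. ?r p) \<le> norm (complex_of_real (LINT p|lborel. ?r p))"
      by simp
    also have "complex_of_real (LINT p|lborel. ?r p) = (LINT p|lborel. complex_of_real (?r p))"
      by (rule integral_complex_of_real[symmetric])
    also have "\<dots> = (LINT p|lborel. indicator U (fst p) * cnj (indicator U (snd p)) * complex_of_real (gaussian (\<delta> n) (fst p - snd p)))"
      by (intro Bochner_Integration.integral_cong) (auto simp: indicator_def)
    also have "ennreal (norm \<dots>) = (\<integral>\<^sup>+\<xi>. ennreal (exp (- (\<delta> n * norm \<xi>)\<^sup>2 / 2) * (norm (fourier_integral \<sigma> (indicator U) \<xi>))\<^sup>2) \<partial>lborel)"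
      by (rule nn_integral_fourier_energy[OF ind(1) \<delta> \<sigma>, symmetric])
    also have "\<dots> \<le> ?E"
      by (intro nn_integral_mono ennreal_leI mult_left_le_one_le) auto
    finally show ?thesis by (simp add: ennreal_leI)
  qed
  have "ennreal ((l2_norm (indicator U :: 'a \<Rightarrow> complex))\<^sup>2) = emeasure lborel U"
    using U(2) by (simp add: ind(3) emeasure_eq_ennreal_measure)
  also have "\<dots> = (\<integral>\<^sup>+x. indicator U x \<partial>lborel)"
    by simp
  also have "\<dots> \<le> (\<integral>\<^sup>+x. liminf (\<lambda>n. indicator U x * ?I n x) \<partial>lborel)"
  proof (intro nn_integral_mono)
    fix x
    show "indicator U x \<le> liminf (\<lambda>n. indicator U x * ?I n x)"
      using nn_integral_gaussian_open_liminf[OF U(1) _ \<delta> \<delta>0, of x] by (cases "x \<in> U") auto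
  qed
  also have "\<dots> \<le> liminf (\<lambda>n. \<integral>\<^sup>+x. indicator U x * ?I n x \<partial>lborel)"
    by (rule nn_integral_liminf) measurable
  also have "\<dots> \<le> limsup (\<lambda>n. \<integral>\<^sup>+x. indicator U x * ?I n x \<partial>lborel)"
    by (simp add: Liminf_le_Limsup)
  also have "\<dots> \<le> ?E"
    by (rule Limsup_bounded) (simp add: le)
  also have "\<dots> = ennreal ((l2_norm (fourier_integral \<sigma> (indicator U :: 'a \<Rightarrow> complex)))\<^sup>2)"
    by (rule nn_integral_norm_sq[OF fourier_integral_contraction(1)[OF ind(1,2) \<sigma>]])
  finally have "(l2_norm (indicator U :: 'a \<Rightarrow> complex))\<^sup>2 \<le> (l2_norm (fourier_integral \<sigma> (indicator U :: 'a \<Rightarrow> complex)))\<^sup>2"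
    by simp
  then show "l2_norm (indicator U :: 'a \<Rightarrow> complex) \<le> l2_norm (fourier_integral \<sigma> (indicator U :: 'a \<Rightarrow> complex))"
    by (rule power2_le_imp_le) simp
qed

text \<open>The isometric functions form a subspace: since the Fourier integral is a contraction, the
  defect \<open>\<parallel>f\<parallel>\<^sup>2 - \<parallel>F f\<parallel>\<^sup>2\<close> is a nonnegative quadratic form, and by the parallelogram law its
  zeros are closed under addition.\<close>

definition fourier_isometric :: "real \<Rightarrow> ('a::euclidean_space \<Rightarrow> complex) \<Rightarrow> bool" where
  "fourier_isometric \<sigma> f \<longleftrightarrow> integrable lborel f \<and> square_integrable f \<and>
     l2_norm (fourier_integral \<sigma> f) = l2_norm f"

lemma fourier_isometric_add:
  assumes \<sigma>: "\<bar>\<sigma>\<bar> = 1" and f: "fourier_isometric \<sigma> f" and g: "fourier_isometric \<sigma> g"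
  shows "fourier_isometric \<sigma> (\<lambda>x. f x + g x)"
proof -
  let ?F = "fourier_integral \<sigma>"
  have if_: "integrable lborel f" "square_integrable f" "l2_norm (?F f) = l2_norm f"
    and ig: "integrable lborel g" "square_integrable g" "l2_norm (?F g) = l2_norm g"
    using f g by (auto simp: fourier_isometric_def)
  have sF: "square_integrable (?F f)" "square_integrable (?F g)"
    using fourier_integral_contraction(1)[OF _ _ \<sigma>] if_ ig by auto
  let ?s = "\<lambda>x. f x + g x" and ?d = "\<lambda>x. f x - g x"
  have add: "?F ?s = (\<lambda>\<xi>. ?F f \<xi> + ?F g \<xi>)" and diff: "?F ?d = (\<lambda>\<xi>. ?F f \<xi> - ?F g \<xi>)"
    using fourier_integral_add[OF if_(1) ig(1)] fourier_integral_diff[OF if_(1) ig(1)] by auto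
  have le: "l2_norm (?F ?s) \<le> l2_norm ?s" "l2_norm (?F ?d) \<le> l2_norm ?d"
    using if_ ig by (auto intro!: fourier_integral_contraction(2)[OF _ _ \<sigma>] square_integrable_intros)
  have "(l2_norm (?F ?s))\<^sup>2 + (l2_norm (?F ?d))\<^sup>2 = (l2_norm ?s)\<^sup>2 + (l2_norm ?d)\<^sup>2"
    unfolding add diff using sF if_ ig by (simp add: l2_norm_add_sq l2_norm_diff_sq)
  moreover have "(l2_norm (?F ?s))\<^sup>2 \<le> (l2_norm ?s)\<^sup>2" "(l2_norm (?F ?d))\<^sup>2 \<le> (l2_norm ?d)\<^sup>2"
    using le by (auto intro: power_mono)
  ultimately have "(l2_norm (?F ?s))\<^sup>2 = (l2_norm ?s)\<^sup>2" by linarith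
  then have "l2_norm (?F ?s) = l2_norm ?s"
    by (rule power2_eq_imp_eq) auto
  then show ?thesis
    using if_ ig by (simp add: fourier_isometric_def square_integrable_intros)
qed

lemma l2_norm_cmult: "l2_norm (\<lambda>x. c * f x :: complex) = norm c * l2_norm f"
  by (simp add: l2_norm_def norm_mult power_mult_distrib real_sqrt_mult)

lemma square_integrable_cmult:
  "square_integrable f \<Longrightarrow> square_integrable (\<lambda>x. c * f x :: complex)"
  by (rule square_integrable_bound[where g=f and C="norm c"])
    (auto simp: norm_mult intro: square_integrable_measurable)

lemma fourier_isometric_cmult:
  assumes "fourier_isometric \<sigma> f"
  shows "fourier_isometric \<sigma> (\<lambda>x. c * f x)"
proof -
  have "fourier_integral \<sigma> (\<lambda>x. c * f x) = (\<lambda>\<xi>. c * fourier_integral \<sigma> f \<xi>)"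
    by (simp add: fourier_integral_cmult fun_eq_iff)
  then show ?thesis
    using assms by (simp add: fourier_isometric_def square_integrable_cmult l2_norm_cmult)
qed

lemma fourier_isometric_sum:
  fixes f :: "'i \<Rightarrow> 'a::euclidean_space \<Rightarrow> complex"
  assumes \<sigma>: "\<bar>\<sigma>\<bar> = 1" and "finite I" "\<And>i. i \<in> I \<Longrightarrow> fourier_isometric \<sigma> (f i)"
  shows "fourier_isometric \<sigma> (\<lambda>x. \<Sum>i\<in>I. f i x)"
  using assms(2,3)
proof (induction I rule: finite_induct)
  case empty
  have "fourier_integral \<sigma> (\<lambda>x::'a. 0) = (\<lambda>\<xi>. 0)"
    by (simp add: fourier_integral_def fun_eq_iff)
  then show ?case by (simp add: fourier_isometric_def l2_norm_def)
next
  case (insert i I)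
  then show ?case by (simp add: fourier_isometric_add[OF \<sigma>])
qed

lemma fourier_isometric_limit:
  assumes \<sigma>: "\<bar>\<sigma>\<bar> = 1" and f: "\<And>n. fourier_isometric \<sigma> (f n)"
    and g: "integrable lborel g" "square_integrable g"
    and lim: "(\<lambda>n. l2_norm (\<lambda>x. f n x - g x)) \<longlonglongrightarrow> 0"
  shows "fourier_isometric \<sigma> g"
proof -
  let ?F = "fourier_integral \<sigma>"
  have fn: "integrable lborel (f n)" "square_integrable (f n)" "l2_norm (?F (f n)) = l2_norm (f n)" for n
    using f[of n] by (auto simp: fourier_isometric_def)
  have sF: "square_integrable (?F (f n))" "square_integrable (?F g)" for n
    using fourier_integral_contraction(1)[OF _ _ \<sigma>] fn g by auto
  have "l2_norm g \<le> l2_norm (?F g) + 2 * l2_norm (\<lambda>x. f n x - g x)" for n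
  proof -
    have "l2_norm (\<lambda>\<xi>. ?F (f n) \<xi> - ?F g \<xi>) = l2_norm (?F (\<lambda>x. f n x - g x))"
      by (intro arg_cong[of _ _ l2_norm]) (auto simp: fourier_integral_diff[OF fn(1) g(1)])
    also have "\<dots> \<le> l2_norm (\<lambda>x. f n x - g x)"
      using fn g by (intro fourier_integral_contraction(2)[OF _ _ \<sigma>] square_integrable_intros) auto
    finally have "l2_norm (\<lambda>\<xi>. ?F (f n) \<xi> - ?F g \<xi>) \<le> l2_norm (\<lambda>x. f n x - g x)" .
    with l2_norm_triangle_rev[OF sF(1)[of n] sF(2)] l2_norm_triangle_rev[OF fn(2)[of n] g(2)] fn(3)[of n]
    show ?thesis by linarith
  qed
  then have "l2_norm g \<le> l2_norm (?F g) + 2 * 0"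
    by (intro LIMSEQ_le_const[OF tendsto_add[OF tendsto_const tendsto_mult[OF tendsto_const lim]]]) auto
  moreover have "l2_norm (?F g) \<le> l2_norm g"
    by (rule fourier_integral_contraction(2)[OF g \<sigma>])
  ultimately show ?thesis using g by (simp add: fourier_isometric_def)
qed

text \<open>Outer regularity approximates the set in measure, hence its indicator in \<open>L\<^sup>2\<close>, by open sets.\<close>

lemma fourier_isometric_indicator:
  fixes A :: "'a::euclidean_space set"
  assumes \<sigma>: "\<bar>\<sigma>\<bar> = 1" and A: "A \<in> sets borel" "emeasure lborel A < \<infinity>"
  shows "fourier_isometric \<sigma> (indicator A)"
proof -
  have "\<exists>U. open U \<and> A \<subseteq> U \<and> emeasure lborel (U - A) < ennreal (1 / real (Suc n))" for n
    using outer_regular_lborel[OF A(1), of "1 / real (Suc n)"] by (metis of_nat_0_less_iff zero_less_Suc zero_less_divide_1_iff)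
  then obtain U where U: "\<And>n. open (U n)" "\<And>n. A \<subseteq> U n"
      "\<And>n. emeasure lborel (U n - A) < ennreal (1 / real (Suc n))" by metis
  have fin: "emeasure lborel (U n) < \<infinity>" "emeasure lborel (U n - A) < \<infinity>" for n
  proof -
    show D: "emeasure lborel (U n - A) < \<infinity>"
      using U(3)[of n] by (rule less_trans) simp
    have "emeasure lborel (U n) = emeasure lborel A + emeasure lborel (U n - A)"
      using U A by (subst plus_emeasure) (auto intro: arg_cong[of _ _ "emeasure lborel"])
    then show "emeasure lborel (U n) < \<infinity>" using A D by simp
  qed
  have Ub: "U n \<in> sets borel" "U n - A \<in> sets borel" for n using U A by auto
  note indA = integrable_indicator_complex[OF A]
  note indU = integrable_indicator_complex[OF Ub(1) fin(1)]
  have iso: "fourier_isometric \<sigma> (indicator (U n) :: 'a \<Rightarrow> complex)" for n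
    using fourier_integral_indicator_open[OF U(1) fin(1) \<sigma>] indU by (simp add: fourier_isometric_def)
  have d: "l2_norm (\<lambda>x. indicator (U n) x - indicator A x :: complex) \<le> sqrt (1 / real (Suc n))" for n
  proof -
    have "(\<lambda>x. indicator (U n) x - indicator A x :: complex) = indicator (U n - A)"
      using U(2)[of n] by (auto simp: indicator_def fun_eq_iff)
    then have "(l2_norm (\<lambda>x. indicator (U n) x - indicator A x :: complex))\<^sup>2 = measure lborel (U n - A)"
      using integrable_indicator_complex(3)[OF Ub(2) fin(2)] by simp
    also have "\<dots> \<le> 1 / real (Suc n)"
      using U(3)[of n] fin(2)[of n] by (simp add: emeasure_eq_ennreal_measure ennreal_less_iff)
    finally show ?thesis by (simp add: real_le_rsqrt)
  qed
  have "(\<lambda>n. sqrt (1 / real (Suc n))) \<longlonglongrightarrow> 0"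
    using tendsto_real_sqrt[OF LIMSEQ_Suc[OF lim_1_over_n]] by simp
  then have "(\<lambda>n. l2_norm (\<lambda>x. indicator (U n) x - indicator A x :: complex)) \<longlonglongrightarrow> 0"
    by (rule Lim_null_comparison[rotated]) (use d in simp)
  from fourier_isometric_limit[OF \<sigma> iso indA(1,2) this] show ?thesis .
qed

lemma fourier_isometric_simple:
  fixes s :: "'a::euclidean_space \<Rightarrow> complex"
  assumes \<sigma>: "\<bar>\<sigma>\<bar> = 1" and s: "simple_function lborel s" "integrable lborel s"
  shows "fourier_isometric \<sigma> s"
proof -
  have sm: "s -` {y} \<in> sets borel" for y
    using simple_functionD(2)[OF s(1), of "{y}"] by simp
  have "fourier_isometric \<sigma> (\<lambda>x. \<Sum>y\<in>range s. y * indicator (s -` {y}) x)"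
  proof (rule fourier_isometric_sum[OF \<sigma>])
    show "finite (range s)" using simple_functionD(1)[OF s(1)] by simp
    fix y
    show "fourier_isometric \<sigma> (\<lambda>x. y * indicator (s -` {y}) x)"
    proof (cases "y = 0")
      case True
      then show ?thesis using fourier_isometric_sum[OF \<sigma>, of "{}"] by simp
    next
      case False
      have "ennreal (norm y) * emeasure lborel (s -` {y}) = (\<integral>\<^sup>+x. ennreal (norm y) * indicator (s -` {y}) x \<partial>lborel)"
        using sm[of y] by (simp add: nn_integral_cmult_indicator)
      also have "\<dots> \<le> (\<integral>\<^sup>+x. ennreal (norm (s x)) \<partial>lborel)"
        by (intro nn_integral_mono) (auto simp: indicator_def)
      also have "\<dots> < \<infinity>"
        using s(2) by (simp add: integrable_iff_bounded)
      finally have "emeasure lborel (s -` {y}) < \<infinity>"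
        using False by (auto simp: ennreal_mult_less_top)
      then show ?thesis
        by (intro fourier_isometric_cmult fourier_isometric_indicator[OF \<sigma> sm])
    qed
  qed
  moreover have "(\<Sum>y\<in>range s. y * indicator (s -` {y}) x) = s x" for x
  proof -
    have "(\<Sum>y\<in>range s. y * indicator (s -` {y}) x) = (\<Sum>y\<in>range s. if y = s x then s x else 0)"
      by (intro sum.cong) (auto simp: indicator_def)
    also have "\<dots> = s x"
      using simple_functionD(1)[OF s(1)] by (simp add: sum.delta)
    finally show ?thesis .
  qed
  ultimately show ?thesis by simp
qed

text \<open>Plancherel's identity on \<open>L\<^sup>1 \<inter> L\<^sup>2\<close>, by density of the simple functions.\<close>

theorem fourier_integral_isometry:
  fixes f :: "'a::euclidean_space \<Rightarrow> complex"
  assumes \<sigma>: "\<bar>\<sigma>\<bar> = 1" and f: "integrable lborel f" "square_integrable f"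
  shows "l2_norm (fourier_integral \<sigma> f) = l2_norm f"
proof -
  have fm [measurable]: "f \<in> borel_measurable borel" using f square_integrable_measurable by blast
  obtain s where s: "\<And>i. simple_function lborel (s i)" "\<And>x. (\<lambda>i. s i x) \<longlonglongrightarrow> f x"
      "\<And>i x. norm (s i x) \<le> 2 * norm (f x)"
    using borel_measurable_implies_sequence_metric[of f lborel 0] fm by auto
  have sm [measurable]: "s i \<in> borel_measurable borel" for i
    using borel_measurable_simple_function[OF s(1)[of i]] by simp
  have si: "integrable lborel (s i)" for i
    by (rule Bochner_Integration.integrable_bound[of _ "\<lambda>x. 2 * f x"])
      (use f s(3) in \<open>auto simp: norm_mult\<close>)
  have iso: "fourier_isometric \<sigma> (s i)" for i
    by (rule fourier_isometric_simple[OF \<sigma> s(1) si])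
  have "(\<lambda>i. LINT x|lborel. (norm (s i x - f x))\<^sup>2) \<longlonglongrightarrow> (LINT x|(lborel :: 'a measure). 0)"
  proof (rule integral_dominated_convergence[where w="\<lambda>x. 9 * (norm (f x))\<^sup>2"])
    show "integrable lborel (\<lambda>x. 9 * (norm (f x))\<^sup>2)"
      using f by (simp add: square_integrable_def)
    have "(\<lambda>i. (norm (s i x - f x))\<^sup>2) \<longlonglongrightarrow> (norm (f x - f x))\<^sup>2" for x
      by (intro tendsto_intros s(2))
    then show "AE x in lborel. (\<lambda>i. (norm (s i x - f x))\<^sup>2) \<longlonglongrightarrow> 0" by simp
    have "norm (s i x - f x) \<le> 3 * norm (f x)" for i x
      using norm_triangle_ineq4[of "s i x" "f x"] s(3)[of i x] by simp
    then have "(norm (s i x - f x))\<^sup>2 \<le> (3 * norm (f x))\<^sup>2" for i x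
      by (rule power_mono) simp
    then show "AE x in lborel. norm ((norm (s i x - f x))\<^sup>2) \<le> 9 * (norm (f x))\<^sup>2" for i
      by (simp add: power_mult_distrib)
  qed measurable
  then have "(\<lambda>i. sqrt (LINT x|lborel. (norm (s i x - f x))\<^sup>2)) \<longlonglongrightarrow> sqrt 0"
    by (intro tendsto_real_sqrt) simp
  then have "(\<lambda>i. l2_norm (\<lambda>x. s i x - f x)) \<longlonglongrightarrow> 0"
    by (simp add: l2_norm_def)
  from fourier_isometric_limit[OF \<sigma> iso f this]
  show ?thesis by (simp add: fourier_isometric_def)
qed

text \<open>Fubini's theorem; conjugating the kernel \<open>cis (\<sigma> (\<xi> \<bullet> x))\<close> reverses the sign \<open>\<sigma>\<close>.\<close>

lemma fourier_integral_adjoint: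
  fixes f g :: "'a::euclidean_space \<Rightarrow> complex"
  assumes f: "integrable lborel f" and g: "integrable lborel g"
  shows "l2_inner (fourier_integral \<sigma> f) g = l2_inner f (fourier_integral (- \<sigma>) g)"
proof -
  have [measurable]: "f \<in> borel_measurable borel" "g \<in> borel_measurable borel"
    using borel_measurable_integrable f g by auto
  let ?C = "(2 * pi) powr (- real DIM('a) / 2)"
  let ?K = "\<lambda>\<xi> x. cis (\<sigma> * (\<xi> \<bullet> x)) * (cnj (g \<xi>) * f x)"
  have re: "a \<bullet> b = Re (a * cnj b)" for a b :: complex
    by (simp add: inner_complex_def)
  have "integrable lborel (\<lambda>p. cnj (g (fst p)) * f (snd p))"
    by (rule integrable_product_lborel(1)) (use f g in auto)
  then have "integrable lborel (\<lambda>p. cis (\<sigma> * (fst p \<bullet> snd p)) * (cnj (g (fst p)) * f (snd p)))"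
    by (rule integrable_cis_mult) (intro borel_measurable_continuous_onI continuous_intros)
  then have K: "integrable (lborel \<Otimes>\<^sub>M lborel) (\<lambda>(\<xi>, x). ?K \<xi> x)"
    by (simp add: lborel_prod case_prod_unfold)
  have int1: "integrable lborel (\<lambda>\<xi>. fourier_integral \<sigma> f \<xi> * cnj (g \<xi>))"
   and int2: "integrable lborel (\<lambda>x. f x * cnj (fourier_integral (- \<sigma>) g x))"
  proof -
    have B: "integrable lborel (\<lambda>\<xi>. k \<xi> * fourier_integral \<tau> h \<xi>)"
      if "integrable lborel k" "h \<in> borel_measurable borel" for k :: "'a \<Rightarrow> complex" and h \<tau>
    proof -
      have [measurable]: "k \<in> borel_measurable borel" "h \<in> borel_measurable borel"
        using that borel_measurable_integrable by auto
      let ?B = "(2 * pi) powr (- real DIM('a) / 2) * (LINT x|lborel. norm (h x))"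
      show ?thesis
        by (rule Bochner_Integration.integrable_bound[of _ "\<lambda>\<xi>. k \<xi> * complex_of_real ?B"])
          (use that norm_fourier_integral_le[of \<tau> h] in \<open>auto simp: norm_mult intro!: mult_left_mono\<close>)
    qed
    show "integrable lborel (\<lambda>\<xi>. fourier_integral \<sigma> f \<xi> * cnj (g \<xi>))"
      using B[of "\<lambda>\<xi>. cnj (g \<xi>)" f \<sigma>] g by (simp add: mult.commute)
    have "integrable lborel (\<lambda>x. cnj (cnj (f x) * fourier_integral (- \<sigma>) g x))"
      using B[of "\<lambda>\<xi>. cnj (f \<xi>)" g "-\<sigma>"] f by (subst complex_integrable_cnj) simp
    then show "integrable lborel (\<lambda>x. f x * cnj (fourier_integral (- \<sigma>) g x))" by simp
  qed
  have "(LINT \<xi>|lborel. fourier_integral \<sigma> f \<xi> * cnj (g \<xi>)) = ?C * (LINT \<xi>|lborel. LINT x|lborel. ?K \<xi> x)"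
  proof -
    have "fourier_integral \<sigma> f \<xi> * cnj (g \<xi>) = ?C * (LINT x|lborel. ?K \<xi> x)" for \<xi>
    proof -
      have "(LINT x|lborel. ?K \<xi> x) = cnj (g \<xi>) * (LINT x|lborel. cis (\<sigma> * (\<xi> \<bullet> x)) * f x)"
        by (subst integral_mult_right_zero[symmetric], intro Bochner_Integration.integral_cong refl)
          (simp add: mult_ac)
      then show ?thesis
        by (simp add: fourier_integral_def scaleR_conv_of_real)
    qed
    then show ?thesis by (simp only: integral_mult_right_zero[symmetric])
  qed
  also have "(LINT \<xi>|lborel. LINT x|lborel. ?K \<xi> x) = (LINT x|lborel. LINT \<xi>|lborel. ?K \<xi> x)"
    by (rule lborel_pair.Fubini_integral[OF K, symmetric])
  also have "?C * \<dots> = (LINT x|lborel. f x * cnj (fourier_integral (- \<sigma>) g x))"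
  proof -
    have "?C * (LINT \<xi>|lborel. ?K \<xi> x) = f x * cnj (fourier_integral (- \<sigma>) g x)" for x
    proof -
      have "(LINT \<xi>|lborel. ?K \<xi> x) = f x * (LINT \<xi>|lborel. cnj (cis ((- \<sigma>) * (x \<bullet> \<xi>)) * g \<xi>))"
        by (subst integral_mult_right_zero[symmetric], intro Bochner_Integration.integral_cong refl)
          (simp add: cis_cnj inner_commute mult_ac)
      then show ?thesis
        by (simp only: fourier_integral_def Bochner_Integration.integral_cnj complex_cnj_scaleR) (simp add: scaleR_conv_of_real)
    qed
    then show ?thesis by (simp only: integral_mult_right_zero[symmetric])
  qed
  finally have *: "(LINT \<xi>|lborel. fourier_integral \<sigma> f \<xi> * cnj (g \<xi>)) = (LINT x|lborel. f x * cnj (fourier_integral (- \<sigma>) g x))" .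
  show ?thesis
    unfolding l2_inner_def re integral_bounded_linear[OF bounded_linear_Re int1]
      integral_bounded_linear[OF bounded_linear_Re int2] by (rule arg_cong[OF *])
qed

section \<open>Plancherel's theorem for vector fields\<close>

lemma L2_iff: "L2 f \<longleftrightarrow> square_integrable f"
  by (simp add: L2_def square_integrable_def)

lemma L2_norm_eq: "L2_norm f = l2_norm f"
  by (simp add: L2_norm_def l2_norm_def)

lemma borel_measurable_vec_nth [measurable]:
  "(\<lambda>v::'b::euclidean_space^'n. v $ i) \<in> borel_measurable borel"
  by (intro borel_measurable_continuous_onI continuous_intros)

lemma borel_measurable_vecI:
  fixes f :: "'x \<Rightarrow> 'b::euclidean_space^'n"
  assumes [measurable]: "\<And>i. (\<lambda>x. f x $ i) \<in> borel_measurable M"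
  shows "f \<in> borel_measurable M"
proof (subst borel_measurable_euclidean_space, intro ballI)
  fix b :: "'b^'n" assume "b \<in> Basis"
  then obtain i u where b: "b = axis i u" by (auto simp: Basis_vec_def)
  have "(\<lambda>x. f x $ i \<bullet> u) \<in> borel_measurable M" by measurable
  then show "(\<lambda>x. f x \<bullet> b) \<in> borel_measurable M" by (simp add: b inner_axis)
qed

lemma norm_vec_sq: "(norm (v::'b::euclidean_space^'n))\<^sup>2 = (\<Sum>i\<in>UNIV. (norm (v $ i))\<^sup>2)"
  by (simp add: norm_vec_def L2_set_def sum_nonneg)

lemma norm_smult_vec: "norm (c *s (v::complex^'n)) = norm c * norm v"
proof -
  have "(norm (c *s v))\<^sup>2 = (norm c * norm v)\<^sup>2"
    by (simp add: norm_vec_sq power_mult_distrib norm_mult sum_distrib_left)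
  then show ?thesis by (rule power2_eq_imp_eq) auto
qed

lemma borel_measurable_smult_vec [measurable]:
  fixes f :: "'x \<Rightarrow> complex^'n"
  assumes [measurable]: "c \<in> borel_measurable M" "f \<in> borel_measurable M"
  shows "(\<lambda>x. c x *s f x) \<in> borel_measurable M"
  by (rule borel_measurable_vecI) simp

lemma square_integrable_component:
  fixes f :: "'a::euclidean_space \<Rightarrow> 'b::euclidean_space^'n"
  assumes "square_integrable f"
  shows "square_integrable (\<lambda>x. f x $ i)"
proof (rule square_integrable_bound[OF _ assms, where C=1])
  show "(\<lambda>x. f x $ i) \<in> borel_measurable borel"
    using assms by measurable
qed (simp add: component_le_norm_cart Finite_Cartesian_Product.norm_nth_le)

lemma l2_inner_components:
  fixes f g :: "'a::euclidean_space \<Rightarrow> 'b::euclidean_space^'n"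
  assumes "square_integrable f" "square_integrable g"
  shows "l2_inner f g = (\<Sum>i\<in>UNIV. l2_inner (\<lambda>x. f x $ i) (\<lambda>x. g x $ i))"
  unfolding l2_inner_def inner_vec_def
  by (rule Bochner_Integration.integral_sum)
    (intro square_integrable_inner square_integrable_component assms)

definition vector_fourier_integral :: "real \<Rightarrow> cfield \<Rightarrow> cfield" where
  "vector_fourier_integral \<sigma> f \<xi> = (2 * pi) powr (-3/2) *\<^sub>R (LINT x|lborel. cis (\<sigma> * (\<xi> \<bullet> x)) *s f x)"

lemma integrable_cis_smult:
  fixes f :: "'a::euclidean_space \<Rightarrow> complex^'n"
  assumes f: "integrable lborel f" and h: "h \<in> borel_measurable borel"
  shows "integrable lborel (\<lambda>x. cis (h x) *s f x)"
proof -
  have [measurable]: "f \<in> borel_measurable borel" "h \<in> borel_measurable borel"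
    using borel_measurable_integrable[OF f] h by auto
  show ?thesis
    by (rule Bochner_Integration.integrable_bound[OF f]) (auto simp: norm_smult_vec)
qed

lemma vector_fourier_integral_component:
  assumes "integrable lborel f"
  shows "vector_fourier_integral \<sigma> f \<xi> $ i = fourier_integral \<sigma> (\<lambda>x. f x $ i) \<xi>"
proof -
  have "(LINT x|lborel. cis (\<sigma> * (\<xi> \<bullet> x)) *s f x) $ i = (LINT x|lborel. (cis (\<sigma> * (\<xi> \<bullet> x)) *s f x) $ i)"
    by (rule integral_bounded_linear[symmetric]) (auto intro!: integrable_cis_smult assms)
  then show ?thesis
    by (simp add: vector_fourier_integral_def fourier_integral_def)
qed

lemma integrable_component:
  fixes f :: "'a::euclidean_space \<Rightarrow> 'b::euclidean_space^'n"
  shows "integrable lborel f \<Longrightarrow> integrable lborel (\<lambda>x. f x $ i)"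
  by (rule integrable_bounded_linear[OF bounded_linear_vec_nth])

lemma vector_fourier_integral_diff:
  assumes "integrable lborel f" "integrable lborel g"
  shows "vector_fourier_integral \<sigma> (\<lambda>x. f x - g x) \<xi> = vector_fourier_integral \<sigma> f \<xi> - vector_fourier_integral \<sigma> g \<xi>"
  using assms by (simp add: vec_eq_iff vector_fourier_integral_component fourier_integral_diff integrable_component)

lemma vector_fourier_integral_measurable [measurable]:
  assumes [measurable]: "f \<in> borel_measurable borel"
  shows "vector_fourier_integral \<sigma> f \<in> borel_measurable borel"
  unfolding vector_fourier_integral_def by measurable

lemma vector_fourier_integral_isometry:
  assumes \<sigma>: "\<bar>\<sigma>\<bar> = 1" and f: "integrable lborel f" "square_integrable f"
  shows "square_integrable (vector_fourier_integral \<sigma> f)"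
    and "l2_norm (vector_fourier_integral \<sigma> f) = l2_norm f"
proof -
  let ?F = "vector_fourier_integral \<sigma> f"
  have [measurable]: "f \<in> borel_measurable borel" using f square_integrable_measurable by blast
  have c: "(\<lambda>\<xi>. ?F \<xi> $ i) = fourier_integral \<sigma> (\<lambda>x. f x $ i)" for i
    by (simp add: fun_eq_iff vector_fourier_integral_component[OF f(1)])
  have sc: "square_integrable (\<lambda>\<xi>. ?F \<xi> $ i)" for i
    unfolding c by (intro fourier_integral_contraction(1)[OF _ _ \<sigma>] integrable_component square_integrable_component f)
  show sF: "square_integrable ?F"
    using square_integrable_integrable[OF sc]
    by (intro square_integrable_dominated[where g="\<lambda>\<xi>. \<Sum>i\<in>UNIV. (norm (?F \<xi> $ i))\<^sup>2"])
      (auto simp: norm_vec_sq)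
  have "(l2_norm ?F)\<^sup>2 = (\<Sum>i\<in>UNIV. (l2_norm (\<lambda>\<xi>. ?F \<xi> $ i))\<^sup>2)"
    by (simp add: l2_norm_sq_inner l2_inner_components[OF sF sF])
  also have "\<dots> = (\<Sum>i\<in>UNIV. (l2_norm (\<lambda>x. f x $ i))\<^sup>2)"
    unfolding c by (simp add: fourier_integral_isometry[OF \<sigma>] integrable_component square_integrable_component f)
  also have "\<dots> = (l2_norm f)\<^sup>2"
    by (simp add: l2_norm_sq_inner l2_inner_components[OF f(2) f(2)])
  finally show "l2_norm ?F = l2_norm f"
    by (rule power2_eq_imp_eq) auto
qed

lemma vector_fourier_integral_adjoint:
  assumes \<sigma>: "\<bar>\<sigma>\<bar> = 1" and f: "integrable lborel f" "square_integrable f"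
    and g: "integrable lborel g" "square_integrable g"
  shows "l2_inner (vector_fourier_integral \<sigma> f) g = l2_inner f (vector_fourier_integral (- \<sigma>) g)"
proof -
  have \<sigma>': "\<bar>- \<sigma>\<bar> = 1" using \<sigma> by simp
  show ?thesis
    using vector_fourier_integral_isometry(1)[OF \<sigma> f] vector_fourier_integral_isometry(1)[OF \<sigma>' g] f g
    by (simp add: l2_inner_components vector_fourier_integral_component fourier_integral_adjoint integrable_component)
qed

subsection \<open>Extension to square-integrable fields\<close>

definition cutoff :: "real \<Rightarrow> ('a::euclidean_space \<Rightarrow> 'b::euclidean_space) \<Rightarrow> 'a \<Rightarrow> 'b" where
  "cutoff R f x = indicator (cball 0 R) x *\<^sub>R f x"

lemma truncated_fourier_eq: "truncated_fourier \<sigma> R f = vector_fourier_integral \<sigma> (cutoff R f)"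
proof -
  have "indicator (cball 0 R) x *\<^sub>R (c *s v) = c *s (indicator (cball 0 R) x *\<^sub>R (v::complex^3))" for x :: "real^3" and c v
    by (simp add: vec_eq_iff scaleR_conv_of_real)
  then show ?thesis
    by (simp add: fun_eq_iff truncated_fourier_def vector_fourier_integral_def set_lebesgue_integral_def cutoff_def)
qed

lemma cutoff_measurable [measurable]:
  fixes f :: "'a::euclidean_space \<Rightarrow> 'b::euclidean_space"
  assumes [measurable]: "f \<in> borel_measurable borel"
  shows "cutoff R f \<in> borel_measurable borel"
proof -
  have [measurable]: "cball (0::'a) R \<in> sets borel" by simp
  show ?thesis unfolding cutoff_def by measurable
qed

lemma cutoff_square_integrable: "square_integrable f \<Longrightarrow> square_integrable (cutoff R f)"
  by (rule square_integrable_bound[where g=f and C=1])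
    (auto intro: square_integrable_measurable simp: cutoff_def indicator_def)

text \<open>A square-integrable function is integrable on bounded sets by Cauchy--Schwarz.\<close>

lemma cutoff_integrable:
  fixes f :: "'a::euclidean_space \<Rightarrow> 'b::euclidean_space"
  assumes f: "square_integrable f"
  shows "integrable lborel (cutoff R f)"
proof -
  have [measurable]: "f \<in> borel_measurable borel" using f square_integrable_measurable by blast
  have "integrable lborel (indicator (cball 0 R) :: 'a \<Rightarrow> real)"
    using emeasure_bounded_finite[OF bounded_cball, of "0::'a" R] by (intro integrable_real_indicator) auto
  moreover have "(norm (indicator (cball (0::'a) R) x :: real))\<^sup>2 = indicator (cball 0 R) x" for x
    by (simp add: indicator_def)
  ultimately have ind: "square_integrable (indicator (cball 0 R) :: 'a \<Rightarrow> real)"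
    by (simp add: square_integrable_def)
  show ?thesis
    by (rule Bochner_Integration.integrable_bound[OF square_integrable_norm_mult[OF ind f]])
      (auto simp: cutoff_def)
qed

lemma cutoff_tendsto:
  fixes f :: "'a::euclidean_space \<Rightarrow> 'b::euclidean_space"
  assumes f: "square_integrable f"
  shows "((\<lambda>R. l2_norm (\<lambda>x. f x - cutoff R f x)) \<longlongrightarrow> 0) at_top"
proof -
  have [measurable]: "f \<in> borel_measurable borel" using f square_integrable_measurable by blast
  have "((\<lambda>R. LINT x|lborel. (norm (f x - cutoff R f x))\<^sup>2) \<longlongrightarrow> (LINT x|(lborel::'a measure). 0)) at_top"
  proof (rule integral_dominated_convergence_at_top[where w="\<lambda>x. (norm (f x))\<^sup>2"])
    show "integrable lborel (\<lambda>x. (norm (f x))\<^sup>2)" using f by (rule square_integrable_integrable)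
    have "((\<lambda>R. (norm (f x - cutoff R f x))\<^sup>2) \<longlongrightarrow> 0) at_top" for x
    proof (rule tendsto_eventually, rule eventually_at_top_linorderI)
      fix R assume "R \<ge> norm x"
      then show "(norm (f x - cutoff R f x))\<^sup>2 = 0" by (simp add: cutoff_def)
    qed
    then show "AE x in lborel. ((\<lambda>R. (norm (f x - cutoff R f x))\<^sup>2) \<longlongrightarrow> 0) at_top" by simp
    show "\<forall>\<^sub>F R in at_top. AE x in lborel. norm ((norm (f x - cutoff R f x))\<^sup>2) \<le> (norm (f x))\<^sup>2"
      by (intro always_eventually allI AE_I2) (simp add: cutoff_def indicator_def)
  qed measurable
  then have "((\<lambda>R. sqrt (LINT x|lborel. (norm (f x - cutoff R f x))\<^sup>2)) \<longlongrightarrow> sqrt 0) at_top"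
    by (intro tendsto_real_sqrt) simp
  then show ?thesis by (simp add: l2_norm_def)
qed

text \<open>The condition in the definition of the Plancherel transform, restated as convergence in norm.\<close>

lemma plancherel_condition_iff:
  assumes \<sigma>: "\<bar>\<sigma>\<bar> = 1" and f: "square_integrable f" and g: "square_integrable g"
  shows "((\<lambda>R. \<integral>\<^sup>+\<xi>. ennreal ((norm (g \<xi> - truncated_fourier \<sigma> R f \<xi>))\<^sup>2) \<partial>lborel) \<longlongrightarrow> 0) at_top
    \<longleftrightarrow> ((\<lambda>R. l2_norm (\<lambda>\<xi>. g \<xi> - vector_fourier_integral \<sigma> (cutoff R f) \<xi>)) \<longlongrightarrow> 0) at_top"
proof -
  have s: "square_integrable (\<lambda>\<xi>. g \<xi> - vector_fourier_integral \<sigma> (cutoff R f) \<xi>)" for R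
    by (intro square_integrable_intros g vector_fourier_integral_isometry(1)[OF \<sigma>]
        cutoff_integrable cutoff_square_integrable f)
  let ?n = "\<lambda>R. l2_norm (\<lambda>\<xi>. g \<xi> - vector_fourier_integral \<sigma> (cutoff R f) \<xi>)"
  have "((\<lambda>R. \<integral>\<^sup>+\<xi>. ennreal ((norm (g \<xi> - truncated_fourier \<sigma> R f \<xi>))\<^sup>2) \<partial>lborel) \<longlongrightarrow> 0) at_top
      \<longleftrightarrow> ((\<lambda>R. ennreal ((?n R)\<^sup>2)) \<longlongrightarrow> ennreal 0) at_top"
    by (simp add: truncated_fourier_eq nn_integral_norm_sq[OF s])
  also have "\<dots> \<longleftrightarrow> ((\<lambda>R. (?n R)\<^sup>2) \<longlongrightarrow> 0) at_top"
    by (rule tendsto_ennreal_iff) auto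
  also have "\<dots> \<longleftrightarrow> (?n \<longlongrightarrow> 0) at_top"
  proof
    assume "((\<lambda>R. (?n R)\<^sup>2) \<longlongrightarrow> 0) at_top"
    then have "((\<lambda>R. sqrt ((?n R)\<^sup>2)) \<longlongrightarrow> sqrt 0) at_top" by (rule tendsto_real_sqrt)
    then show "(?n \<longlongrightarrow> 0) at_top" by simp
  next
    assume "(?n \<longlongrightarrow> 0) at_top"
    from tendsto_power[OF this, of 2] show "((\<lambda>R. (?n R)\<^sup>2) \<longlongrightarrow> 0) at_top" by simp
  qed
  finally show ?thesis .
qed

lemma vector_fourier_integral_cutoff_diff:
  assumes \<sigma>: "\<bar>\<sigma>\<bar> = 1" and f: "square_integrable f"
  shows "l2_norm (\<lambda>\<xi>. vector_fourier_integral \<sigma> (cutoff R f) \<xi> - vector_fourier_integral \<sigma> (cutoff S f) \<xi>)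
    \<le> l2_norm (\<lambda>x. f x - cutoff R f x) + l2_norm (\<lambda>x. f x - cutoff S f x)"
proof -
  note c = cutoff_integrable[OF f] cutoff_square_integrable[OF f]
  have "l2_norm (\<lambda>\<xi>. vector_fourier_integral \<sigma> (cutoff R f) \<xi> - vector_fourier_integral \<sigma> (cutoff S f) \<xi>)
      = l2_norm (vector_fourier_integral \<sigma> (\<lambda>x. cutoff R f x - cutoff S f x))"
    by (intro arg_cong[of _ _ l2_norm]) (auto simp: vector_fourier_integral_diff[OF c(1) c(1)])
  also have "\<dots> = l2_norm (\<lambda>x. cutoff R f x - cutoff S f x)"
    by (intro vector_fourier_integral_isometry(2)[OF \<sigma>]) (auto intro: c square_integrable_intros)
  also have "\<dots> \<le> l2_norm (\<lambda>x. cutoff R f x - f x) + l2_norm (\<lambda>x. f x - cutoff S f x)"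
    by (rule l2_norm_triangle_diff[OF c(2) f c(2)])
  finally show ?thesis by (simp only: l2_norm_minus_commute[of "cutoff R f" f])
qed

text \<open>The cutoffs of \<open>f\<close> converge to \<open>f\<close>; by isometry their Fourier integrals are Cauchy, and completeness
  provides the limit.\<close>

lemma plancherel_exists:
  assumes \<sigma>: "\<bar>\<sigma>\<bar> = 1" and f: "square_integrable f"
  shows "\<exists>g. square_integrable g \<and>
    ((\<lambda>R. l2_norm (\<lambda>\<xi>. g \<xi> - vector_fourier_integral \<sigma> (cutoff R f) \<xi>)) \<longlongrightarrow> 0) at_top"
proof -
  let ?V = "\<lambda>R. vector_fourier_integral \<sigma> (cutoff R f)" and ?t = "\<lambda>R. l2_norm (\<lambda>x. f x - cutoff R f x)"
  have sV: "square_integrable (?V R)" for R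
    by (intro vector_fourier_integral_isometry(1)[OF \<sigma>] cutoff_integrable cutoff_square_integrable f)
  have lim: "(?t \<longlongrightarrow> 0) at_top" by (rule cutoff_tendsto[OF f])
  have limn: "(\<lambda>n. ?t (real n)) \<longlonglongrightarrow> 0"
    by (rule filterlim_compose[OF lim filterlim_real_sequentially])
  obtain g where g: "square_integrable g" "(\<lambda>n. l2_norm (\<lambda>\<xi>. ?V (real n) \<xi> - g \<xi>)) \<longlonglongrightarrow> 0"
  proof -
    have "\<exists>N. \<forall>m\<ge>N. \<forall>n\<ge>N. l2_norm (\<lambda>\<xi>. ?V (real m) \<xi> - ?V (real n) \<xi>) \<le> e" if "0 < e" for e
    proof -
      from LIMSEQ_D[OF limn, of "e/2"] \<open>0 < e\<close> obtain N where N: "\<And>n. n \<ge> N \<Longrightarrow> ?t (real n) < e / 2"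
        by auto
      have "l2_norm (\<lambda>\<xi>. ?V (real m) \<xi> - ?V (real n) \<xi>) \<le> e" if "m \<ge> N" "n \<ge> N" for m n
        using vector_fourier_integral_cutoff_diff[OF \<sigma> f, of "real m" "real n"] N[OF that(1)] N[OF that(2)] by linarith
      then show ?thesis by blast
    qed
    from l2_complete[of "\<lambda>n. ?V (real n)", OF sV this] show ?thesis using that by blast
  qed
  have "l2_norm (\<lambda>\<xi>. g \<xi> - ?V R \<xi>) \<le> ?t R" for R
  proof -
    have "l2_norm (\<lambda>\<xi>. g \<xi> - ?V R \<xi>) \<le> l2_norm (\<lambda>\<xi>. ?V (real n) \<xi> - g \<xi>) + (?t (real n) + ?t R)" for n
      using l2_norm_triangle_diff[OF g(1) sV[of "real n"] sV[of R]] vector_fourier_integral_cutoff_diff[OF \<sigma> f, of "real n" R]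
        l2_norm_minus_commute[of g "?V (real n)"] by linarith
    then have "l2_norm (\<lambda>\<xi>. g \<xi> - ?V R \<xi>) \<le> 0 + (0 + ?t R)"
      by (intro LIMSEQ_le_const[OF tendsto_add[OF g(2) tendsto_add[OF limn tendsto_const]]]) auto
    then show ?thesis by simp
  qed
  then have "((\<lambda>R. l2_norm (\<lambda>\<xi>. g \<xi> - ?V R \<xi>)) \<longlongrightarrow> 0) at_top"
    by (intro Lim_null_comparison[OF _ lim]) simp
  with g(1) show ?thesis by blast
qed

lemma plancherel_limit:
  assumes \<sigma>: "\<bar>\<sigma>\<bar> = 1" and f: "square_integrable f"
  shows "square_integrable (plancherel \<sigma> f)"
    and "((\<lambda>R. l2_norm (\<lambda>\<xi>. plancherel \<sigma> f \<xi> - vector_fourier_integral \<sigma> (cutoff R f) \<xi>)) \<longlongrightarrow> 0) at_top"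
proof -
  let ?P = "\<lambda>g. L2 g \<and> ((\<lambda>R. \<integral>\<^sup>+\<xi>. ennreal ((norm (g \<xi> - truncated_fourier \<sigma> R f \<xi>))\<^sup>2) \<partial>lborel) \<longlongrightarrow> 0) at_top"
  have eq: "?P g \<longleftrightarrow> square_integrable g \<and> ((\<lambda>R. l2_norm (\<lambda>\<xi>. g \<xi> - vector_fourier_integral \<sigma> (cutoff R f) \<xi>)) \<longlongrightarrow> 0) at_top" for g
    using plancherel_condition_iff[OF \<sigma> f, of g] by (auto simp: L2_iff)
  have "\<exists>g. ?P g" unfolding eq by (rule plancherel_exists[OF \<sigma> f])
  then have "?P (plancherel \<sigma> f)" unfolding plancherel_def by (rule someI_ex)
  then show "square_integrable (plancherel \<sigma> f)"
    and "((\<lambda>R. l2_norm (\<lambda>\<xi>. plancherel \<sigma> f \<xi> - vector_fourier_integral \<sigma> (cutoff R f) \<xi>)) \<longlongrightarrow> 0) at_top"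
    unfolding eq by auto
qed

lemma l2_norm_le_0_AE_eq:
  assumes "square_integrable f" "square_integrable g" "l2_norm (\<lambda>x. f x - g x) \<le> 0"
  shows "AE x in lborel. f x = g x"
proof -
  have "l2_norm (\<lambda>x. f x - g x) = 0" using assms(3) by (intro antisym) auto
  from l2_norm_eq_0_AE[OF square_integrable_diff[OF assms(1,2)] this] show ?thesis by simp
qed

lemma plancherel_unique:
  assumes \<sigma>: "\<bar>\<sigma>\<bar> = 1" and f: "square_integrable f" and g: "square_integrable g"
    and lim: "((\<lambda>R. l2_norm (\<lambda>\<xi>. g \<xi> - vector_fourier_integral \<sigma> (cutoff R f) \<xi>)) \<longlongrightarrow> 0) at_top"
  shows "AE \<xi> in lborel. plancherel \<sigma> f \<xi> = g \<xi>"
proof (rule l2_norm_le_0_AE_eq[OF plancherel_limit(1)[OF \<sigma> f] g])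
  let ?V = "\<lambda>R. vector_fourier_integral \<sigma> (cutoff R f)"
  have sV: "square_integrable (?V R)" for R
    by (intro vector_fourier_integral_isometry(1)[OF \<sigma>] cutoff_integrable cutoff_square_integrable f)
  have "l2_norm (\<lambda>\<xi>. plancherel \<sigma> f \<xi> - g \<xi>) \<le> l2_norm (\<lambda>\<xi>. plancherel \<sigma> f \<xi> - ?V R \<xi>) + l2_norm (\<lambda>\<xi>. g \<xi> - ?V R \<xi>)" for R
    using l2_norm_triangle_diff[OF plancherel_limit(1)[OF \<sigma> f] sV[of R] g] l2_norm_minus_commute[of g "?V R"] by simp
  then have "l2_norm (\<lambda>\<xi>. plancherel \<sigma> f \<xi> - g \<xi>) \<le> 0 + 0"
    by (intro tendsto_lowerbound[OF tendsto_add[OF plancherel_limit(2)[OF \<sigma> f] lim]]) auto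
  then show "l2_norm (\<lambda>\<xi>. plancherel \<sigma> f \<xi> - g \<xi>) \<le> 0" by simp
qed

lemma plancherel_L1:
  assumes \<sigma>: "\<bar>\<sigma>\<bar> = 1" and f: "integrable lborel f" "square_integrable f"
  shows "AE \<xi> in lborel. plancherel \<sigma> f \<xi> = vector_fourier_integral \<sigma> f \<xi>"
proof (rule plancherel_unique[OF \<sigma> f(2) vector_fourier_integral_isometry(1)[OF \<sigma> f]])
  note c = cutoff_integrable[OF f(2)] cutoff_square_integrable[OF f(2)]
  have "l2_norm (\<lambda>\<xi>. vector_fourier_integral \<sigma> f \<xi> - vector_fourier_integral \<sigma> (cutoff R f) \<xi>)
      = l2_norm (vector_fourier_integral \<sigma> (\<lambda>x. f x - cutoff R f x))" for R
    by (intro arg_cong[of _ _ l2_norm]) (auto simp: vector_fourier_integral_diff[OF f(1) c(1)])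
  also have "\<dots> R = l2_norm (\<lambda>x. f x - cutoff R f x)" for R
    by (intro vector_fourier_integral_isometry(2)[OF \<sigma>]) (auto intro: c f square_integrable_intros)
  finally show "((\<lambda>R. l2_norm (\<lambda>\<xi>. vector_fourier_integral \<sigma> f \<xi> - vector_fourier_integral \<sigma> (cutoff R f) \<xi>)) \<longlongrightarrow> 0) at_top"
    using cutoff_tendsto[OF f(2)] by simp
qed

lemma plancherel_linear:
  assumes \<sigma>: "\<bar>\<sigma>\<bar> = 1" and f: "square_integrable f" and g: "square_integrable g"
  shows "AE \<xi> in lborel. plancherel \<sigma> (\<lambda>x. f x + c *\<^sub>R g x) \<xi> = plancherel \<sigma> f \<xi> + c *\<^sub>R plancherel \<sigma> g \<xi>"
proof (rule plancherel_unique[OF \<sigma>])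
  note P = plancherel_limit[OF \<sigma> f] plancherel_limit[OF \<sigma> g]
  show "square_integrable (\<lambda>x. f x + c *\<^sub>R g x)" by (intro square_integrable_intros f g)
  show "square_integrable (\<lambda>\<xi>. plancherel \<sigma> f \<xi> + c *\<^sub>R plancherel \<sigma> g \<xi>)" by (intro square_integrable_intros P)
  let ?V = "\<lambda>f R. vector_fourier_integral \<sigma> (cutoff R f)"
  have sV: "square_integrable (?V f R)" if "square_integrable f" for f R
    by (intro vector_fourier_integral_isometry(1)[OF \<sigma>] cutoff_integrable cutoff_square_integrable that)
  have V: "?V (\<lambda>x. f x + c *\<^sub>R g x) R \<xi> = ?V f R \<xi> + c *\<^sub>R ?V g R \<xi>" for R \<xi>
  proof -
    have "cutoff R (\<lambda>x. f x + c *\<^sub>R g x) = (\<lambda>x. cutoff R f x - (- c) *\<^sub>R cutoff R g x)"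
      by (simp add: cutoff_def fun_eq_iff scaleR_add_right)
    then have "?V (\<lambda>x. f x + c *\<^sub>R g x) R \<xi> = ?V f R \<xi> - vector_fourier_integral \<sigma> (\<lambda>x. (- c) *\<^sub>R cutoff R g x) \<xi>"
      by (simp only:) (intro vector_fourier_integral_diff cutoff_integrable f integrable_scaleR_right g)
    also have "vector_fourier_integral \<sigma> (\<lambda>x. (- c) *\<^sub>R cutoff R g x) \<xi> = (- c) *\<^sub>R ?V g R \<xi>"
    proof -
      have "z *s ((- c) *\<^sub>R v) = (- c) *\<^sub>R (z *s (v::complex^3))" for z v
        by (simp add: vec_eq_iff)
      then show ?thesis by (simp only: vector_fourier_integral_def integral_scaleR_right scaleR_left_commute)
    qed
    finally show ?thesis by simp
  qed
  have bd: "l2_norm (\<lambda>\<xi>. plancherel \<sigma> f \<xi> + c *\<^sub>R plancherel \<sigma> g \<xi> - ?V (\<lambda>x. f x + c *\<^sub>R g x) R \<xi>)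
     \<le> l2_norm (\<lambda>\<xi>. plancherel \<sigma> f \<xi> - ?V f R \<xi>) + \<bar>c\<bar> * l2_norm (\<lambda>\<xi>. plancherel \<sigma> g \<xi> - ?V g R \<xi>)" for R
  proof -
    have "l2_norm (\<lambda>\<xi>. plancherel \<sigma> f \<xi> + c *\<^sub>R plancherel \<sigma> g \<xi> - ?V (\<lambda>x. f x + c *\<^sub>R g x) R \<xi>)
        = l2_norm (\<lambda>\<xi>. (plancherel \<sigma> f \<xi> - ?V f R \<xi>) + c *\<^sub>R (plancherel \<sigma> g \<xi> - ?V g R \<xi>))"
      by (simp only: V) (simp add: algebra_simps)
    also have "\<dots> \<le> l2_norm (\<lambda>\<xi>. plancherel \<sigma> f \<xi> - ?V f R \<xi>) + l2_norm (\<lambda>\<xi>. c *\<^sub>R (plancherel \<sigma> g \<xi> - ?V g R \<xi>))"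
      by (intro l2_norm_triangle square_integrable_intros P sV f g)
    finally show ?thesis by (simp only: l2_norm_scaleR)
  qed
  have "((\<lambda>R. l2_norm (\<lambda>\<xi>. plancherel \<sigma> f \<xi> - ?V f R \<xi>) + \<bar>c\<bar> * l2_norm (\<lambda>\<xi>. plancherel \<sigma> g \<xi> - ?V g R \<xi>)) \<longlongrightarrow> 0 + \<bar>c\<bar> * 0) at_top"
    by (intro tendsto_intros P)
  then have lim: "((\<lambda>R. l2_norm (\<lambda>\<xi>. plancherel \<sigma> f \<xi> - ?V f R \<xi>) + \<bar>c\<bar> * l2_norm (\<lambda>\<xi>. plancherel \<sigma> g \<xi> - ?V g R \<xi>)) \<longlongrightarrow> 0) at_top"
    by simp
  show "((\<lambda>R. l2_norm (\<lambda>\<xi>. plancherel \<sigma> f \<xi> + c *\<^sub>R plancherel \<sigma> g \<xi> - ?V (\<lambda>x. f x + c *\<^sub>R g x) R \<xi>)) \<longlongrightarrow> 0) at_top"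
    by (rule Lim_null_comparison[OF _ lim])
      (rule always_eventually, rule allI, simp only: real_norm_def abs_of_nonneg[OF l2_norm_nonneg], rule bd)
qed

lemma plancherel_diff:
  assumes "\<bar>\<sigma>\<bar> = 1" "square_integrable f" "square_integrable g"
  shows "AE \<xi> in lborel. plancherel \<sigma> (\<lambda>x. f x - g x) \<xi> = plancherel \<sigma> f \<xi> - plancherel \<sigma> g \<xi>"
  using plancherel_linear[OF assms, of "-1"] by simp

text \<open>Fields that agree almost everywhere have the same truncated transforms, so the choice operator
  selects literally the same function for both.\<close>

lemma plancherel_cong_AE:
  assumes "AE x in lborel. f x = g x" "f \<in> borel_measurable borel" "g \<in> borel_measurable borel"
  shows "plancherel \<sigma> f = plancherel \<sigma> g"
proof -
  have [measurable]: "f \<in> borel_measurable borel" "g \<in> borel_measurable borel" by fact+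
  have m: "(\<lambda>x. cis (\<sigma> * (\<xi> \<bullet> x)) *s cutoff R h x) \<in> borel_measurable lborel"
    if [measurable]: "h \<in> borel_measurable borel" for \<xi> R and h :: cfield
    by measurable
  have "truncated_fourier \<sigma> R f = truncated_fourier \<sigma> R g" for R
    unfolding truncated_fourier_eq vector_fourier_integral_def fun_eq_iff
    by (intro allI arg_cong[of _ _ "scaleR _"] integral_cong_AE)
      (use assms m in \<open>auto simp: cutoff_def\<close>)
  then show ?thesis by (simp add: plancherel_def)
qed

lemma l2_norm_tendsto:
  assumes "\<And>R. square_integrable (f R)" "square_integrable g" "((\<lambda>R. l2_norm (\<lambda>x. g x - f R x)) \<longlongrightarrow> 0) F"
  shows "((\<lambda>R. l2_norm (f R)) \<longlongrightarrow> l2_norm g) F"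
proof (rule LIM_zero_cancel, rule Lim_null_comparison[OF _ assms(3)], intro always_eventually allI)
  show "norm (l2_norm (f R) - l2_norm g) \<le> l2_norm (\<lambda>x. g x - f R x)" for R
    using l2_norm_triangle_rev[OF assms(2,1), of R] by (simp add: abs_minus_commute)
qed

lemma l2_inner_tendsto:
  assumes f: "\<And>R. square_integrable (f R)" "square_integrable f'" "((\<lambda>R. l2_norm (\<lambda>x. f' x - f R x)) \<longlongrightarrow> 0) F"
    and g: "\<And>R. square_integrable (g R)" "square_integrable g'" "((\<lambda>R. l2_norm (\<lambda>x. g' x - g R x)) \<longlongrightarrow> 0) F"
  shows "((\<lambda>R. l2_inner (f R) (g R)) \<longlongrightarrow> l2_inner f' g') F"
proof (rule LIM_zero_cancel)
  have lim: "((\<lambda>R. l2_norm (\<lambda>x. f' x - f R x) * l2_norm (g R) + l2_norm f' * l2_norm (\<lambda>x. g' x - g R x))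
      \<longlongrightarrow> 0 * l2_norm g' + l2_norm f' * 0) F"
    by (intro tendsto_intros f g l2_norm_tendsto)
  show "((\<lambda>R. l2_inner (f R) (g R) - l2_inner f' g') \<longlongrightarrow> 0) F"
  proof (rule Lim_null_comparison)
    show "((\<lambda>R. l2_norm (\<lambda>x. f' x - f R x) * l2_norm (g R) + l2_norm f' * l2_norm (\<lambda>x. g' x - g R x)) \<longlongrightarrow> 0) F"
      using lim by simp
    have "\<bar>l2_inner (f R) (g R) - l2_inner f' g'\<bar>
        \<le> l2_norm (\<lambda>x. f' x - f R x) * l2_norm (g R) + l2_norm f' * l2_norm (\<lambda>x. g' x - g R x)" for R
    proof -
      have "l2_inner f' g' - l2_inner (f R) (g R) = l2_inner (\<lambda>x. f' x - f R x) (g R) + l2_inner f' (\<lambda>x. g' x - g R x)"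
        using f g by (simp add: l2_inner_simps)
      moreover have "\<bar>l2_inner (\<lambda>x. f' x - f R x) (g R)\<bar> \<le> l2_norm (\<lambda>x. f' x - f R x) * l2_norm (g R)"
        by (intro l2_Cauchy_Schwarz square_integrable_intros f g)
      moreover have "\<bar>l2_inner f' (\<lambda>x. g' x - g R x)\<bar> \<le> l2_norm f' * l2_norm (\<lambda>x. g' x - g R x)"
        by (intro l2_Cauchy_Schwarz square_integrable_intros f g)
      ultimately show ?thesis by linarith
    qed
    then show "\<forall>\<^sub>F R in F. norm (l2_inner (f R) (g R) - l2_inner f' g') \<le>
        l2_norm (\<lambda>x. f' x - f R x) * l2_norm (g R) + l2_norm f' * l2_norm (\<lambda>x. g' x - g R x)"
      by simp
  qed
qed

theorem plancherel_norm:
  assumes \<sigma>: "\<bar>\<sigma>\<bar> = 1" and f: "square_integrable f"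
  shows "l2_norm (plancherel \<sigma> f) = l2_norm f"
proof -
  note c = cutoff_integrable[OF f] cutoff_square_integrable[OF f]
  have "((\<lambda>R. l2_norm (vector_fourier_integral \<sigma> (cutoff R f))) \<longlongrightarrow> l2_norm (plancherel \<sigma> f)) at_top"
    by (intro l2_norm_tendsto plancherel_limit[OF \<sigma> f] vector_fourier_integral_isometry(1)[OF \<sigma>] c)
  then have "((\<lambda>R. l2_norm (cutoff R f)) \<longlongrightarrow> l2_norm (plancherel \<sigma> f)) at_top"
    by (simp add: vector_fourier_integral_isometry(2)[OF \<sigma> c])
  moreover have "((\<lambda>R. l2_norm (cutoff R f)) \<longlongrightarrow> l2_norm f) at_top"
    by (intro l2_norm_tendsto c f cutoff_tendsto)
  ultimately show ?thesis
    by (intro tendsto_unique[of at_top]) auto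
qed

text \<open>Polarization of the isometry.\<close>

lemma plancherel_inner:
  assumes \<sigma>: "\<bar>\<sigma>\<bar> = 1" and f: "square_integrable f" and g: "square_integrable g"
  shows "l2_inner (plancherel \<sigma> f) (plancherel \<sigma> g) = l2_inner f g"
proof -
  note P = plancherel_limit(1)[OF \<sigma> f] plancherel_limit(1)[OF \<sigma> g]
  have d: "square_integrable (\<lambda>x. f x - g x)" by (intro square_integrable_intros f g)
  have "l2_norm (\<lambda>\<xi>. plancherel \<sigma> f \<xi> - plancherel \<sigma> g \<xi>) = l2_norm (plancherel \<sigma> (\<lambda>x. f x - g x))"
    using plancherel_diff[OF \<sigma> f g] P plancherel_limit(1)[OF \<sigma> d]
    by (intro l2_norm_cong_AE) (auto intro: square_integrable_measurable square_integrable_diff)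
  also have "\<dots> = l2_norm (\<lambda>x. f x - g x)"
    by (rule plancherel_norm[OF \<sigma> d])
  finally show ?thesis
    using l2_norm_diff_sq[OF P] l2_norm_diff_sq[OF f g] plancherel_norm[OF \<sigma> f] plancherel_norm[OF \<sigma> g] by simp
qed

lemma plancherel_adjoint:
  assumes \<sigma>: "\<bar>\<sigma>\<bar> = 1" and f: "square_integrable f" and g: "square_integrable g"
  shows "l2_inner (plancherel \<sigma> f) g = l2_inner f (plancherel (- \<sigma>) g)"
proof -
  have \<sigma>': "\<bar>- \<sigma>\<bar> = 1" using \<sigma> by simp
  note c = cutoff_integrable[OF f] cutoff_square_integrable[OF f] cutoff_integrable[OF g] cutoff_square_integrable[OF g]
  have "((\<lambda>R. l2_inner (vector_fourier_integral \<sigma> (cutoff R f)) (cutoff R g)) \<longlongrightarrow> l2_inner (plancherel \<sigma> f) g) at_top"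
    by (intro l2_inner_tendsto plancherel_limit[OF \<sigma> f] vector_fourier_integral_isometry(1)[OF \<sigma>] c g cutoff_tendsto)
  then have "((\<lambda>R. l2_inner (cutoff R f) (vector_fourier_integral (- \<sigma>) (cutoff R g))) \<longlongrightarrow> l2_inner (plancherel \<sigma> f) g) at_top"
    by (simp only: vector_fourier_integral_adjoint[OF \<sigma> c])
  moreover have "((\<lambda>R. l2_inner (cutoff R f) (vector_fourier_integral (- \<sigma>) (cutoff R g))) \<longlongrightarrow> l2_inner f (plancherel (- \<sigma>) g)) at_top"
    by (intro l2_inner_tendsto plancherel_limit[OF \<sigma>' g] vector_fourier_integral_isometry(1)[OF \<sigma>'] c f cutoff_tendsto)
  ultimately show ?thesis
    by (intro tendsto_unique[of at_top]) auto
qed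

text \<open>Let \<open>A\<close> be the transform and \<open>B\<close> the one of opposite sign. As \<open>B\<close> is the adjoint of \<open>A\<close>, and \<open>A\<close> is an
  isometry, \<open>\<langle>B A f, h\<rangle> = \<langle>A f, A h\<rangle> = \<langle>f, h\<rangle>\<close> for all \<open>h\<close>.\<close>

theorem plancherel_inversion:
  assumes \<sigma>: "\<bar>\<sigma>\<bar> = 1" and f: "square_integrable f"
  shows "AE x in lborel. plancherel (- \<sigma>) (plancherel \<sigma> f) x = f x"
proof (rule l2_norm_le_0_AE_eq)
  have \<sigma>': "\<bar>- \<sigma>\<bar> = 1" using \<sigma> by simp
  show s: "square_integrable (plancherel (- \<sigma>) (plancherel \<sigma> f))"
    by (intro plancherel_limit(1)[OF \<sigma>'] plancherel_limit(1)[OF \<sigma>] f)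
  show "square_integrable f" by fact
  let ?h = "\<lambda>x. plancherel (- \<sigma>) (plancherel \<sigma> f) x - f x"
  have h: "square_integrable ?h" by (intro square_integrable_intros s f)
  have "l2_inner (plancherel (- \<sigma>) (plancherel \<sigma> f)) ?h = l2_inner f ?h"
    using plancherel_adjoint[OF \<sigma>' plancherel_limit(1)[OF \<sigma> f] h] plancherel_inner[OF \<sigma> f h] by simp
  then have "(l2_norm ?h)\<^sup>2 = 0"
    using h s f by (simp add: l2_norm_sq_inner l2_inner_diff_left)
  then show "l2_norm ?h \<le> 0" by simp
qed

section \<open>The Leray projection\<close>

text \<open>Projection onto a closed subspace, here an orthogonal complement: a minimizing sequence is
  Cauchy by the parallelogram law.\<close>

theorem l2_projection_exists:
  fixes f :: "'a::euclidean_space \<Rightarrow> 'b::euclidean_space" and S :: "('a \<Rightarrow> 'b) set"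
  assumes f: "square_integrable f" and S: "\<And>h. h \<in> S \<Longrightarrow> square_integrable h"
  defines "V \<equiv> {g. square_integrable g \<and> (\<forall>h\<in>S. l2_inner g h = 0)}"
  shows "\<exists>g\<in>V. \<forall>k\<in>V. l2_inner (\<lambda>x. f x - g x) k = 0"
proof -
  have Vsq: "g \<in> V \<Longrightarrow> square_integrable g" for g by (simp add: V_def)
  have Vadd: "(\<lambda>x. g x + c *\<^sub>R k x) \<in> V" if "g \<in> V" "k \<in> V" for g k c
    using that by (auto simp: V_def S l2_inner_simps square_integrable_intros)
  let ?q = "\<lambda>g. (l2_norm (\<lambda>x. f x - g x))\<^sup>2"
  define d where "d = Inf (?q ` V)"
  have ne: "V \<noteq> {}"
  proof -
    have "(\<lambda>x. 0) \<in> V" by (simp add: V_def l2_inner_def)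
    then show ?thesis by blast
  qed
  have bdd: "bdd_below (?q ` V)" by (rule bdd_belowI[of _ 0]) auto
  have dle: "d \<le> ?q g" if "g \<in> V" for g
    unfolding d_def using that bdd by (intro cInf_lower) auto
  have "\<exists>g\<in>V. ?q g < d + 1 / real (Suc n)" for n
  proof -
    have "Inf (?q ` V) < d + 1 / real (Suc n)" by (simp add: d_def)
    then show ?thesis using cInf_lessD[of "?q ` V"] ne by auto
  qed
  then obtain G where G: "\<And>n. G n \<in> V" "\<And>n. ?q (G n) < d + 1 / real (Suc n)" by metis
  have sG: "square_integrable (G n)" for n using G(1) Vsq by blast
  have par: "(l2_norm (\<lambda>x. G m x - G n x))\<^sup>2 \<le> 2 / real (Suc m) + 2 / real (Suc n)" for m n
  proof -
    let ?a = "\<lambda>x. f x - G m x" and ?b = "\<lambda>x. f x - G n x"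
    let ?mid = "\<lambda>x. G m x + (1/2) *\<^sub>R (G n x + (-1) *\<^sub>R G m x)"
    have sab: "square_integrable ?a" "square_integrable ?b" by (intro square_integrable_intros f sG)+
    have "?mid \<in> V" by (intro Vadd G)
    then have mid: "d \<le> ?q ?mid" by (rule dle)
    \<comment> \<open>the midpoint of two minimizing fields cannot be closer to \<open>f\<close> than the distance \<open>d\<close>\<close>
    have "f x - (G m x + (1/2) *\<^sub>R (G n x + (-1) *\<^sub>R G m x)) = (1/2) *\<^sub>R ((f x - G m x) + (f x - G n x))" for x
    proof -
      have "f x = (1/2) *\<^sub>R f x + (1/2) *\<^sub>R f x" "G m x = (1/2) *\<^sub>R G m x + (1/2) *\<^sub>R G m x"
        by (simp_all add: scaleR_left_distrib[symmetric])
      then show ?thesis by (simp add: algebra_simps)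
    qed
    then have "?q ?mid = (1/4) * (l2_norm (\<lambda>x. ?a x + ?b x))\<^sup>2"
      by (simp only: l2_norm_scaleR power_mult_distrib) (simp add: power2_eq_square)
    moreover have "(l2_norm (\<lambda>x. ?b x - ?a x))\<^sup>2 + (l2_norm (\<lambda>x. ?a x + ?b x))\<^sup>2 = 2 * ?q (G m) + 2 * ?q (G n)"
      using l2_norm_add_sq[OF sab] l2_norm_diff_sq[OF sab(2,1)] by (simp add: l2_inner_commute[of ?b ?a])
    moreover have "(\<lambda>x. ?b x - ?a x) = (\<lambda>x. G m x - G n x)" by auto
    ultimately have "(l2_norm (\<lambda>x. G m x - G n x))\<^sup>2 \<le> 2 * ?q (G m) + 2 * ?q (G n) - 4 * d"
      using mid by simp
    then show ?thesis using G(2)[of m] G(2)[of n] by simp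
  qed
  have "\<exists>N. \<forall>m\<ge>N. \<forall>n\<ge>N. l2_norm (\<lambda>x. G m x - G n x) \<le> e" if e: "0 < e" for e
  proof -
    obtain N where N: "4 / e\<^sup>2 < real N" using reals_Archimedean2 by blast
    have "l2_norm (\<lambda>x. G m x - G n x) \<le> e" if "m \<ge> N" "n \<ge> N" for m n
    proof (rule power2_le_imp_le)
      have "4 / e\<^sup>2 < real (Suc m)" "4 / e\<^sup>2 < real (Suc n)" using N that by auto
      then have "2 / real (Suc m) \<le> e\<^sup>2 / 2" "2 / real (Suc n) \<le> e\<^sup>2 / 2"
        using e by (auto simp: field_simps)
      then show "(l2_norm (\<lambda>x. G m x - G n x))\<^sup>2 \<le> e\<^sup>2" using par[of m n] by linarith
    qed (use e in simp)
    then show ?thesis by blast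
  qed
  from l2_complete[OF sG this] obtain g
    where g: "square_integrable g" "(\<lambda>n. l2_norm (\<lambda>x. G n x - g x)) \<longlonglongrightarrow> 0" by blast
  have lim: "(\<lambda>n. l2_norm (\<lambda>x. g x - G n x)) \<longlonglongrightarrow> 0"
    using g(2) by (simp only: l2_norm_minus_commute[of g])
  have gV: "g \<in> V"
  proof -
    have "l2_inner g h = 0" if h: "h \<in> S" for h
    proof -
      have "(\<lambda>n. l2_inner (G n) h) \<longlonglongrightarrow> l2_inner g h"
        by (rule l2_inner_tendsto[OF sG g(1) lim S[OF h] S[OF h]]) (simp add: l2_norm_def)
      moreover have "l2_inner (G n) h = 0" for n using G(1)[of n] h by (simp add: V_def)
      ultimately show ?thesis by (simp add: LIMSEQ_const_iff)
    qed
    then show ?thesis using g(1) by (simp add: V_def)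
  qed
  have sfg: "square_integrable (\<lambda>x. f x - g x)" by (intro square_integrable_intros f g)
  have "?q g \<le> d"
  proof -
    have "(\<lambda>n. l2_norm (\<lambda>x. f x - G n x)) \<longlonglongrightarrow> l2_norm (\<lambda>x. f x - g x)"
    proof (rule l2_norm_tendsto)
      show "square_integrable (\<lambda>x. f x - G n x)" for n by (intro square_integrable_intros f sG)
      show "(\<lambda>n. l2_norm (\<lambda>x. f x - g x - (f x - G n x))) \<longlonglongrightarrow> 0"
        using g(2) by simp
    qed (rule sfg)
    then have "(\<lambda>n. ?q (G n)) \<longlonglongrightarrow> ?q g" by (rule tendsto_power)
    moreover have "(\<lambda>n. d + 1 / real (Suc n)) \<longlonglongrightarrow> d + 0"
      by (intro tendsto_intros LIMSEQ_Suc[OF lim_1_over_n])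
    ultimately have "?q g \<le> d + 0"
      using G(2) by (intro LIMSEQ_le) (auto intro: less_imp_le)
    then show ?thesis by simp
  qed
  have "l2_inner (\<lambda>x. f x - g x) k = 0" if k: "k \<in> V" for k
  proof -
    let ?i = "l2_inner (\<lambda>x. f x - g x) k" and ?n = "(l2_norm k)\<^sup>2"
    have ineq: "2 * t * ?i \<le> t\<^sup>2 * ?n" for t
    proof -
      have "d \<le> ?q (\<lambda>x. g x + t *\<^sub>R k x)" by (intro dle Vadd gV k)
      also have "(\<lambda>x. f x - (g x + t *\<^sub>R k x)) = (\<lambda>x. (f x - g x) - t *\<^sub>R k x)" by (simp add: diff_diff_eq)
      also have "(l2_norm (\<lambda>x. (f x - g x) - t *\<^sub>R k x))\<^sup>2 = ?q g - 2 * t * ?i + t\<^sup>2 * ?n"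
        using Vsq[OF k] by (subst l2_norm_diff_sq[OF sfg])
          (simp_all add: square_integrable_intros l2_inner_scaleR_right l2_norm_scaleR power_mult_distrib)
      finally show ?thesis using \<open>?q g \<le> d\<close> by linarith
    qed
    show ?thesis
    proof (rule ccontr)
      assume "?i \<noteq> 0"
      then have pos: "?i\<^sup>2 > 0" by simp
      have n1: "?n + 1 > 0" using zero_le_power2[of "l2_norm k"] by linarith
      have "2 * (?i / (?n + 1)) * ?i \<le> (?i / (?n + 1))\<^sup>2 * ?n" by (rule ineq)
      also have "\<dots> \<le> (?i / (?n + 1))\<^sup>2 * (?n + 1)" by (intro mult_left_mono) auto
      also have "\<dots> = ?i\<^sup>2 / (?n + 1)" using n1 by (simp add: power2_eq_square)
      also have "\<dots> < 2 * (?i\<^sup>2 / (?n + 1))" using divide_pos_pos[OF pos n1] by linarith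
      finally show False by (simp add: power2_eq_square)
    qed
  qed
  with gV show ?thesis by blast
qed

subsection \<open>Divergence-free fields\<close>

lemma integrable_continuous_compact_support:
  fixes g :: "'a::euclidean_space \<Rightarrow> 'b::euclidean_space"
  assumes g: "continuous_on UNIV g" and K: "compact K" "\<And>x. x \<notin> K \<Longrightarrow> g x = 0"
  shows "integrable lborel g" and "square_integrable g"
proof -
  have gm [measurable]: "g \<in> borel_measurable borel" using g by (rule borel_measurable_continuous_onI)
  have "bounded (g ` K)"
    using compact_continuous_image[OF continuous_on_subset[OF g] K(1)] by (auto intro: compact_imp_bounded)
  then obtain B0 where B0: "\<And>x. x \<in> K \<Longrightarrow> norm (g x) \<le> B0" by (auto simp: bounded_iff)
  define B where "B = max B0 0"
  have B: "norm (g x) \<le> B * indicator K x" for x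
    using B0[of x] K(2)[of x] by (cases "x \<in> K") (auto simp: B_def)
  have [measurable]: "K \<in> sets borel" using K(1) by (simp add: borel_compact)
  have ind: "integrable lborel (indicator K :: 'a \<Rightarrow> real)"
    using emeasure_bounded_finite[OF compact_imp_bounded[OF K(1)]] by (intro integrable_real_indicator) auto
  show "integrable lborel g"
    by (rule Bochner_Integration.integrable_bound[of _ "\<lambda>x. B * indicator K x"])
      (use ind B in \<open>auto intro: order_trans[OF _ abs_ge_self]\<close>)
  show "square_integrable g"
  proof (rule square_integrable_dominated[OF gm])
    show "integrable lborel (\<lambda>x. B\<^sup>2 * indicator K x)" using ind by simp
    show "(norm (g x))\<^sup>2 \<le> B\<^sup>2 * indicator K x" for x
      using power_mono[OF B[of x] norm_ge_zero, of 2] by (cases "x \<in> K") auto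
  qed
qed

lemma has_derivative_zero_outside_support:
  fixes \<psi> :: "'a::euclidean_space \<Rightarrow> 'b::real_normed_vector"
  assumes K: "closed K" "\<And>x. x \<notin> K \<Longrightarrow> \<psi> x = 0" and D: "(\<psi> has_derivative D) (at x)" and x: "x \<notin> K"
  shows "D = (\<lambda>h. 0)"
proof -
  have "((\<lambda>_. 0) has_derivative D) (at x)"
    by (rule has_derivative_transform_within_open[OF D, of "- K"]) (use K x in auto)
  then show ?thesis using has_derivative_unique[OF has_derivative_const] by blast
qed

text \<open>The integral of a derivative of a compactly supported function is the limit of the integrals
  of difference quotients, which vanish by translation invariance.\<close>

lemma integral_directional_derivative_eq_0:
  fixes \<psi> :: "'a::euclidean_space \<Rightarrow> real"
  assumes D: "\<And>x. (\<psi> has_derivative \<psi>' x) (at x)" and cont: "continuous_on UNIV (\<lambda>x. \<psi>' x e)"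
    and K: "compact K" "\<And>x. x \<notin> K \<Longrightarrow> \<psi> x = 0"
  shows "(LINT x|lborel. \<psi>' x e) = 0"
proof -
  have cpsi: "continuous_on UNIV \<psi>"
    using D by (auto intro!: continuous_at_imp_continuous_on has_derivative_continuous)
  have [measurable]: "\<psi> \<in> borel_measurable borel" "(\<lambda>x. \<psi>' x e) \<in> borel_measurable borel"
    using cpsi cont by (auto intro: borel_measurable_continuous_onI)
  have out: "\<psi>' x e = 0" if "x \<notin> K" for x
    using has_derivative_zero_outside_support[OF compact_imp_closed[OF K(1)] K(2) D that] by simp
  have int: "integrable lborel \<psi>"
    by (rule integrable_continuous_compact_support(1)[OF cpsi K])
  have "bounded ((\<lambda>x. \<psi>' x e) ` K)"
    using compact_continuous_image[OF continuous_on_subset[OF cont] K(1)] by (auto intro: compact_imp_bounded)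
  then obtain B0 where B0: "\<And>x. x \<in> K \<Longrightarrow> \<bar>\<psi>' x e\<bar> \<le> B0" by (auto simp: bounded_iff)
  define B where "B = max B0 0"
  have B: "\<bar>\<psi>' x e\<bar> \<le> B" for x
    using B0[of x] out[of x] by (cases "x \<in> K") (auto simp: B_def)
  obtain R where R: "\<And>x. x \<in> K \<Longrightarrow> norm x \<le> R" using compact_imp_bounded[OF K(1)] by (auto simp: bounded_iff)
  have line: "((\<lambda>t. \<psi> (x + t *\<^sub>R e)) has_real_derivative \<psi>' (x + t *\<^sub>R e) e) (at t)" for x t
  proof -
    have "((\<lambda>t. \<psi> (x + t *\<^sub>R e)) has_derivative (\<lambda>h. \<psi>' (x + t *\<^sub>R e) (h *\<^sub>R e))) (at t)"
      by (rule has_derivative_compose[of "\<lambda>t. x + t *\<^sub>R e" _ _ _ \<psi>, OF _ D]) (auto intro!: derivative_eq_intros)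
    moreover have "\<psi>' (x + t *\<^sub>R e) (h *\<^sub>R e) = \<psi>' (x + t *\<^sub>R e) e * h" for h
      using has_derivative_linear[OF D] by (simp add: linear_scale)
    ultimately show ?thesis by (simp add: has_field_derivative_def)
  qed
  let ?h = "\<lambda>n. 1 / real (Suc n)"
  let ?s = "\<lambda>n x. (\<psi> (x + ?h n *\<^sub>R e) - \<psi> x) / ?h n"
  have "(\<lambda>n. LINT x|lborel. ?s n x) \<longlonglongrightarrow> (LINT x|lborel. \<psi>' x e)"
  proof (rule integral_dominated_convergence[where w="\<lambda>x. B * indicator (cball 0 (R + norm e)) x"])
    show "integrable lborel (\<lambda>x. B * indicator (cball (0::'a) (R + norm e)) x)"
      using emeasure_bounded_finite[OF bounded_cball, of "0::'a" "R + norm e"]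
      by (intro integrable_mult_right integrable_real_indicator) auto
    have "(\<lambda>n. ?s n x) \<longlonglongrightarrow> \<psi>' x e" for x
    proof -
      have "((\<lambda>h. (\<psi> (x + (0 + h) *\<^sub>R e) - \<psi> (x + 0 *\<^sub>R e)) / h) \<longlongrightarrow> \<psi>' (x + 0 *\<^sub>R e) e) (at 0)"
        using line[of x 0] unfolding DERIV_def .
      then have l: "((\<lambda>h. (\<psi> (x + h *\<^sub>R e) - \<psi> x) / h) \<longlongrightarrow> \<psi>' x e) (at 0)" by simp
      have "filterlim ?h (at 0) sequentially"
        by (rule filterlim_atI[OF LIMSEQ_Suc[OF lim_1_over_n]]) simp
      from filterlim_compose[OF l this] show ?thesis .
    qed
    then show "AE x in lborel. (\<lambda>n. ?s n x) \<longlonglongrightarrow> \<psi>' x e" by simp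
    show "AE x in lborel. norm (?s n x) \<le> B * indicator (cball 0 (R + norm e)) x" for n
    proof (rule AE_I2)
      fix x :: 'a
      have hn: "0 < ?h n" "?h n \<le> 1" by auto
      show "norm (?s n x) \<le> B * indicator (cball 0 (R + norm e)) x"
      proof (cases "x \<in> cball 0 (R + norm e)")
        case True
        obtain z where "\<psi> (x + ?h n *\<^sub>R e) - \<psi> (x + 0 *\<^sub>R e) = (?h n - 0) * \<psi>' (x + z *\<^sub>R e) e"
          using MVT2[OF hn(1), of "\<lambda>t. \<psi> (x + t *\<^sub>R e)" "\<lambda>t. \<psi>' (x + t *\<^sub>R e) e"] line by blast
        then have "?s n x = \<psi>' (x + z *\<^sub>R e) e" using hn by simp
        then show ?thesis using B True by simp
      next
        case False
        then have x: "norm x > R + norm e" by simp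
        have "norm (?h n *\<^sub>R e) \<le> 1 * norm e"
          using hn by (simp only: norm_scaleR, intro mult_right_mono) auto
        then have "norm (x + ?h n *\<^sub>R e) > R"
          using x norm_diff_ineq[of x "?h n *\<^sub>R e"] by linarith
        then have "x + ?h n *\<^sub>R e \<notin> K" using R by fastforce
        moreover have "x \<notin> K" using R[of x] x norm_ge_zero[of e] by linarith
        ultimately show ?thesis using K(2) False by simp
      qed
    qed
  qed measurable
  moreover have "(LINT x|lborel. ?s n x) = 0" for n
  proof -
    let ?c = "?h n *\<^sub>R e"
    have tr: "(\<lambda>x. ?c + x) \<in> measurable lborel borel" by measurable
    have i: "integrable lborel (\<lambda>x. \<psi> (?c + x))"
      using integrable_distr_eq[OF tr, of \<psi>] int by (simp add: lborel_distr_plus)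
    have "(LINT x|lborel. \<psi> (?c + x)) = (LINT x|lborel. \<psi> x)"
      using integral_distr[OF tr, of \<psi>] by (simp add: lborel_distr_plus)
    moreover have "(\<lambda>x. \<psi> (x + ?c)) = (\<lambda>x. \<psi> (?c + x))" by (simp only: add.commute)
    ultimately have "integrable lborel (\<lambda>x. \<psi> (x + ?c))" "(LINT x|lborel. \<psi> (x + ?c)) = (LINT x|lborel. \<psi> x)"
      using i by (simp_all only:)
    then show ?thesis
      by (simp only: integral_divide_zero Bochner_Integration.integral_diff[OF _ int]) simp
  qed
  ultimately show ?thesis by (simp add: LIMSEQ_const_iff)
qed

lemma partial_eq: "(f has_derivative f') (at x) \<Longrightarrow> partial i f x = f' (axis i 1)"
  by (simp add: partial_def frechet_derivative_at[symmetric])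

definition test_function :: "(real^3 \<Rightarrow> real) \<Rightarrow> bool" where
  "test_function \<phi> \<longleftrightarrow> smooth_on \<phi> UNIV \<and> compact (closure {x. \<phi> x \<noteq> 0})"

definition gradient_field :: "(real^3 \<Rightarrow> real) \<Rightarrow> cfield" where
  "gradient_field \<phi> x = (\<chi> i. complex_of_real (partial i \<phi> x))"

lemma test_function_derivative:
  assumes "test_function \<phi>"
  obtains \<phi>' where "\<And>x. (\<phi> has_derivative \<phi>' x) (at x)" "\<And>v. continuous_on UNIV (\<lambda>x. \<phi>' x v)"
proof -
  have "Ck_on (Suc 0) \<phi> UNIV" using assms unfolding test_function_def smooth_on_def by blast
  then obtain \<phi>' where "\<forall>x. (\<phi> has_derivative \<phi>' x) (at x)" "\<forall>v. continuous_on UNIV (\<lambda>x. \<phi>' x v)"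
    by auto
  then show ?thesis using that[of \<phi>'] by simp
qed

lemma derivative_outside_support:
  fixes \<phi> :: "'a::euclidean_space \<Rightarrow> real"
  assumes x: "x \<notin> closure {x. \<phi> x \<noteq> 0}"
  shows "\<phi> x = 0" and "(\<phi> has_derivative D) (at x) \<Longrightarrow> D = (\<lambda>h. 0)"
proof -
  have 0: "\<phi> x = 0" if "x \<notin> closure {x. \<phi> x \<noteq> 0}" for x
    using that closure_subset[of "{x. \<phi> x \<noteq> 0}"] by auto
  show "\<phi> x = 0" by (rule 0[OF x])
  show "D = (\<lambda>h. 0)" if "(\<phi> has_derivative D) (at x)"
    by (rule has_derivative_zero_outside_support[OF closed_closure 0 that x])
qed

lemma gradient_field_square_integrable:
  assumes t: "test_function \<phi>"
  shows "square_integrable (gradient_field \<phi>)"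
proof -
  obtain \<phi>' where \<phi>': "\<And>x. (\<phi> has_derivative \<phi>' x) (at x)" "\<And>v. continuous_on UNIV (\<lambda>x. \<phi>' x v)"
    using test_function_derivative[OF t] by blast
  let ?K = "closure {x. \<phi> x \<noteq> 0}"
  have eq: "gradient_field \<phi> x = (\<chi> i. complex_of_real (\<phi>' x (axis i 1)))" for x
    by (simp add: gradient_field_def partial_eq[OF \<phi>'(1)])
  show ?thesis
  proof (rule integrable_continuous_compact_support(2))
    show "continuous_on UNIV (gradient_field \<phi>)"
      unfolding eq[abs_def] by (intro continuous_intros \<phi>'(2))
    show "compact ?K" using t by (simp add: test_function_def)
    show "gradient_field \<phi> x = 0" if "x \<notin> ?K" for x
      using derivative_outside_support(2)[OF that \<phi>'(1)]
      by (simp add: eq vec_eq_iff)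
  qed
qed

lemma square_integrable_smult:
  fixes f :: "'a::euclidean_space \<Rightarrow> complex^'n"
  assumes "square_integrable f"
  shows "square_integrable (\<lambda>x. c *s f x)"
proof (rule square_integrable_bound[OF _ assms, where C="norm c"])
  show "(\<lambda>x. c *s f x) \<in> borel_measurable borel" using assms by measurable
qed (simp add: norm_smult_vec)

lemma L2_inner_eq:
  assumes "square_integrable f" "square_integrable g"
  shows "L2_inner f g = Complex (l2_inner f g) (l2_inner f (\<lambda>x. \<i> *s g x))"
proof -
  have re: "a \<bullet> b = Re (a * cnj b)" for a b :: complex by (simp add: inner_complex_def)
  let ?h = "\<lambda>x. \<Sum>i\<in>UNIV. f x $ i * cnj (g x $ i)"
  have [measurable]: "cnj \<in> borel_measurable borel" "f \<in> borel_measurable borel" "g \<in> borel_measurable borel"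
    using assms by (auto intro: square_integrable_measurable borel_measurable_continuous_onI continuous_intros)
  have m: "(\<lambda>x. f x $ i * cnj (g x $ i)) \<in> borel_measurable borel" for i by measurable
  have h: "integrable lborel ?h"
  proof (rule Bochner_Integration.integrable_sum)
    fix i
    show "integrable lborel (\<lambda>x. f x $ i * cnj (g x $ i))"
      by (rule Bochner_Integration.integrable_bound[OF square_integrable_norm_mult[OF
          square_integrable_component[OF assms(1), of i] square_integrable_component[OF assms(2), of i]]])
        (use m in \<open>auto simp: norm_mult\<close>)
  qed
  have "Re (L2_inner f g) = l2_inner f g"
    unfolding L2_inner_def l2_inner_def integral_bounded_linear[OF bounded_linear_Re h, symmetric]
    by (simp add: inner_vec_def re)
  moreover have "Im (L2_inner f g) = l2_inner f (\<lambda>x. \<i> *s g x)"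
    unfolding L2_inner_def l2_inner_def integral_bounded_linear[OF bounded_linear_Im h, symmetric]
    by (simp add: inner_vec_def re algebra_simps)
  ultimately show ?thesis by (simp add: complex_eq_iff)
qed

text \<open>Against real test functions the real and the imaginary part of a field decouple. Including the
  gradients multiplied by \<open>\<i>\<close> therefore exhibits the divergence-free fields as an orthogonal complement
  for the real inner product.\<close>

lemma divergence_free_iff:
  assumes f: "square_integrable f"
  shows "divergence_free f \<longleftrightarrow>
    (\<forall>h \<in> gradient_field ` {\<phi>. test_function \<phi>} \<union> (\<lambda>\<phi> x. \<i> *s gradient_field \<phi> x) ` {\<phi>. test_function \<phi>}. l2_inner f h = 0)"
proof -
  have "(LINT x|lborel. (\<Sum>i\<in>UNIV. f x $ i * complex_of_real (partial i \<phi> x))) = L2_inner f (gradient_field \<phi>)" for \<phi>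
    by (simp add: L2_inner_def gradient_field_def)
  then have "divergence_free f \<longleftrightarrow> (\<forall>\<phi>. test_function \<phi> \<longrightarrow> L2_inner f (gradient_field \<phi>) = 0)"
    by (simp add: divergence_free_def test_function_def)
  also have "\<dots> \<longleftrightarrow> (\<forall>\<phi>. test_function \<phi> \<longrightarrow> l2_inner f (gradient_field \<phi>) = 0 \<and> l2_inner f (\<lambda>x. \<i> *s gradient_field \<phi> x) = 0)"
    using L2_inner_eq[OF f gradient_field_square_integrable] by (auto simp: complex_eq_iff)
  finally show ?thesis by blast
qed

lemma divergence_free_diff:
  assumes "square_integrable f" "square_integrable g" "divergence_free f" "divergence_free g"
  shows "divergence_free (\<lambda>x. f x - g x)"
  using assms
  by (auto simp: divergence_free_iff square_integrable_intros l2_inner_simps gradient_field_square_integrable square_integrable_smult)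

lemma divergence_free_add:
  assumes "square_integrable f" "square_integrable g" "divergence_free f" "divergence_free g"
  shows "divergence_free (\<lambda>x. f x + g x)"
  using assms
  by (auto simp: divergence_free_iff square_integrable_intros l2_inner_simps gradient_field_square_integrable square_integrable_smult)

lemma divergence_free_smult:
  assumes "divergence_free f"
  shows "divergence_free (\<lambda>x. c *s f x)"
  using assms by (simp add: divergence_free_def mult.assoc sum_distrib_left[symmetric])

text \<open>The projection theorem gives a field that is orthogonal for the real inner product. As the
  divergence-free fields are stable under multiplication by \<open>\<i>\<close>, it is orthogonal for the Hermitian one,
  so the choice in the definition of the projection is not void.\<close>

lemma leray_properties:
  assumes f: "square_integrable f"
  shows "square_integrable (leray f)" "divergence_free (leray f)"
    and "\<And>h. square_integrable h \<Longrightarrow> divergence_free h \<Longrightarrow> l2_inner (\<lambda>x. f x - leray f x) h = 0"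
proof -
  let ?S = "gradient_field ` {\<phi>. test_function \<phi>} \<union> (\<lambda>\<phi> x. \<i> *s gradient_field \<phi> x) ` {\<phi>. test_function \<phi>}"
  let ?P = "\<lambda>g. L2 g \<and> divergence_free g \<and> (\<forall>h. L2 h \<and> divergence_free h \<longrightarrow> L2_inner (\<lambda>x. f x - g x) h = 0)"
  have S: "square_integrable h" if "h \<in> ?S" for h
    using that by (auto intro: gradient_field_square_integrable square_integrable_smult)
  have eq: "{g. square_integrable g \<and> (\<forall>h\<in>?S. l2_inner g h = 0)} = {g. square_integrable g \<and> divergence_free g}"
    by (intro Collect_cong conj_cong refl) (rule divergence_free_iff[symmetric])
  have "\<exists>g\<in>{g. square_integrable g \<and> divergence_free g}.
      \<forall>k\<in>{g. square_integrable g \<and> divergence_free g}. l2_inner (\<lambda>x. f x - g x) k = 0"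
    using l2_projection_exists[OF f S, of ?S] unfolding eq by simp
  then obtain g where g: "square_integrable g" "divergence_free g"
      "\<And>k. square_integrable k \<Longrightarrow> divergence_free k \<Longrightarrow> l2_inner (\<lambda>x. f x - g x) k = 0"
    by auto
  have sfg: "square_integrable (\<lambda>x. f x - g x)" by (intro square_integrable_intros f g)
  have "?P g"
    using g by (auto simp: L2_iff L2_inner_eq[OF sfg] complex_eq_iff square_integrable_smult divergence_free_smult)
  then have P: "?P (leray f)" unfolding leray_def by (rule someI[of ?P])
  then show s: "square_integrable (leray f)" "divergence_free (leray f)" by (auto simp: L2_iff)
  show "l2_inner (\<lambda>x. f x - leray f x) h = 0" if h: "square_integrable h" "divergence_free h" for h
  proof -
    have "L2_inner (\<lambda>x. f x - leray f x) h = 0" using P h by (simp add: L2_iff)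
    then show ?thesis
      using L2_inner_eq[OF square_integrable_diff[OF f s(1)] h(1)] by (simp add: complex_eq_iff)
  qed
qed

lemma l2_inner_leray:
  assumes "square_integrable f" "square_integrable h" "divergence_free h"
  shows "l2_inner (leray f) h = l2_inner f h"
  using leray_properties(3)[OF assms] leray_properties(1)[OF assms(1)] assms by (simp add: l2_inner_simps)

lemma l2_norm_leray_le:
  assumes f: "square_integrable f"
  shows "l2_norm (leray f) \<le> l2_norm f"
proof (cases "l2_norm (leray f) = 0")
  case False
  note L = leray_properties[OF f]
  have "l2_norm (leray f) * l2_norm (leray f) = l2_inner f (leray f)"
    using l2_inner_leray[OF f L(1,2)] by (simp add: l2_norm_sq_inner[symmetric] power2_eq_square)
  also have "\<dots> \<le> l2_norm f * l2_norm (leray f)" using l2_Cauchy_Schwarz[OF f L(1)] by simp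
  finally show ?thesis using False by (simp add: mult_le_cancel_right less_le)
qed simp

text \<open>The difference is divergence-free, hence orthogonal to itself.\<close>

lemma leray_of_divergence_free:
  assumes f: "square_integrable f" "divergence_free f"
  shows "AE x in lborel. leray f x = f x"
proof -
  note L = leray_properties[OF f(1)]
  let ?k = "\<lambda>x. f x - leray f x"
  have k: "square_integrable ?k" "divergence_free ?k"
    using f L by (auto intro: square_integrable_intros divergence_free_diff)
  have "(l2_norm ?k)\<^sup>2 = 0" using L(3)[OF k] by (simp add: l2_norm_sq_inner)
  then have "l2_norm ?k \<le> 0" by simp
  from l2_norm_le_0_AE_eq[OF f(1) L(1) this] show ?thesis by eventually_elim simp
qed

text \<open>Integrate \<open>\<partial>\<^sub>i (v\<^sub>i \<phi>)\<close>, whose integral vanishes, and sum over \<open>i\<close>.\<close>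

lemma divergence_free_complexify:
  assumes D: "\<And>x. (v has_derivative v' x) (at x)" and cont: "\<And>i. continuous_on UNIV (\<lambda>x. v' x (axis i 1))"
    and div: "\<And>x. divergence v x = 0"
  shows "divergence_free (complexify v)"
  unfolding divergence_free_def
proof (intro allI impI)
  fix \<phi> :: "real^3 \<Rightarrow> real"
  define K where "K = closure {x. \<phi> x \<noteq> 0}"
  assume "smooth_on \<phi> UNIV \<and> compact (closure {x. \<phi> x \<noteq> 0})"
  then have t: "test_function \<phi>" and K: "compact K" by (auto simp: test_function_def K_def)
  obtain \<phi>' where \<phi>': "\<And>x. (\<phi> has_derivative \<phi>' x) (at x)" "\<And>v. continuous_on UNIV (\<lambda>x. \<phi>' x v)"
    using test_function_derivative[OF t] by blast
  have cv: "continuous_on UNIV v" and c\<phi>: "continuous_on UNIV \<phi>"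
    using D \<phi>'(1) by (auto intro!: continuous_at_imp_continuous_on has_derivative_continuous)
  have \<phi>0: "\<phi> x = 0" "\<phi>' x = (\<lambda>h. 0)" if "x \<notin> K" for x
    using derivative_outside_support[OF that[unfolded K_def]] \<phi>'(1) by blast+
  let ?a = "\<lambda>i x. v x $ i * \<phi>' x (axis i 1)" and ?b = "\<lambda>i x. v' x (axis i 1) $ i * \<phi> x"
  have ia: "integrable lborel (?a i)" and ib: "integrable lborel (?b i)" for i
  proof -
    have "continuous_on UNIV (?a i)" "continuous_on UNIV (?b i)"
      by (intro continuous_intros cv cont c\<phi> \<phi>'(2))+
    then show "integrable lborel (?a i)" "integrable lborel (?b i)"
      using integrable_continuous_compact_support(1)[OF _ K, of "?a i"]
        integrable_continuous_compact_support(1)[OF _ K, of "?b i"] by (simp_all add: \<phi>0)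
  qed
  have sum0: "(LINT x|lborel. ?a i x + ?b i x) = 0" for i
  proof (rule integral_directional_derivative_eq_0[where \<psi>="\<lambda>x. v x $ i * \<phi> x" and \<psi>'="\<lambda>x h. v x $ i * \<phi>' x h + v' x h $ i * \<phi> x" and e="axis i 1", OF _ _ K])
    show "((\<lambda>x. v x $ i * \<phi> x) has_derivative (\<lambda>h. v x $ i * \<phi>' x h + v' x h $ i * \<phi> x)) (at x)" for x
      by (intro has_derivative_mult \<phi>'(1) bounded_linear.has_derivative[OF bounded_linear_vec_nth D])
    show "continuous_on UNIV (\<lambda>x. v x $ i * \<phi>' x (axis i 1) + v' x (axis i 1) $ i * \<phi> x)"
      by (intro continuous_intros cv \<phi>'(2) cont c\<phi>)
  qed (simp add: \<phi>0)
  have ab: "(LINT x|lborel. ?a i x) = - (LINT x|lborel. ?b i x)" for i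
    using Bochner_Integration.integral_add[OF ia[of i] ib[of i]] sum0[of i] by linarith
  have "(LINT x|lborel. (\<Sum>i\<in>UNIV. ?a i x)) = (\<Sum>i\<in>UNIV. (LINT x|lborel. ?a i x))"
    by (rule Bochner_Integration.integral_sum) (rule ia)
  also have "\<dots> = - (\<Sum>i\<in>UNIV. (LINT x|lborel. ?b i x))"
    by (simp add: ab sum_negf)
  also have "(\<Sum>i\<in>UNIV. (LINT x|lborel. ?b i x)) = (LINT x|lborel. (\<Sum>i\<in>UNIV. ?b i x))"
    by (rule Bochner_Integration.integral_sum[symmetric]) (rule ib)
  also have "(\<lambda>x. \<Sum>i\<in>UNIV. ?b i x) = (\<lambda>x. divergence v x * \<phi> x)"
    by (simp add: divergence_def partial_eq[OF D] sum_distrib_right)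
  finally have z: "(LINT x|lborel. (\<Sum>i\<in>UNIV. ?a i x)) = 0" by (simp add: div)
  have "(LINT x|lborel. (\<Sum>i\<in>UNIV. complexify v x $ i * complex_of_real (partial i \<phi> x)))
      = (LINT x|lborel. complex_of_real (\<Sum>i\<in>UNIV. ?a i x))"
    by (simp add: complexify_def partial_eq[OF \<phi>'(1)])
  also have "\<dots> = 0" by (simp only: integral_complex_of_real z of_real_0)
  finally show "(LINT x|lborel. (\<Sum>i\<in>UNIV. complexify v x $ i * complex_of_real (partial i \<phi> x))) = 0" .
qed

section \<open>Fields with rapidly decaying Fourier transform\<close>

text \<open>The weight \<open>\<langle>\<xi>\<rangle>\<close> whose \<open>s\<close>-th power defines the Sobolev space of order \<open>s\<close>.\<close>

definition bracket :: "'a::euclidean_space \<Rightarrow> real" where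
  "bracket \<xi> = sqrt (1 + (norm \<xi>)\<^sup>2)"

lemma bracket_sq: "(bracket \<xi>)\<^sup>2 = 1 + (norm \<xi>)\<^sup>2"
  by (simp add: bracket_def add_nonneg_nonneg)

lemma bracket_ge_1 [simp]: "1 \<le> bracket \<xi>"
  by (simp add: bracket_def)

lemma bracket_pos [simp]: "0 < bracket \<xi>" "0 \<le> bracket \<xi>"
  using bracket_ge_1[of \<xi>] by linarith+

lemma norm_le_bracket: "norm \<xi> \<le> bracket \<xi>"
  by (rule power2_le_imp_le) (simp_all add: bracket_sq)

lemma bracket_measurable [measurable]: "bracket \<in> borel_measurable borel"
  unfolding bracket_def by measurable

lemma bracket_power_mono: "m \<le> n \<Longrightarrow> bracket \<xi> ^ m \<le> bracket \<xi> ^ n"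
  by (simp add: power_increasing)

text \<open>The negative power of the weight is square-integrable, being dominated by a product of
  one-dimensional Cauchy densities.\<close>

lemma square_integrable_inverse_bracket:
  "square_integrable (\<lambda>\<xi>::'a::euclidean_space. 1 / bracket \<xi> ^ DIM('a))"
proof (rule square_integrable_dominated)
  have "integrable lborel (\<lambda>x::real. inverse (1 + x\<^sup>2))"
    using integrable_inverse_1_plus_square by (simp add: set_integrable_def)
  then show "integrable lborel (\<lambda>\<xi>::'a. \<Prod>b\<in>Basis. inverse (1 + (\<xi> \<bullet> b)\<^sup>2))"
    by (rule integrable_lborel_prod_Basis(1))
  fix \<xi> :: 'a
  have "(\<Prod>b\<in>(Basis::'a set). inverse ((bracket \<xi>)\<^sup>2)) \<le> (\<Prod>b\<in>Basis. inverse (1 + (\<xi> \<bullet> b)\<^sup>2))"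
  proof (intro prod_mono conjI)
    fix b :: 'a assume b: "b \<in> Basis"
    have "\<bar>\<xi> \<bullet> b\<bar>\<^sup>2 \<le> (norm \<xi>)\<^sup>2" by (rule power_mono[OF Basis_le_norm[OF b]]) simp
    then show "inverse ((bracket \<xi>)\<^sup>2) \<le> inverse (1 + (\<xi> \<bullet> b)\<^sup>2)"
      by (simp add: bracket_sq le_imp_inverse_le add_pos_nonneg)
  qed simp
  then show "(norm (1 / bracket \<xi> ^ DIM('a)))\<^sup>2 \<le> (\<Prod>b\<in>Basis. inverse (1 + (\<xi> \<bullet> b)\<^sup>2))"
    by (simp add: power_divide divide_inverse power_mult[symmetric] mult.commute power_inverse)
qed measurable

definition decay_norm :: "cfield \<Rightarrow> real" where
  "decay_norm g = l2_norm (\<lambda>\<xi>. bracket \<xi> ^ 7 *\<^sub>R g \<xi>)"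

text \<open>The exponent is 4 + 3. Three powers make the inverse weight square-integrable in dimension three, and
  four moments in \<open>L\<^sup>1\<close> remain: a curl costs one of them, and differentiating a Fourier integral with a
  continuous derivative costs three.\<close>

definition decaying :: "cfield \<Rightarrow> bool" where
  "decaying g \<longleftrightarrow> g \<in> borel_measurable borel \<and> square_integrable (\<lambda>\<xi>. bracket \<xi> ^ 7 *\<^sub>R g \<xi>)"

definition decay_const :: real where
  "decay_const = l2_norm (\<lambda>\<xi>::real^3. 1 / bracket \<xi> ^ 3)"

lemma decaying_L1:
  assumes "decaying g"
  shows "integrable lborel (\<lambda>\<xi>. bracket \<xi> ^ 4 * norm (g \<xi>))"
    and "(LINT \<xi>|lborel. bracket \<xi> ^ 4 * norm (g \<xi>)) \<le> decay_const * decay_norm g"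
proof -
  let ?a = "\<lambda>\<xi>::real^3. 1 / bracket \<xi> ^ 3" and ?b = "\<lambda>\<xi>. bracket \<xi> ^ 7 *\<^sub>R g \<xi>"
  have a: "square_integrable ?a" using square_integrable_inverse_bracket[where 'a="real^3"] by simp
  have b: "square_integrable ?b" using assms by (simp add: decaying_def)
  have eq: "norm (?a \<xi>) * norm (?b \<xi>) = bracket \<xi> ^ 4 * norm (g \<xi>)" for \<xi>
  proof -
    have k7: "bracket \<xi> ^ 7 = bracket \<xi> ^ 3 * bracket \<xi> ^ 4" by (simp add: power_add[symmetric])
    have ne: "bracket \<xi> ^ 3 \<noteq> 0" using zero_less_power[OF bracket_pos(1), of \<xi> 3] by linarith
    have "norm (?a \<xi>) * norm (?b \<xi>) = (1 / bracket \<xi> ^ 3) * (bracket \<xi> ^ 7 * norm (g \<xi>))" by simp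
    also have "\<dots> = bracket \<xi> ^ 4 * norm (g \<xi>)"
      by (subst k7) (simp only: times_divide_eq_left mult_1_left mult.assoc nonzero_mult_div_cancel_left[OF ne])
    finally show ?thesis .
  qed
  show "integrable lborel (\<lambda>\<xi>. bracket \<xi> ^ 4 * norm (g \<xi>))"
    using square_integrable_norm_mult[OF a b] by (simp only: eq)
  show "(LINT \<xi>|lborel. bracket \<xi> ^ 4 * norm (g \<xi>)) \<le> decay_const * decay_norm g"
    using l2_Cauchy_Schwarz_norm[OF a b] by (simp only: eq decay_const_def decay_norm_def)
qed

lemma decaying_bounded:
  assumes g: "decaying g" and h: "h \<in> borel_measurable borel" and le: "\<And>\<xi>. norm (h \<xi>) \<le> bracket \<xi> ^ 4 * norm (g \<xi>)"
  shows "integrable lborel h" and "square_integrable (h :: cfield)" and "l2_norm h \<le> decay_norm g"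
proof -
  have [measurable]: "g \<in> borel_measurable borel" "h \<in> borel_measurable borel" using g h by (auto simp: decaying_def)
  show "integrable lborel h"
    by (rule Bochner_Integration.integrable_bound[OF decaying_L1(1)[OF g]])
      (use le in \<open>auto simp: abs_mult intro: order_trans[OF _ abs_ge_self]\<close>)
  have le7: "norm (h \<xi>) \<le> 1 * norm (bracket \<xi> ^ 7 *\<^sub>R g \<xi>)" for \<xi>
  proof -
    have "norm (h \<xi>) \<le> bracket \<xi> ^ 7 * norm (g \<xi>)"
      by (rule order_trans[OF le mult_right_mono[OF bracket_power_mono]]) auto
    then show ?thesis by simp
  qed
  have s: "square_integrable (\<lambda>\<xi>. bracket \<xi> ^ 7 *\<^sub>R g \<xi>)" using g by (simp add: decaying_def)
  show "square_integrable h" by (rule square_integrable_bound[OF h s le7])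
  show "l2_norm h \<le> decay_norm g"
    using l2_norm_mono[OF h s le7] by (simp add: decay_norm_def)
qed

lemma decaying_diff: "decaying f \<Longrightarrow> decaying g \<Longrightarrow> decaying (\<lambda>\<xi>. f \<xi> - g \<xi>)"
  by (auto simp: decaying_def scaleR_diff_right square_integrable_diff intro: borel_measurable_diff)

subsection \<open>Fourier integrals as classical functions\<close>

lemma vector_fourier_integral_linear:
  assumes f: "integrable lborel f" and g: "integrable lborel g"
  shows "vector_fourier_integral \<sigma> (\<lambda>x. f x + c *\<^sub>R g x) \<xi> = vector_fourier_integral \<sigma> f \<xi> + c *\<^sub>R vector_fourier_integral \<sigma> g \<xi>"
proof -
  have "integrable lborel (\<lambda>x. f x + c *\<^sub>R g x)" using f g by simp
  moreover have "fourier_integral \<sigma> (\<lambda>x. f x $ i + c *\<^sub>R g x $ i) \<xi> = fourier_integral \<sigma> (\<lambda>x. f x $ i) \<xi> + c *\<^sub>R fourier_integral \<sigma> (\<lambda>x. g x $ i) \<xi>" for i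
    using fourier_integral_add[OF integrable_component[OF f] integrable_component[OF integrable_scaleR_right[OF g, of c]], of \<sigma> i i \<xi>]
      fourier_integral_cmult[of \<sigma> "complex_of_real c" "\<lambda>x. g x $ i" \<xi>]
    by (simp add: scaleR_conv_of_real[where 'a=complex])
  ultimately show ?thesis
    using f g by (simp add: vec_eq_iff vector_fourier_integral_component)
qed

lemma norm_vector_fourier_integral_le:
  "norm (vector_fourier_integral \<sigma> f \<xi>) \<le> (2 * pi) powr (-3/2) * (LINT x|lborel. norm (f x))"
proof -
  have "norm (LINT x|lborel. cis (\<sigma> * (\<xi> \<bullet> x)) *s f x) \<le> (LINT x|lborel. norm (cis (\<sigma> * (\<xi> \<bullet> x)) *s f x))"
    by (rule integral_norm_bound)
  then show ?thesis by (simp add: vector_fourier_integral_def norm_smult_vec)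
qed

lemma norm_cis_expansion: "norm (cis t - 1 - \<i> * complex_of_real t) \<le> t\<^sup>2 / 2"
proof -
  have "norm (iexp t - (\<Sum>k\<le>1. (\<i> * t)^k / fact k)) \<le> \<bar>t\<bar>^(Suc 1) / fact (Suc 1)"
    by (rule iexp_approx1)
  then show ?thesis by (simp add: cis_conv_exp power2_eq_square algebra_simps)
qed

definition fourier_derivative :: "cfield \<Rightarrow> real^3 \<Rightarrow> cfield" where
  "fourier_derivative g h \<xi> = (\<i> * complex_of_real (\<xi> \<bullet> h)) *s g \<xi>"

lemma fourier_derivative_measurable [measurable]:
  assumes [measurable]: "g \<in> borel_measurable borel"
  shows "fourier_derivative g h \<in> borel_measurable borel"
  unfolding fourier_derivative_def by measurable

lemma norm_fourier_derivative_le: "norm (fourier_derivative g h \<xi>) \<le> norm h * (bracket \<xi> * norm (g \<xi>))"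
proof -
  have "\<bar>\<xi> \<bullet> h\<bar> \<le> norm h * bracket \<xi>"
    using Cauchy_Schwarz_ineq2[of \<xi> h] mult_right_mono[OF norm_le_bracket[of \<xi>] norm_ge_zero[of h]] by (simp add: mult.commute)
  from mult_right_mono[OF this norm_ge_zero[of "g \<xi>"]] show ?thesis
    by (simp add: fourier_derivative_def norm_smult_vec norm_mult mult.assoc)
qed

lemma integrable_bracket_mono:
  assumes g: "g \<in> borel_measurable borel" and i: "integrable lborel (\<lambda>\<xi>. bracket \<xi> ^ n * norm (g \<xi>))" and "m \<le> n"
  shows "integrable lborel (\<lambda>\<xi>. bracket \<xi> ^ m * norm (g \<xi> :: complex^3))"
proof (rule Bochner_Integration.integrable_bound[OF i])
  show "(\<lambda>\<xi>. bracket \<xi> ^ m * norm (g \<xi>)) \<in> borel_measurable lborel" using g by measurable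
  show "AE \<xi> in lborel. norm (bracket \<xi> ^ m * norm (g \<xi>)) \<le> norm (bracket \<xi> ^ n * norm (g \<xi>))"
    using mult_right_mono[OF bracket_power_mono[OF \<open>m \<le> n\<close>] norm_ge_zero] by (intro AE_I2) (simp add: abs_mult)
qed

lemma integrable_fourier_derivative:
  assumes g: "g \<in> borel_measurable borel" and i: "integrable lborel (\<lambda>\<xi>. bracket \<xi> ^ Suc n * norm (g \<xi>))"
  shows "integrable lborel (\<lambda>\<xi>. bracket \<xi> ^ n * norm (fourier_derivative g h \<xi>))"
proof (rule Bochner_Integration.integrable_bound)
  show "integrable lborel (\<lambda>\<xi>. norm h * (bracket \<xi> ^ Suc n * norm (g \<xi>)))" using i by simp
  show "(\<lambda>\<xi>. bracket \<xi> ^ n * norm (fourier_derivative g h \<xi>)) \<in> borel_measurable lborel" using g by measurable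
  have "bracket \<xi> ^ n * norm (fourier_derivative g h \<xi>) \<le> norm h * (bracket \<xi> ^ Suc n * norm (g \<xi>))" for \<xi>
    using mult_left_mono[OF norm_fourier_derivative_le[of g h \<xi>], of "bracket \<xi> ^ n"] by (simp add: mult_ac)
  then show "AE \<xi> in lborel. norm (bracket \<xi> ^ n * norm (fourier_derivative g h \<xi>)) \<le> norm (norm h * (bracket \<xi> ^ Suc n * norm (g \<xi>)))"
    by (auto simp: abs_mult intro: order_trans[OF _ abs_ge_self])
qed

lemma integrable_of_bracket:
  fixes g :: cfield
  assumes g: "g \<in> borel_measurable borel" and i: "integrable lborel (\<lambda>\<xi>. bracket \<xi> ^ n * norm (g \<xi>))"
  shows "integrable lborel g"
proof -
  have "integrable lborel (\<lambda>\<xi>. norm (g \<xi>))"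
    using integrable_bracket_mono[OF g i, of 0] by simp
  then show ?thesis using g by (simp add: integrable_norm_iff)
qed

text \<open>Since \<open>|cis t - 1 - i t| \<le> t\<^sup>2 / 2\<close>, a finite second moment bounds the remainder of the linear
  approximation by a multiple of the square of the increment.\<close>

lemma vector_fourier_integral_has_derivative:
  assumes g: "g \<in> borel_measurable borel" and i: "integrable lborel (\<lambda>\<xi>. bracket \<xi> ^ 2 * norm (g \<xi>))"
  shows "(vector_fourier_integral 1 g has_derivative (\<lambda>h. vector_fourier_integral 1 (fourier_derivative g h) x)) (at x)"
  unfolding has_derivative_at
proof
  let ?V = "vector_fourier_integral 1" and ?D = "fourier_derivative g"
  have ig: "integrable lborel g" by (rule integrable_of_bracket[OF g i])
  have iD: "integrable lborel (?D h)" for h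
  proof (rule integrable_of_bracket)
    show "integrable lborel (\<lambda>\<xi>. bracket \<xi> ^ 1 * norm (?D h \<xi>))"
      by (rule integrable_fourier_derivative[OF g]) (use i in \<open>simp add: numeral_2_eq_2\<close>)
    show "?D h \<in> borel_measurable borel" using g by measurable
  qed
  have "linear (\<lambda>h. ?V (?D h) x)"
  proof (rule linearI)
    have "?D (h + k) = (\<lambda>\<xi>. ?D h \<xi> + 1 *\<^sub>R ?D k \<xi>)" for h k
      by (simp add: fourier_derivative_def fun_eq_iff vec_eq_iff inner_add_right algebra_simps)
    then show "?V (?D (h + k)) x = ?V (?D h) x + ?V (?D k) x" for h k
      using vector_fourier_integral_linear[OF iD iD, of 1 h 1 k x] by simp
    have "?D (c *\<^sub>R h) = (\<lambda>\<xi>. 0 + c *\<^sub>R ?D h \<xi>)" for h c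
      by (simp add: fourier_derivative_def fun_eq_iff vec_eq_iff scaleR_conv_of_real[where 'a=complex])
    moreover have "?V (\<lambda>\<xi>. 0) x = 0" by (simp add: vector_fourier_integral_def)
    ultimately show "?V (?D (c *\<^sub>R h)) x = c *\<^sub>R ?V (?D h) x" for h c
      using vector_fourier_integral_linear[OF integrable_zero iD, of 1 c h x] by simp
  qed
  then show "bounded_linear (\<lambda>h. ?V (?D h) x)" by (simp add: linear_conv_bounded_linear)
  define C where "C = (2 * pi) powr (-3/2) * (LINT \<xi>|lborel. bracket \<xi> ^ 2 * norm (g \<xi>))"
  have C0: "0 \<le> C" unfolding C_def by (intro mult_nonneg_nonneg integral_nonneg) auto
  have rem: "norm (?V g (x + h) - ?V g x - ?V (?D h) x) \<le> C * (norm h)\<^sup>2" for h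
  proof -
    let ?r = "\<lambda>\<xi>. (cis (h \<bullet> \<xi>) - 1 - \<i> * complex_of_real (\<xi> \<bullet> h)) *s g \<xi>"
    have i1: "integrable lborel (\<lambda>\<xi>. cis (1 * ((x + h) \<bullet> \<xi>)) *s g \<xi>)" "integrable lborel (\<lambda>\<xi>. cis (1 * (x \<bullet> \<xi>)) *s g \<xi>)"
        "integrable lborel (\<lambda>\<xi>. cis (1 * (x \<bullet> \<xi>)) *s ?D h \<xi>)"
      by (intro integrable_cis_smult ig iD; simp)+
    have pt: "cis (1 * ((x + h) \<bullet> \<xi>)) *s g \<xi> - cis (1 * (x \<bullet> \<xi>)) *s g \<xi> - cis (1 * (x \<bullet> \<xi>)) *s ?D h \<xi>
        = cis (1 * (x \<bullet> \<xi>)) *s ?r \<xi>" for \<xi>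
      by (simp add: vec_eq_iff fourier_derivative_def inner_add_left cis_mult[symmetric] algebra_simps)
    have "?V g (x + h) - ?V g x - ?V (?D h) x = ?V ?r x"
      by (simp only: vector_fourier_integral_def scaleR_diff_right[symmetric] Bochner_Integration.integral_diff[symmetric] i1
          Bochner_Integration.integrable_diff pt)
    also have "norm \<dots> \<le> (2 * pi) powr (-3/2) * (LINT \<xi>|lborel. norm (?r \<xi>))"
      by (rule norm_vector_fourier_integral_le)
    also have "\<dots> \<le> (2 * pi) powr (-3/2) * (LINT \<xi>|lborel. (norm h)\<^sup>2 * (bracket \<xi> ^ 2 * norm (g \<xi>)))"
    proof (intro mult_left_mono)
      have le: "norm (?r \<xi>) \<le> (norm h)\<^sup>2 * (bracket \<xi> ^ 2 * norm (g \<xi>))" for \<xi>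
      proof -
        have "norm (cis (h \<bullet> \<xi>) - 1 - \<i> * complex_of_real (h \<bullet> \<xi>)) \<le> (h \<bullet> \<xi>)\<^sup>2"
          using norm_cis_expansion[of "h \<bullet> \<xi>"] zero_le_power2[of "h \<bullet> \<xi>"] by linarith
        also have "\<dots> \<le> (norm h * norm \<xi>)\<^sup>2"
          using power_mono[OF Cauchy_Schwarz_ineq2[of h \<xi>], of 2] by simp
        also have "\<dots> \<le> (norm h * bracket \<xi>)\<^sup>2"
          by (intro power_mono mult_left_mono norm_le_bracket) auto
        finally have "norm (cis (h \<bullet> \<xi>) - 1 - \<i> * complex_of_real (h \<bullet> \<xi>)) \<le> (norm h)\<^sup>2 * bracket \<xi> ^ 2"
          by (simp add: power_mult_distrib)
        from mult_right_mono[OF this norm_ge_zero[of "g \<xi>"]] show ?thesis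
          by (simp only: norm_smult_vec inner_commute[of \<xi> h] mult.assoc)
      qed
      have ri: "integrable lborel (\<lambda>\<xi>. (norm h)\<^sup>2 * (bracket \<xi> ^ 2 * norm (g \<xi>)))" using i by simp
      show "(LINT \<xi>|lborel. norm (?r \<xi>)) \<le> (LINT \<xi>|lborel. (norm h)\<^sup>2 * (bracket \<xi> ^ 2 * norm (g \<xi>)))"
        by (rule integral_mono'[OF ri le]) simp
    qed simp
    also have "\<dots> = C * (norm h)\<^sup>2" by (simp add: C_def)
    finally show ?thesis .
  qed
  show "(\<lambda>h. norm (?V g (x + h) - ?V g x - ?V (?D h) x) / norm h) \<midarrow>0\<rightarrow> 0"
  proof (rule Lim_null_comparison)
    show "\<forall>\<^sub>F h in at 0. norm (norm (?V g (x + h) - ?V g x - ?V (?D h) x) / norm h) \<le> C * norm h"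
      using rem by (intro always_eventually allI) (simp add: divide_le_eq power2_eq_square mult.assoc C0)
    have "((\<lambda>h::real^3. C * norm h) \<longlongrightarrow> C * norm (0::real^3)) (at 0)" by (intro tendsto_intros)
    then show "((\<lambda>h::real^3. C * norm h) \<longlongrightarrow> 0) (at 0)" by simp
  qed
qed

lemma vector_fourier_integral_continuous:
  assumes g: "g \<in> borel_measurable borel" and i: "integrable lborel (\<lambda>\<xi>. bracket \<xi> ^ 2 * norm (g \<xi>))"
  shows "continuous_on UNIV (vector_fourier_integral 1 g)"
  using vector_fourier_integral_has_derivative[OF g i]
  by (auto intro!: continuous_at_imp_continuous_on has_derivative_continuous)

text \<open>The set where the functions differ is open and null, hence empty.\<close>

lemma continuous_AE_eq:
  fixes f g :: "'a::euclidean_space \<Rightarrow> 'b::t2_space"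
  assumes "continuous_on UNIV f" "continuous_on UNIV g" and AE: "AE x in lborel. f x = g x"
  shows "f x = g x"
proof (rule ccontr)
  assume "f x \<noteq> g x"
  have "open {x. f x \<noteq> g x}" using assms(1,2) by (rule open_Collect_neq)
  then obtain e where e: "e > 0" "ball x e \<subseteq> {x. f x \<noteq> g x}"
    using \<open>f x \<noteq> g x\<close> openE by blast
  have "AE y in lborel. y \<notin> ball x e" using AE by eventually_elim (use e in auto)
  then have "emeasure lborel (ball x e) = 0"
    by (subst (asm) AE_iff_null_sets[symmetric]) auto
  then have "measure lborel (ball x e) = 0" by (simp add: measure_def)
  moreover have "measure lborel (ball x e) > 0"
    using content_ball_pos[OF e(1), of x] by simp
  ultimately show False by simp
qed

definition real_part :: "complex^3 \<Rightarrow> real^3" where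
  "real_part z = (\<chi> i. Re (z $ i))"

lemma complexify_inj: "complexify v x = z \<Longrightarrow> v x = real_part z"
  by (simp add: complexify_def real_part_def vec_eq_iff) (metis Re_complex_of_real)

lemma bounded_linear_real_part: "bounded_linear real_part"
  unfolding linear_conv_bounded_linear[symmetric]
  by (rule linearI) (simp_all add: real_part_def vec_eq_iff)

lemma bounded_linear_complexify_vec: "bounded_linear (\<lambda>z::real^3. (\<chi> i. complex_of_real (z $ i)) :: complex^3)"
  unfolding linear_conv_bounded_linear[symmetric]
  by (rule linearI) (simp_all add: vec_eq_iff scaleR_conv_of_real[where 'a=complex])

text \<open>The derivative of the Fourier integral is a priori complex. Being the derivative of a real field it
  is real, by uniqueness of derivatives.\<close>

lemma represented_derivative:
  assumes rep: "\<And>x. complexify v x = vector_fourier_integral 1 g x"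
    and g: "g \<in> borel_measurable borel" and i: "integrable lborel (\<lambda>\<xi>. bracket \<xi> ^ 3 * norm (g \<xi>))"
  obtains v' where "\<And>x. (v has_derivative v' x) (at x)" "\<And>h. continuous_on UNIV (\<lambda>x. v' x h)"
    "\<And>x h. complexify (\<lambda>x. v' x h) x = vector_fourier_integral 1 (fourier_derivative g h) x"
proof -
  let ?V = "vector_fourier_integral 1"
  let ?v' = "\<lambda>x h. real_part (?V (fourier_derivative g h) x)"
  have i2: "integrable lborel (\<lambda>\<xi>. bracket \<xi> ^ 2 * norm (g \<xi>))" by (rule integrable_bracket_mono[OF g i]) simp
  have D: "(?V g has_derivative (\<lambda>h. ?V (fourier_derivative g h) x)) (at x)" for x
    by (rule vector_fourier_integral_has_derivative[OF g i2])
  have veq: "v = (\<lambda>x. real_part (?V g x))" using complexify_inj[OF rep] by auto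
  have Dv: "(v has_derivative ?v' x) (at x)" for x
    unfolding veq by (rule bounded_linear.has_derivative[OF bounded_linear_real_part D])
  have ceq: "complexify v = (\<lambda>x. (\<chi> i. complex_of_real (v x $ i)))" by (simp add: complexify_def fun_eq_iff)
  have Dc: "(complexify v has_derivative (\<lambda>h. (\<chi> i. complex_of_real (?v' x h $ i)))) (at x)" for x
    unfolding ceq by (rule bounded_linear.has_derivative[OF bounded_linear_complexify_vec Dv])
  have "complexify v = ?V g" using rep by auto
  with D have "(complexify v has_derivative (\<lambda>h. ?V (fourier_derivative g h) x)) (at x)" for x by simp
  from has_derivative_unique[OF Dc this] have eq: "(\<chi> i. complex_of_real (?v' x h $ i)) = ?V (fourier_derivative g h) x" for x h
    by (simp add: fun_eq_iff)
  have c: "continuous_on UNIV (\<lambda>x. ?v' x h)" for h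
  proof -
    have "continuous_on UNIV (?V (fourier_derivative g h))"
    proof (rule vector_fourier_integral_continuous)
      show "fourier_derivative g h \<in> borel_measurable borel" using g by measurable
      show "integrable lborel (\<lambda>\<xi>. bracket \<xi> ^ 2 * norm (fourier_derivative g h \<xi>))"
        by (rule integrable_fourier_derivative[OF g]) (use i in \<open>simp add: eval_nat_numeral\<close>)
    qed
    then show ?thesis by (rule bounded_linear.continuous_on[OF bounded_linear_real_part])
  qed
  show ?thesis by (rule that[of ?v']) (use Dv c eq in \<open>auto simp: complexify_def\<close>)
qed

subsection \<open>Curl and divergence on the Fourier side\<close>

lemma curl_symbol_mult:
  "(curl_symbol \<xi> *v z) $ 1 = \<i> * (complex_of_real (\<xi> $ 2) * z $ 3 - complex_of_real (\<xi> $ 3) * z $ 2)"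
  "(curl_symbol \<xi> *v z) $ 2 = \<i> * (complex_of_real (\<xi> $ 3) * z $ 1 - complex_of_real (\<xi> $ 1) * z $ 3)"
  "(curl_symbol \<xi> *v z) $ 3 = \<i> * (complex_of_real (\<xi> $ 1) * z $ 2 - complex_of_real (\<xi> $ 2) * z $ 1)"
  by (simp_all add: curl_symbol_def matrix_vector_mult_def sum_3 cross3_def axis_def vector_3 algebra_simps)

lemma inner_complex3: "(a::complex^3) \<bullet> b = Re (a$1) * Re (b$1) + Im (a$1) * Im (b$1)
    + (Re (a$2) * Re (b$2) + Im (a$2) * Im (b$2)) + (Re (a$3) * Re (b$3) + Im (a$3) * Im (b$3))"
  by (simp add: inner_vec_def sum_3 inner_complex_def)

lemma curl_symbol_hermitian: "(curl_symbol \<xi> *v a) \<bullet> b = a \<bullet> (curl_symbol \<xi> *v b)"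
  by (simp add: inner_complex3 curl_symbol_mult algebra_simps)

lemma norm_sq_real3: "(norm (\<xi>::real^3))\<^sup>2 = (\<xi>$1)\<^sup>2 + (\<xi>$2)\<^sup>2 + (\<xi>$3)\<^sup>2"
  by (simp add: norm_vec_sq sum_3)

text \<open>Applying the symbol twice gives \<open>|\<xi>|\<^sup>2 z - (\<xi> \<bullet> z) \<xi>\<close>, and the second term is orthogonal to \<open>\<xi> \<times> z\<close>.\<close>

lemma curl_symbol_curl_curl:
  "(curl_symbol \<xi> *v (curl_symbol \<xi> *v z)) \<bullet> (curl_symbol \<xi> *v z) = (norm \<xi>)\<^sup>2 * (z \<bullet> (curl_symbol \<xi> *v z))"
  by (simp add: inner_complex3 curl_symbol_mult norm_sq_real3) algebra

text \<open>Lagrange's identity for the real and the imaginary part of \<open>z\<close>; \<open>p\<close> and \<open>q\<close> are their products with \<open>\<xi>\<close>.\<close>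

lemma norm_curl_symbol_le: "norm (curl_symbol \<xi> *v z) \<le> norm \<xi> * norm z"
proof (rule power2_le_imp_le)
  let ?p = "\<xi>$1 * Re (z$1) + \<xi>$2 * Re (z$2) + \<xi>$3 * Re (z$3)" and ?q = "\<xi>$1 * Im (z$1) + \<xi>$2 * Im (z$2) + \<xi>$3 * Im (z$3)"
  have "(norm (curl_symbol \<xi> *v z))\<^sup>2 = (norm \<xi>)\<^sup>2 * (norm z)\<^sup>2 - ?p\<^sup>2 - ?q\<^sup>2"
    by (simp add: power2_norm_eq_inner[of z] power2_norm_eq_inner[of "curl_symbol \<xi> *v z"] inner_complex3 curl_symbol_mult norm_sq_real3) algebra
  then show "(norm (curl_symbol \<xi> *v z))\<^sup>2 \<le> (norm \<xi> * norm z)\<^sup>2"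
    by (simp add: power_mult_distrib)
qed simp

lemma norm_curl_symbol_le_bracket: "norm (curl_symbol \<xi> *v z) \<le> bracket \<xi> * norm z"
  by (rule order_trans[OF norm_curl_symbol_le mult_right_mono[OF norm_le_bracket]]) simp

lemma curl_symbol_measurable [measurable]:
  assumes [measurable]: "g \<in> borel_measurable borel"
  shows "(\<lambda>\<xi>. curl_symbol \<xi> *v g \<xi>) \<in> borel_measurable borel"
proof (rule borel_measurable_vecI)
  fix i :: 3
  have "i = 1 \<or> i = 2 \<or> i = 3" using exhaust_3 by blast
  then show "(\<lambda>\<xi>. (curl_symbol \<xi> *v g \<xi>) $ i) \<in> borel_measurable borel"
    by (elim disjE) (simp_all add: curl_symbol_mult)
qed

lemma fourier_derivative_axis: "fourier_derivative g (axis i 1) \<xi> $ j = \<i> * complex_of_real (\<xi> $ i) * g \<xi> $ j"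
  by (simp add: fourier_derivative_def inner_axis)

lemma partial_represented:
  assumes rep: "\<And>x. complexify v x = vector_fourier_integral 1 g x"
    and g: "g \<in> borel_measurable borel" and i: "integrable lborel (\<lambda>\<xi>. bracket \<xi> ^ 3 * norm (g \<xi>))"
  shows "integrable lborel (\<lambda>\<xi>. \<i> * complex_of_real (\<xi> $ k) * g \<xi> $ j)"
    and "complex_of_real (partial k v x $ j) = fourier_integral 1 (\<lambda>\<xi>. \<i> * complex_of_real (\<xi> $ k) * g \<xi> $ j) x"
proof -
  obtain v' where v': "\<And>x. (v has_derivative v' x) (at x)"
    "\<And>x h. complexify (\<lambda>x. v' x h) x = vector_fourier_integral 1 (fourier_derivative g h) x"
    using represented_derivative[OF rep g i] by metis
  have iD: "integrable lborel (fourier_derivative g h)" for h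
  proof (rule integrable_of_bracket)
    show "integrable lborel (\<lambda>\<xi>. bracket \<xi> ^ 2 * norm (fourier_derivative g h \<xi>))"
      by (rule integrable_fourier_derivative[OF g]) (use i in \<open>simp add: eval_nat_numeral\<close>)
    show "fourier_derivative g h \<in> borel_measurable borel" using g by measurable
  qed
  show "integrable lborel (\<lambda>\<xi>. \<i> * complex_of_real (\<xi> $ k) * g \<xi> $ j)"
    using integrable_component[OF iD[of "axis k 1"], of j] by (simp add: fourier_derivative_axis)
  have "complex_of_real (partial k v x $ j) = complexify (\<lambda>x. v' x (axis k 1)) x $ j"
    by (simp add: complexify_def partial_eq[OF v'(1)])
  also have "\<dots> = fourier_integral 1 (\<lambda>\<xi>. \<i> * complex_of_real (\<xi> $ k) * g \<xi> $ j) x"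
    by (simp add: v'(2) vector_fourier_integral_component[OF iD] fourier_derivative_axis)
  finally show "complex_of_real (partial k v x $ j) = fourier_integral 1 (\<lambda>\<xi>. \<i> * complex_of_real (\<xi> $ k) * g \<xi> $ j) x" .
qed

lemma curl_represented:
  assumes rep: "\<And>x. complexify v x = vector_fourier_integral 1 g x"
    and g: "g \<in> borel_measurable borel" and i: "integrable lborel (\<lambda>\<xi>. bracket \<xi> ^ 3 * norm (g \<xi>))"
  shows "complexify (curl v) x = vector_fourier_integral 1 (\<lambda>\<xi>. curl_symbol \<xi> *v g \<xi>) x"
proof -
  note P = partial_represented[OF rep g i]
  have int: "integrable lborel (\<lambda>\<xi>. curl_symbol \<xi> *v g \<xi>)"
  proof (rule Bochner_Integration.integrable_bound)
    show "integrable lborel (\<lambda>\<xi>. bracket \<xi> ^ 1 * norm (g \<xi>))" by (rule integrable_bracket_mono[OF g i]) simp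
    show "(\<lambda>\<xi>. curl_symbol \<xi> *v g \<xi>) \<in> borel_measurable lborel" using g by measurable
    show "AE \<xi> in lborel. norm (curl_symbol \<xi> *v g \<xi>) \<le> norm (bracket \<xi> ^ 1 * norm (g \<xi>))"
      using norm_curl_symbol_le_bracket by (auto simp: abs_mult)
  qed
  have diff: "complex_of_real (partial k v x $ j) - complex_of_real (partial l v x $ m)
      = fourier_integral 1 (\<lambda>\<xi>. \<i> * (complex_of_real (\<xi> $ k) * g \<xi> $ j - complex_of_real (\<xi> $ l) * g \<xi> $ m)) x" for k l j m
    by (simp only: P(2) fourier_integral_diff[OF P(1) P(1), symmetric]) (simp only: right_diff_distrib mult.assoc)
  have "complexify (curl v) x $ j = vector_fourier_integral 1 (\<lambda>\<xi>. curl_symbol \<xi> *v g \<xi>) x $ j" for j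
  proof -
    have "j = 1 \<or> j = 2 \<or> j = 3" using exhaust_3 by blast
    then show ?thesis
      by (elim disjE) (simp_all add: vector_fourier_integral_component[OF int] complexify_def curl_def curl_symbol_mult diff)
  qed
  then show ?thesis by (simp add: vec_eq_iff)
qed

lemma divergence_curl_represented:
  assumes rep: "\<And>x. complexify v x = vector_fourier_integral 1 (\<lambda>\<xi>. curl_symbol \<xi> *v g \<xi>) x"
    and g: "g \<in> borel_measurable borel" and i: "integrable lborel (\<lambda>\<xi>. bracket \<xi> ^ 3 * norm (curl_symbol \<xi> *v g \<xi>))"
  shows "divergence v x = 0"
proof -
  have m: "(\<lambda>\<xi>. curl_symbol \<xi> *v g \<xi>) \<in> borel_measurable borel" using g by measurable
  note P = partial_represented[OF rep m i]
  let ?f = "\<lambda>k \<xi>. \<i> * complex_of_real (\<xi> $ k) * (curl_symbol \<xi> *v g \<xi>) $ k"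
  have "complex_of_real (divergence v x) = fourier_integral 1 (?f 1) x + fourier_integral 1 (?f 2) x + fourier_integral 1 (?f 3) x"
    by (simp add: divergence_def sum_3 P(2))
  also have "\<dots> = fourier_integral 1 (\<lambda>\<xi>. ?f 1 \<xi> + ?f 2 \<xi> + ?f 3 \<xi>) x"
    by (simp add: fourier_integral_add[symmetric] P(1))
  also have "(\<lambda>\<xi>. ?f 1 \<xi> + ?f 2 \<xi> + ?f 3 \<xi>) = (\<lambda>\<xi>. 0)"
    by (simp add: curl_symbol_mult fun_eq_iff algebra_simps)
  finally show ?thesis by (simp add: fourier_integral_def)
qed

text \<open>Inversion gives the identity almost everywhere, and both sides are continuous.\<close>

lemma represented_by_fourier:
  assumes f: "square_integrable (complexify v)" "continuous_on UNIV v" and d: "decaying (fourier (complexify v))"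
  shows "complexify v x = vector_fourier_integral 1 (fourier (complexify v)) x"
proof -
  let ?g = "fourier (complexify v)"
  have m: "?g \<in> borel_measurable borel" using d by (simp add: decaying_def)
  have b4: "norm (?g \<xi>) \<le> bracket \<xi> ^ 4 * norm (?g \<xi>)" for \<xi>
    using mult_right_mono[OF bracket_power_mono[of 0 4 \<xi>] norm_ge_zero[of "?g \<xi>"]] by simp
  note G = decaying_bounded(1,2)[OF d m b4]
  have "AE x in lborel. plancherel 1 ?g x = complexify v x"
    using plancherel_inversion[of "-1", OF _ f(1)] by (simp add: fourier_def)
  moreover have "AE x in lborel. plancherel 1 ?g x = vector_fourier_integral 1 ?g x"
    by (rule plancherel_L1[OF _ G]) simp
  ultimately have AE: "AE x in lborel. complexify v x = vector_fourier_integral 1 ?g x"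
    by eventually_elim simp
  have ceq: "complexify v = (\<lambda>x. (\<chi> i. complex_of_real (v x $ i)))" by (simp add: complexify_def fun_eq_iff)
  have c1: "continuous_on UNIV (complexify v)"
    unfolding ceq by (rule bounded_linear.continuous_on[OF bounded_linear_complexify_vec f(2)])
  have c2: "continuous_on UNIV (vector_fourier_integral 1 ?g)"
    by (rule vector_fourier_integral_continuous[OF m integrable_bracket_mono[OF m decaying_L1(1)[OF d]]]) simp
  show ?thesis by (rule continuous_AE_eq[OF c1 c2 AE])
qed

section \<open>Smooth solutions\<close>

definition complex_vec :: "real^3 \<Rightarrow> complex^3" where
  "complex_vec z = (\<chi> i. complex_of_real (z $ i))"

lemma complexify_eq: "complexify v x = complex_vec (v x)"
  by (simp add: complexify_def complex_vec_def)

lemma bounded_linear_complex_vec: "bounded_linear complex_vec"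
  using bounded_linear_complexify_vec by (simp add: complex_vec_def[abs_def])

lemma complex_vec_measurable [measurable]: "complex_vec \<in> borel_measurable borel"
  using bounded_linear.continuous_on[OF bounded_linear_complex_vec continuous_on_id]
  by (auto intro: borel_measurable_continuous_onI)

lemma inner_complex_vec: "complex_vec a \<bullet> complex_vec b = a \<bullet> b"
  by (simp add: complex_vec_def inner_vec_def inner_complex_def)

lemma norm_complex_vec: "norm (complex_vec a) = norm a"
  by (simp add: norm_eq_sqrt_inner inner_complex_vec)

lemma norm_cross_le: "norm (cross3 x y) \<le> norm x * norm y"
  by (rule power2_le_imp_le) (simp_all add: norm_cross power_mult_distrib)

lemma vector_fourier_integral_inner:
  assumes \<sigma>: "\<bar>\<sigma>\<bar> = 1" and f: "integrable lborel f" "square_integrable f" and g: "integrable lborel g" "square_integrable g"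
  shows "l2_inner (vector_fourier_integral \<sigma> f) (vector_fourier_integral \<sigma> g) = l2_inner f g"
proof -
  note V = vector_fourier_integral_isometry[OF \<sigma> f] vector_fourier_integral_isometry[OF \<sigma> g]
  have "l2_norm (\<lambda>\<xi>. vector_fourier_integral \<sigma> f \<xi> - vector_fourier_integral \<sigma> g \<xi>) = l2_norm (vector_fourier_integral \<sigma> (\<lambda>x. f x - g x))"
    by (intro arg_cong[of _ _ l2_norm]) (auto simp: vector_fourier_integral_diff[OF f(1) g(1)])
  also have "\<dots> = l2_norm (\<lambda>x. f x - g x)"
    using f g by (intro vector_fourier_integral_isometry(2)[OF \<sigma>]) (auto intro: square_integrable_intros)
  finally show ?thesis
    using l2_norm_diff_sq[OF V(1,3)] l2_norm_diff_sq[OF f(2) g(2)] V(2,4) by simp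
qed

text \<open>Symbols of at most quartic growth, additive in the vector. They map decaying transforms boundedly
  into \<open>L\<^sup>1 \<inter> L\<^sup>2\<close>; besides the identity, this covers curl, its square and the helical components.\<close>

definition admissible :: "(real^3 \<Rightarrow> complex^3 \<Rightarrow> complex^3) \<Rightarrow> bool" where
  "admissible m \<longleftrightarrow> (\<forall>f. f \<in> borel_measurable borel \<longrightarrow> (\<lambda>\<xi>. m \<xi> (f \<xi>)) \<in> borel_measurable borel) \<and>
     (\<forall>\<xi> a b. m \<xi> (a - b) = m \<xi> a - m \<xi> b) \<and> (\<forall>\<xi> z. norm (m \<xi> z) \<le> bracket \<xi> ^ 4 * norm z)"

lemma admissible_props:
  assumes m: "admissible m" and f: "decaying f"
  shows "integrable lborel (\<lambda>\<xi>. m \<xi> (f \<xi>))" "square_integrable (\<lambda>\<xi>. m \<xi> (f \<xi>))" "l2_norm (\<lambda>\<xi>. m \<xi> (f \<xi>)) \<le> decay_norm f"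
proof -
  have "(\<lambda>\<xi>. m \<xi> (f \<xi>)) \<in> borel_measurable borel" "norm (m \<xi> (f \<xi>)) \<le> bracket \<xi> ^ 4 * norm (f \<xi>)" for \<xi>
    using m f by (auto simp: admissible_def decaying_def)
  from decaying_bounded[OF f this] show "integrable lborel (\<lambda>\<xi>. m \<xi> (f \<xi>))" "square_integrable (\<lambda>\<xi>. m \<xi> (f \<xi>))"
    "l2_norm (\<lambda>\<xi>. m \<xi> (f \<xi>)) \<le> decay_norm f" .
qed

lemma admissible_lipschitz:
  assumes m: "admissible m" and f: "decaying f" and g: "decaying g"
  shows "l2_norm (\<lambda>\<xi>. m \<xi> (f \<xi>) - m \<xi> (g \<xi>)) \<le> decay_norm (\<lambda>\<xi>. f \<xi> - g \<xi>)"
proof -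
  have "(\<lambda>\<xi>. m \<xi> (f \<xi>) - m \<xi> (g \<xi>)) = (\<lambda>\<xi>. m \<xi> (f \<xi> - g \<xi>))" using m by (simp add: admissible_def)
  then show ?thesis using admissible_props(3)[OF m decaying_diff[OF f g]] by simp
qed

lemma curl_symbol_diff: "curl_symbol \<xi> *v (a - b) = curl_symbol \<xi> *v a - curl_symbol \<xi> *v b"
  by (simp add: matrix_vector_mult_diff_distrib)

lemma admissible_id: "admissible (\<lambda>\<xi> z. z)"
  using mult_right_mono[OF bracket_power_mono[of 0 4] norm_ge_zero] by (auto simp: admissible_def)

lemma admissible_curl: "admissible (\<lambda>\<xi> z. curl_symbol \<xi> *v z)"
proof -
  have "norm (curl_symbol \<xi> *v z) \<le> bracket \<xi> ^ 4 * norm z" for \<xi> z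
    using norm_curl_symbol_le_bracket[of \<xi> z] mult_right_mono[OF bracket_power_mono[of 1 4 \<xi>] norm_ge_zero[of z]] by simp
  then show ?thesis by (auto simp: admissible_def curl_symbol_diff)
qed

lemma admissible_curl_curl: "admissible (\<lambda>\<xi> z. curl_symbol \<xi> *v (curl_symbol \<xi> *v z))"
proof -
  have "norm (curl_symbol \<xi> *v (curl_symbol \<xi> *v z)) \<le> bracket \<xi> ^ 4 * norm z" for \<xi> z
  proof -
    have "norm (curl_symbol \<xi> *v (curl_symbol \<xi> *v z)) \<le> bracket \<xi> * (bracket \<xi> * norm z)"
      by (rule order_trans[OF norm_curl_symbol_le_bracket mult_left_mono[OF norm_curl_symbol_le_bracket]]) simp
    also have "\<dots> = bracket \<xi> ^ 2 * norm z" by (simp add: power2_eq_square)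
    also have "\<dots> \<le> bracket \<xi> ^ 4 * norm z" by (rule mult_right_mono[OF bracket_power_mono]) auto
    finally show ?thesis .
  qed
  then show ?thesis by (auto simp: admissible_def curl_symbol_diff)
qed

lemma sobolev_decaying:
  assumes "sobolev 7 f"
  shows "decaying (fourier f)"
proof -
  have f: "square_integrable f" and i: "integrable lborel (\<lambda>\<xi>. (1 + (norm \<xi>)\<^sup>2) powr 7 * (norm (fourier f \<xi>))\<^sup>2)"
    using assms by (auto simp: sobolev_def L2_iff)
  have [measurable]: "fourier f \<in> borel_measurable borel"
    unfolding fourier_def by (rule square_integrable_measurable[OF plancherel_limit(1)[OF _ f]]) simp
  have "(\<lambda>\<xi>. (1 + (norm \<xi>)\<^sup>2) powr 7 * (norm (fourier f \<xi>))\<^sup>2) = (\<lambda>\<xi>. (norm (bracket \<xi> ^ 7 *\<^sub>R fourier f \<xi>))\<^sup>2)"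
    by (simp add: fun_eq_iff power_mult_distrib bracket_sq[symmetric] power_mult[symmetric] powr_numeral)
  with i show ?thesis by (simp add: decaying_def square_integrable_def)
qed

lemma sobolev_norm_7: "sobolev_norm 7 f = decay_norm (fourier f)"
proof -
  have "(\<lambda>\<xi>. (1 + (norm \<xi>)\<^sup>2) powr 7 * (norm (fourier f \<xi>))\<^sup>2) = (\<lambda>\<xi>. (norm (bracket \<xi> ^ 7 *\<^sub>R fourier f \<xi>))\<^sup>2)"
    by (simp add: fun_eq_iff power_mult_distrib bracket_sq[symmetric] power_mult[symmetric] powr_numeral)
  then show ?thesis by (simp add: sobolev_norm_def decay_norm_def l2_norm_def)
qed

locale navier_stokes_solution =
  fixes \<nu> :: real and T :: ereal and u :: "real \<Rightarrow> real^3 \<Rightarrow> real^3"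
  assumes solution: "smooth_solution \<nu> T u"
begin

abbreviation "I \<equiv> time_interval T"

definition uhat :: "real \<Rightarrow> cfield" where "uhat t = fourier (complexify (u t))"

definition decay_dist :: "real \<Rightarrow> real \<Rightarrow> real" where
  "decay_dist r t = decay_norm (\<lambda>\<xi>. uhat r \<xi> - uhat t \<xi>)"

lemma sobolev_u: "t \<in> I \<Longrightarrow> sobolev 7 (complexify (u t))"
  using solution by (simp add: smooth_solution_def continuous_in_sobolev_def)

lemma u_square_integrable: "t \<in> I \<Longrightarrow> square_integrable (complexify (u t))"
  using sobolev_u by (simp add: sobolev_def L2_iff)

lemma uhat_decaying: "t \<in> I \<Longrightarrow> decaying (uhat t)"
  unfolding uhat_def by (intro sobolev_decaying sobolev_u)

lemma uhat_measurable: "t \<in> I \<Longrightarrow> uhat t \<in> borel_measurable borel"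
  using uhat_decaying by (simp add: decaying_def)

text \<open>Continuity in the Sobolev space concerns the transform of a difference, which is the difference of
  the transforms only up to a null set.\<close>

lemma decay_dist_tendsto:
  assumes t: "t \<in> I"
  shows "((\<lambda>r. decay_dist r t) \<longlongrightarrow> 0) (at t within I)"
proof -
  have lim: "((\<lambda>r. sobolev_norm 7 (\<lambda>x. complexify (u r) x - complexify (u t) x)) \<longlongrightarrow> 0) (at t within I)"
    using solution t by (simp add: smooth_solution_def continuous_in_sobolev_def)
  have eq: "sobolev_norm 7 (\<lambda>x. complexify (u r) x - complexify (u t) x) = decay_dist r t" if r: "r \<in> I" for r
  proof -
    let ?d = "\<lambda>x. complexify (u r) x - complexify (u t) x"
    have AE: "AE \<xi> in lborel. fourier ?d \<xi> = uhat r \<xi> - uhat t \<xi>"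
      unfolding uhat_def fourier_def
      by (rule plancherel_diff[OF _ u_square_integrable[OF r] u_square_integrable[OF t]]) simp
    have [measurable]: "uhat r \<in> borel_measurable borel" "uhat t \<in> borel_measurable borel"
      using uhat_measurable r t by auto
    have [measurable]: "fourier ?d \<in> borel_measurable borel"
      unfolding fourier_def
      by (rule square_integrable_measurable[OF plancherel_limit(1)[OF _ square_integrable_diff[OF u_square_integrable[OF r] u_square_integrable[OF t]]]]) simp
    show ?thesis
      unfolding sobolev_norm_7 decay_dist_def decay_norm_def
      by (rule l2_norm_cong_AE) (use AE in \<open>auto\<close>)
  qed
  have "\<forall>\<^sub>F r in at t within I. sobolev_norm 7 (\<lambda>x. complexify (u r) x - complexify (u t) x) = decay_dist r t"
    by (simp add: eventually_at_filter eq)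
  then show ?thesis using lim by (rule Lim_transform_eventually[rotated])
qed

lemma u_continuous:
  assumes "t \<in> I"
  shows "continuous_on UNIV (u t)"
proof -
  have "Ck_on 0 (\<lambda>(t, x). u t x) (I \<times> UNIV)" using solution unfolding smooth_solution_def smooth_on_def by blast
  then have "continuous_on (I \<times> UNIV) (\<lambda>(t, x). u t x)" by simp
  then have "continuous_on UNIV ((\<lambda>(t, x). u t x) \<circ> (\<lambda>x. (t, x)))"
    using assms by (intro continuous_on_compose continuous_intros) (auto elim: continuous_on_subset)
  then show ?thesis by (simp add: o_def)
qed

subsection \<open>Velocity, vorticity and the curl of the vorticity\<close>

definition field :: "(real^3 \<Rightarrow> complex^3 \<Rightarrow> complex^3) \<Rightarrow> real \<Rightarrow> cfield" where
  "field m t = vector_fourier_integral 1 (\<lambda>\<xi>. m \<xi> (uhat t \<xi>))"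

definition vorticity :: "real \<Rightarrow> cfield" where "vorticity t = complexify (curl (u t))"
definition curl_vorticity :: "real \<Rightarrow> cfield" where "curl_vorticity t = complexify (curl (curl (u t)))"

lemma bracket_uhat_integrable: "t \<in> I \<Longrightarrow> n \<le> 4 \<Longrightarrow> integrable lborel (\<lambda>\<xi>. bracket \<xi> ^ n * norm (uhat t \<xi>))"
  using integrable_bracket_mono[OF uhat_measurable decaying_L1(1)[OF uhat_decaying]] .

lemma bracket_what_integrable:
  assumes t: "t \<in> I"
  shows "integrable lborel (\<lambda>\<xi>. bracket \<xi> ^ 3 * norm (curl_symbol \<xi> *v uhat t \<xi>))"
proof (rule Bochner_Integration.integrable_bound[OF bracket_uhat_integrable[OF t order_refl]])
  show "(\<lambda>\<xi>. bracket \<xi> ^ 3 * norm (curl_symbol \<xi> *v uhat t \<xi>)) \<in> borel_measurable lborel"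
    using uhat_measurable[OF t] by measurable
  have "bracket \<xi> ^ 3 * norm (curl_symbol \<xi> *v uhat t \<xi>) \<le> bracket \<xi> ^ 4 * norm (uhat t \<xi>)" for \<xi>
    using mult_left_mono[OF norm_curl_symbol_le_bracket[of \<xi> "uhat t \<xi>"], of "bracket \<xi> ^ 3"] by (simp add: eval_nat_numeral mult_ac)
  then show "AE \<xi> in lborel. norm (bracket \<xi> ^ 3 * norm (curl_symbol \<xi> *v uhat t \<xi>)) \<le> norm (bracket \<xi> ^ 4 * norm (uhat t \<xi>))"
    by (simp add: abs_mult)
qed

lemma u_field: "t \<in> I \<Longrightarrow> complexify (u t) = field (\<lambda>\<xi> z. z) t"
  using represented_by_fourier[OF u_square_integrable u_continuous uhat_decaying[unfolded uhat_def]]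
  by (simp add: field_def uhat_def fun_eq_iff)

lemma vorticity_field:
  assumes t: "t \<in> I"
  shows "vorticity t = field (\<lambda>\<xi> z. curl_symbol \<xi> *v z) t"
proof -
  have "complexify (u t) x = vector_fourier_integral 1 (uhat t) x" for x
    using u_field[OF t] by (simp add: field_def)
  from curl_represented[OF this uhat_measurable[OF t] bracket_uhat_integrable[OF t]]
  show ?thesis by (simp add: vorticity_def field_def fun_eq_iff)
qed

lemma curl_vorticity_field:
  assumes t: "t \<in> I"
  shows "curl_vorticity t = field (\<lambda>\<xi> z. curl_symbol \<xi> *v (curl_symbol \<xi> *v z)) t"
proof -
  have "complexify (curl (u t)) x = vector_fourier_integral 1 (\<lambda>\<xi>. curl_symbol \<xi> *v uhat t \<xi>) x" for x
    using vorticity_field[OF t] by (simp add: field_def vorticity_def)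
  from curl_represented[OF this curl_symbol_measurable[OF uhat_measurable[OF t]] bracket_what_integrable[OF t]]
  show ?thesis by (simp add: curl_vorticity_def field_def fun_eq_iff)
qed

lemma field_square_integrable:
  assumes "admissible m" "t \<in> I"
  shows "square_integrable (field m t)"
  unfolding field_def
  by (rule vector_fourier_integral_isometry(1)[OF _ admissible_props(1,2)[OF assms(1) uhat_decaying[OF assms(2)]]]) simp

lemma field_inner:
  assumes "admissible m" "admissible n" "t \<in> I" "r \<in> I"
  shows "l2_inner (field m t) (field n r) = l2_inner (\<lambda>\<xi>. m \<xi> (uhat t \<xi>)) (\<lambda>\<xi>. n \<xi> (uhat r \<xi>))"
  unfolding field_def
  by (rule vector_fourier_integral_inner[OF _ admissible_props(1,2)[OF assms(1) uhat_decaying[OF assms(3)]]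
      admissible_props(1,2)[OF assms(2) uhat_decaying[OF assms(4)]]]) simp

lemma field_norm_le:
  assumes "admissible m" "t \<in> I"
  shows "l2_norm (field m t) \<le> decay_norm (uhat t)"
  unfolding field_def
  using vector_fourier_integral_isometry(2)[OF _ admissible_props(1,2)[OF assms(1) uhat_decaying[OF assms(2)]], of 1]
    admissible_props(3)[OF assms(1) uhat_decaying[OF assms(2)]] by simp

lemma field_dist_le:
  assumes m: "admissible m" and t: "t \<in> I" "r \<in> I"
  shows "l2_norm (\<lambda>x. field m t x - field m r x) \<le> decay_dist t r"
proof -
  note a = admissible_props(1,2)[OF m uhat_decaying]
  have "l2_norm (\<lambda>x. field m t x - field m r x) = l2_norm (vector_fourier_integral 1 (\<lambda>\<xi>. m \<xi> (uhat t \<xi>) - m \<xi> (uhat r \<xi>)))"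
    unfolding field_def by (intro arg_cong[of _ _ l2_norm]) (auto simp: vector_fourier_integral_diff[OF a(1)[OF t(1)] a(1)[OF t(2)]])
  also have "\<dots> = l2_norm (\<lambda>\<xi>. m \<xi> (uhat t \<xi>) - m \<xi> (uhat r \<xi>))"
    using a t by (intro vector_fourier_integral_isometry(2)) (auto intro: square_integrable_intros)
  also have "\<dots> \<le> decay_dist t r"
    unfolding decay_dist_def by (rule admissible_lipschitz[OF m uhat_decaying[OF t(1)] uhat_decaying[OF t(2)]])
  finally show ?thesis .
qed

lemma decay_dist_commute: "decay_dist r t = decay_dist t r"
  unfolding decay_dist_def decay_norm_def scaleR_diff_right by (rule l2_norm_minus_commute)

lemma decay_norm_triangle:
  assumes "t \<in> I" "r \<in> I"
  shows "\<bar>decay_norm (uhat r) - decay_norm (uhat t)\<bar> \<le> decay_dist r t"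
  using l2_norm_triangle_rev[of "\<lambda>\<xi>. bracket \<xi> ^ 7 *\<^sub>R uhat r \<xi>" "\<lambda>\<xi>. bracket \<xi> ^ 7 *\<^sub>R uhat t \<xi>"]
    uhat_decaying[OF assms(1)] uhat_decaying[OF assms(2)]
  by (simp add: decay_dist_def decay_norm_def decaying_def scaleR_diff_right)

lemma decay_norm_bounded:
  assumes "{a..b} \<subseteq> I"
  obtains B where "B \<ge> 0" "\<And>r. r \<in> {a..b} \<Longrightarrow> decay_norm (uhat r) \<le> B"
proof -
  have "continuous_on I (\<lambda>t. decay_norm (uhat t))"
    unfolding continuous_on_def
  proof
    fix t assume t: "t \<in> I"
    show "((\<lambda>t. decay_norm (uhat t)) \<longlongrightarrow> decay_norm (uhat t)) (at t within I)"
    proof (rule LIM_zero_cancel, rule Lim_null_comparison[OF _ decay_dist_tendsto[OF t]])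
      show "\<forall>\<^sub>F r in at t within I. norm (decay_norm (uhat r) - decay_norm (uhat t)) \<le> decay_dist r t"
        using decay_norm_triangle[OF t] by (simp add: eventually_at_filter)
    qed
  qed
  from compact_imp_bounded[OF compact_continuous_image[OF continuous_on_subset[OF this assms] compact_Icc]]
  obtain B where B: "\<forall>r\<in>{a..b}. norm (decay_norm (uhat r)) \<le> B" by (auto simp: bounded_iff)
  show ?thesis
  proof (rule that[of "max B 0"])
    fix r assume "r \<in> {a..b}"
    then have "norm (decay_norm (uhat r)) \<le> B" using B by blast
    then show "decay_norm (uhat r) \<le> max B 0" by simp
  qed simp
qed

subsection \<open>Vanishing divergence\<close>

lemma vorticity_divergence_free:
  assumes t: "t \<in> I"
  shows "divergence_free (vorticity t)"
proof -
  let ?g = "\<lambda>\<xi>. curl_symbol \<xi> *v uhat t \<xi>"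
  have rep: "complexify (curl (u t)) x = vector_fourier_integral 1 ?g x" for x
    using vorticity_field[OF t] by (simp add: field_def vorticity_def)
  obtain v' where "\<And>x. (curl (u t) has_derivative v' x) (at x)" "\<And>h. continuous_on UNIV (\<lambda>x. v' x h)"
    using represented_derivative[OF rep curl_symbol_measurable[OF uhat_measurable[OF t]] bracket_what_integrable[OF t]] by metis
  from divergence_free_complexify[OF this divergence_curl_represented[OF rep uhat_measurable[OF t] bracket_what_integrable[OF t]]]
  show ?thesis by (simp add: vorticity_def)
qed

lemma u_divergence_free:
  assumes t: "t \<in> I"
  shows "divergence_free (complexify (u t))"
proof -
  have rep: "complexify (u t) x = vector_fourier_integral 1 (uhat t) x" for x
    using u_field[OF t] by (simp add: field_def)
  have i3: "integrable lborel (\<lambda>\<xi>. bracket \<xi> ^ 3 * norm (uhat t \<xi>))"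
    by (rule bracket_uhat_integrable[OF t]) simp
  obtain v' where "\<And>x. (u t has_derivative v' x) (at x)" "\<And>h. continuous_on UNIV (\<lambda>x. v' x h)"
    using represented_derivative[OF rep uhat_measurable[OF t] i3] by metis
  moreover have "divergence (u t) x = 0" for x
    using solution t by (simp add: smooth_solution_def navier_stokes_def)
  ultimately show ?thesis by (rule divergence_free_complexify)
qed

subsection \<open>The nonlinear term\<close>

definition nonlinearity :: "real \<Rightarrow> cfield" where
  "nonlinearity t = complexify (\<lambda>x. cross3 (curl (u t) x) (u t x))"

definition sup_const :: real where "sup_const = (2 * pi) powr (-3/2) * decay_const"

lemma sup_const_nonneg: "0 \<le> sup_const"
  by (simp add: sup_const_def decay_const_def)

text \<open>The Sobolev embedding: the transform of the velocity is integrable.\<close>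

lemma u_bounded:
  assumes t: "t \<in> I"
  shows "norm (u t x) \<le> sup_const * decay_norm (uhat t)"
proof -
  have "norm (u t x) = norm (field (\<lambda>\<xi> z. z) t x)"
    using u_field[OF t] by (metis complexify_eq norm_complex_vec)
  also have "\<dots> \<le> (2 * pi) powr (-3/2) * (LINT \<xi>|lborel. norm (uhat t \<xi>))"
    unfolding field_def by (rule norm_vector_fourier_integral_le)
  also have "\<dots> \<le> (2 * pi) powr (-3/2) * (LINT \<xi>|lborel. bracket \<xi> ^ 4 * norm (uhat t \<xi>))"
  proof (intro mult_left_mono integral_mono')
    show "integrable lborel (\<lambda>\<xi>. bracket \<xi> ^ 4 * norm (uhat t \<xi>))" by (rule bracket_uhat_integrable[OF t]) simp
    show "norm (uhat t \<xi>) \<le> bracket \<xi> ^ 4 * norm (uhat t \<xi>)" for \<xi>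
      using mult_right_mono[OF bracket_power_mono[of 0 4 \<xi>] norm_ge_zero] by simp
  qed auto
  also have "\<dots> \<le> (2 * pi) powr (-3/2) * (decay_const * decay_norm (uhat t))"
    by (intro mult_left_mono decaying_L1(2)[OF uhat_decaying[OF t]]) auto
  finally show ?thesis by (simp add: sup_const_def mult.assoc)
qed

text \<open>Bounded velocity times square-integrable vorticity.\<close>

lemma nonlinearity_square_integrable:
  assumes t: "t \<in> I"
  shows "square_integrable (nonlinearity t)"
    and "l2_norm (nonlinearity t) \<le> sup_const * (decay_norm (uhat t))\<^sup>2"
proof -
  let ?B = "sup_const * decay_norm (uhat t)"
  have N0: "0 \<le> decay_norm (uhat t)" by (simp add: decay_norm_def)
  have W: "square_integrable (vorticity t)"
    unfolding vorticity_field[OF t] by (rule field_square_integrable[OF admissible_curl t])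
  have le: "norm (nonlinearity t x) \<le> ?B * norm (vorticity t x)" for x
  proof -
    have "norm (nonlinearity t x) \<le> norm (curl (u t) x) * norm (u t x)"
      unfolding nonlinearity_def complexify_eq norm_complex_vec by (rule norm_cross_le)
    also have "\<dots> \<le> norm (curl (u t) x) * ?B" by (intro mult_left_mono u_bounded t) simp
    finally show ?thesis by (simp add: vorticity_def complexify_eq norm_complex_vec mult.commute)
  qed
  have [measurable]: "u t \<in> borel_measurable borel"
    by (rule borel_measurable_continuous_onI[OF u_continuous[OF t]])
  have "curl (u t) = (\<lambda>x. real_part (vorticity t x))"
    using complexify_inj[of "curl (u t)"] by (auto simp: vorticity_def)
  moreover have "real_part \<in> borel_measurable borel"
    using bounded_linear.continuous_on[OF bounded_linear_real_part continuous_on_id]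
    by (auto intro: borel_measurable_continuous_onI)
  ultimately have [measurable]: "curl (u t) \<in> borel_measurable borel"
    using square_integrable_measurable[OF W] by simp
  have "(\<lambda>x. cross3 (curl (u t) x) (u t x)) \<in> borel_measurable borel"
  proof (rule borel_measurable_vecI)
    fix i :: 3
    have "i = 1 \<or> i = 2 \<or> i = 3" using exhaust_3 by blast
    then show "(\<lambda>x. cross3 (curl (u t) x) (u t x) $ i) \<in> borel_measurable borel"
      by (elim disjE) (simp_all add: cross3_def)
  qed
  then have m: "nonlinearity t \<in> borel_measurable borel"
    unfolding nonlinearity_def complexify_eq[abs_def] by measurable
  show "square_integrable (nonlinearity t)"
    by (rule square_integrable_bound[OF m W le])
  have "l2_norm (nonlinearity t) \<le> ?B * l2_norm (vorticity t)"
    by (rule l2_norm_mono[OF m W le]) (simp add: sup_const_nonneg N0)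
  also have "\<dots> \<le> ?B * decay_norm (uhat t)"
    unfolding vorticity_field[OF t] by (intro mult_left_mono field_norm_le[OF admissible_curl t]) (simp add: sup_const_nonneg N0)
  finally show "l2_norm (nonlinearity t) \<le> sup_const * (decay_norm (uhat t))\<^sup>2"
    by (simp add: power2_eq_square mult.assoc)
qed

lemma nonlinearity_orthogonal: "l2_inner (nonlinearity t) (vorticity t) = 0"
  by (simp add: l2_inner_def nonlinearity_def vorticity_def complexify_eq inner_complex_vec dot_cross_self)

section \<open>The helicity balance\<close>

definition dt_u :: "real \<Rightarrow> real^3 \<Rightarrow> real^3" where
  "dt_u t x = vector_derivative (\<lambda>r. u r x) (at t within I)"

lemma time_interval_right:
  assumes "t \<in> I"
  obtains b where "t < b" "{t..b} \<subseteq> I"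
proof -
  have "ereal t < T" using assms by (simp add: time_interval_def)
  then obtain b where b: "ereal t < ereal b" "ereal b < T"
    using ereal_dense2 by blast
  have "{t..b} \<subseteq> I"
    using assms b by (auto simp: time_interval_def intro: le_less_trans[of _ "ereal b"])
  with b that show ?thesis by simp
qed

text \<open>Derivatives in time are unique also at time zero, where they are one-sided.\<close>

lemma at_within_I_neq_bot:
  assumes "t \<in> I"
  shows "at t within I \<noteq> bot"
proof -
  obtain b where b: "t < b" "{t..b} \<subseteq> I" using time_interval_right[OF assms] .
  have "at_right t \<le> at t within I"
    using at_le[OF b(2), of t] at_within_Icc_at_right[OF b(1)] by simp
  then show ?thesis using trivial_limit_at_right_real[of t] by (auto simp: bot_unique)
qed

lemma Icc_subset_I: "a \<in> I \<Longrightarrow> b \<in> I \<Longrightarrow> {a..b} \<subseteq> I"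
  by (auto simp: time_interval_def intro: le_less_trans[of _ "ereal b"])

lemma dt_u_props:
  shows "\<And>t x. t \<in> I \<Longrightarrow> ((\<lambda>r. u r x) has_vector_derivative dt_u t x) (at t within I)"
    and "continuous_on (I \<times> UNIV) (\<lambda>p. dt_u (fst p) (snd p))"
proof -
  have "Ck_on (Suc 0) (\<lambda>(t, x). u t x) (I \<times> UNIV)"
    using solution unfolding smooth_solution_def smooth_on_def by blast
  then obtain f' where f': "\<And>p. p \<in> I \<times> UNIV \<Longrightarrow> ((\<lambda>(t, x). u t x) has_derivative f' p) (at p within I \<times> UNIV)"
      "\<And>v. continuous_on (I \<times> UNIV) (\<lambda>p. f' p v)"
    by auto
  have d: "((\<lambda>r. u r x) has_vector_derivative f' (t, x) (1, 0)) (at t within I)" if t: "t \<in> I" for t x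
  proof -
    have "((\<lambda>r. (r, x)) has_derivative (\<lambda>h. (h, 0))) (at t within I)"
      by (intro derivative_eq_intros) auto
    moreover have "((\<lambda>(t, x). u t x) has_derivative f' (t, x)) (at (t, x) within (\<lambda>r. (r, x)) ` I)"
      by (rule has_derivative_subset[OF f'(1)]) (use t in auto)
    ultimately have "((\<lambda>r. case (r, x) of (t, x) \<Rightarrow> u t x) has_derivative (\<lambda>h. f' (t, x) (h, 0))) (at t within I)"
      by (rule has_derivative_in_compose)
    then have der: "((\<lambda>r. u r x) has_derivative (\<lambda>h. f' (t, x) (h, 0))) (at t within I)" by simp
    have hom: "f' (t, x) (h, 0) = h *\<^sub>R f' (t, x) (1, 0)" for h
      using linear_scale[OF has_derivative_linear[OF f'(1)[of "(t, x)"]], of h "(1, 0)"] t by simp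
    show ?thesis using der unfolding has_vector_derivative_def hom[symmetric] .
  qed
  have eq: "dt_u t x = f' (t, x) (1, 0)" if "t \<in> I" for t x
    unfolding dt_u_def by (rule vector_derivative_within[OF at_within_I_neq_bot[OF that] d[OF that]])
  show "((\<lambda>r. u r x) has_vector_derivative dt_u t x) (at t within I)" if "t \<in> I" for t x
    using d[OF that] eq[OF that] by simp
  show "continuous_on (I \<times> UNIV) (\<lambda>p. dt_u (fst p) (snd p))"
    by (rule continuous_on_eq[OF f'(2)[of "(1, 0)"]]) (auto simp: eq)
qed

lemma dt_u_measurable:
  assumes t: "t \<in> I"
  shows "dt_u t \<in> borel_measurable borel"
proof -
  have "continuous_on UNIV ((\<lambda>p. dt_u (fst p) (snd p)) \<circ> (\<lambda>x. (t, x)))"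
    using t by (intro continuous_on_compose continuous_on_subset[OF dt_u_props(2)] continuous_intros) auto
  then have "continuous_on UNIV (dt_u t)" by (simp add: o_def)
  then show ?thesis by (rule borel_measurable_continuous_onI)
qed

lemma vorticity_sq: "t \<in> I \<Longrightarrow> square_integrable (vorticity t)"
  and curl_vorticity_sq: "t \<in> I \<Longrightarrow> square_integrable (curl_vorticity t)"
  by (auto simp: vorticity_field curl_vorticity_field
      intro: field_square_integrable admissible_curl admissible_curl_curl)

text \<open>The equation expresses the time derivative through the nonlinearity and the dissipation;
  against a divergence-free field the Leray projection drops out.\<close>

lemma dt_u_equation:
  assumes t: "t \<in> I"
  shows "square_integrable (complexify (dt_u t))"
    and "l2_norm (complexify (dt_u t)) \<le> sup_const * (decay_norm (uhat t))\<^sup>2 + \<bar>\<nu>\<bar> * decay_norm (uhat t)"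
    and "\<And>\<psi>. square_integrable \<psi> \<Longrightarrow> divergence_free \<psi> \<Longrightarrow>
      l2_inner (complexify (dt_u t)) \<psi> = - l2_inner (nonlinearity t) \<psi> - \<nu> * l2_inner (curl_vorticity t) \<psi>"
proof -
  let ?L = "leray (nonlinearity t)" and ?Z = "curl_vorticity t" and ?D = "complexify (dt_u t)"
  let ?R = "\<lambda>x. - ?L x - \<nu> *\<^sub>R ?Z x"
  note n = nonlinearity_square_integrable[OF t]
  note L = leray_properties[OF n(1)]
  have Z: "square_integrable ?Z" by (rule curl_vorticity_sq[OF t])
  have R: "square_integrable ?R" by (intro square_integrable_intros L Z)
  have m: "?D \<in> borel_measurable borel"
    using dt_u_measurable[OF t] unfolding complexify_eq[abs_def] by measurable
  have "AE x in lborel. ?D x + ?L x + \<nu> *\<^sub>R ?Z x = 0"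
    using solution t
    by (simp add: smooth_solution_def navier_stokes_def dt_u_def[abs_def] nonlinearity_def curl_vorticity_def)
  then have AE: "AE x in lborel. ?R x = ?D x"
  proof eventually_elim
    case (elim x)
    then have "?D x + (?L x + \<nu> *\<^sub>R ?Z x) = 0" by (simp only: add.assoc)
    then have "?D x = - (?L x + \<nu> *\<^sub>R ?Z x)" by (simp only: eq_neg_iff_add_eq_0)
    then show ?case by simp
  qed
  show D: "square_integrable ?D" by (rule square_integrable_cong_AE[OF AE R m])
  have "l2_norm ?D = l2_norm ?R"
    by (rule l2_norm_cong_AE[symmetric]) (use AE m square_integrable_measurable[OF R] in auto)
  also have "\<dots> \<le> l2_norm (\<lambda>x. (-1) *\<^sub>R ?L x) + l2_norm (\<lambda>x. (- \<nu>) *\<^sub>R ?Z x)"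
    using l2_norm_triangle[of "\<lambda>x. (-1) *\<^sub>R ?L x" "\<lambda>x. (- \<nu>) *\<^sub>R ?Z x"] L(1) Z by (simp add: square_integrable_intros)
  also have "\<dots> = l2_norm ?L + \<bar>\<nu>\<bar> * l2_norm ?Z"
    by (simp only: l2_norm_scaleR) simp
  also have "\<dots> \<le> sup_const * (decay_norm (uhat t))\<^sup>2 + \<bar>\<nu>\<bar> * decay_norm (uhat t)"
    using order_trans[OF l2_norm_leray_le[OF n(1)] n(2)] field_norm_le[OF admissible_curl_curl t]
    by (intro add_mono mult_left_mono) (auto simp: curl_vorticity_field[OF t])
  finally show "l2_norm ?D \<le> sup_const * (decay_norm (uhat t))\<^sup>2 + \<bar>\<nu>\<bar> * decay_norm (uhat t)" .
  show "l2_inner ?D \<psi> = - l2_inner (nonlinearity t) \<psi> - \<nu> * l2_inner ?Z \<psi>"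
    if \<psi>: "square_integrable \<psi>" "divergence_free \<psi>" for \<psi>
  proof -
    have "l2_inner ?D \<psi> = l2_inner ?R \<psi>"
      by (rule l2_inner_cong_AE)
        (use AE m square_integrable_measurable[OF R] square_integrable_measurable[OF \<psi>(1)] in auto)
    also have "\<dots> = - l2_inner ?L \<psi> - \<nu> * l2_inner ?Z \<psi>"
      using L(1) Z \<psi>(1) by (simp add: l2_inner_simps square_integrable_intros)
    finally show ?thesis using l2_inner_leray[OF n(1) \<psi>] by simp
  qed
qed

text \<open>The fundamental theorem of calculus at each point of space, followed by Fubini's theorem. Joint
  continuity of the time derivative gives measurability, and its \<open>L\<^sup>2\<close> norm is bounded on compact time
  intervals.\<close>

lemma l2_inner_increment:
  assumes a: "a \<in> I" and b: "b \<in> I" and ab: "a \<le> b" and \<psi>: "square_integrable \<psi>"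
  shows "integrable lborel (\<lambda>r. indicator {a..b} r * l2_inner (complexify (dt_u r)) \<psi>)"
    and "l2_inner (\<lambda>x. complexify (u b) x - complexify (u a) x) \<psi>
      = (LINT r|lborel. indicator {a..b} r * l2_inner (complexify (dt_u r)) \<psi>)"
proof -
  have sub: "{a..b} \<subseteq> I" by (rule Icc_subset_I[OF a b])
  have [measurable]: "\<psi> \<in> borel_measurable borel" by (rule square_integrable_measurable[OF \<psi>])
  let ?K = "\<lambda>r x. indicator {a..b} r * (complex_vec (dt_u r x) \<bullet> \<psi> x)"
  obtain B where B: "B \<ge> 0" "\<And>r. r \<in> {a..b} \<Longrightarrow> decay_norm (uhat r) \<le> B"
    using decay_norm_bounded[OF sub] by blast
  define M where "M = (sup_const * B\<^sup>2 + \<bar>\<nu>\<bar> * B) * l2_norm \<psi>"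
  have D: "square_integrable (complexify (dt_u r))" if "r \<in> {a..b}" for r
    using dt_u_equation(1) sub that by blast
  have bound: "(LINT x|lborel. norm (complexify (dt_u r) x) * norm (\<psi> x)) \<le> M" if r: "r \<in> {a..b}" for r
  proof -
    have rI: "r \<in> I" using r sub by blast
    have N0: "0 \<le> decay_norm (uhat r)" by (simp add: decay_norm_def)
    have "l2_norm (complexify (dt_u r)) \<le> sup_const * (decay_norm (uhat r))\<^sup>2 + \<bar>\<nu>\<bar> * decay_norm (uhat r)"
      by (rule dt_u_equation(2)[OF rI])
    also have "\<dots> \<le> sup_const * B\<^sup>2 + \<bar>\<nu>\<bar> * B"
      by (intro add_mono mult_left_mono power_mono B(2)[OF r] N0 sup_const_nonneg abs_ge_zero)
    finally have "l2_norm (complexify (dt_u r)) * l2_norm \<psi> \<le> M"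
      unfolding M_def by (intro mult_right_mono) auto
    with l2_Cauchy_Schwarz_norm[OF D[OF r] \<psi>] show ?thesis by linarith
  qed
  have Kint: "integrable lborel (\<lambda>x. ?K r x)" for r
  proof (cases "r \<in> {a..b}")
    case True
    then show ?thesis using square_integrable_inner[OF D[OF True] \<psi>] by (simp add: complexify_eq)
  qed simp
  have "(\<lambda>p. indicator ({a..b} \<times> UNIV) p *\<^sub>R dt_u (fst p) (snd p)) \<in> borel_measurable (borel :: (real \<times> (real^3)) measure)"
    by (rule borel_measurable_continuous_on_indicator)
      (use sub in \<open>auto intro!: borel_closed closed_Times continuous_on_subset[OF dt_u_props(2)]\<close>)
  then have m0 [measurable]: "(\<lambda>p. indicator ({a..b} \<times> UNIV) p *\<^sub>R dt_u (fst p) (snd p)) \<in> borel_measurable (borel :: (real \<times> (real^3)) measure)" .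
  have "(\<lambda>p. complex_vec (indicator ({a..b} \<times> UNIV) p *\<^sub>R dt_u (fst p) (snd p)) \<bullet> \<psi> (snd p)) \<in> borel_measurable (borel :: (real \<times> (real^3)) measure)"
    by measurable
  moreover have "complex_vec (indicator ({a..b} \<times> UNIV) p *\<^sub>R dt_u (fst p) (snd p)) \<bullet> \<psi> (snd p) = ?K (fst p) (snd p)" for p :: "real \<times> (real^3)"
    using bounded_linear.linear[OF bounded_linear_complex_vec]
    by (cases p) (auto simp: indicator_def linear_0)
  ultimately have Km: "(\<lambda>p. ?K (fst p) (snd p)) \<in> borel_measurable (lborel \<Otimes>\<^sub>M lborel)"
    by (simp add: lborel_prod)
  have K: "integrable (lborel \<Otimes>\<^sub>M lborel) (\<lambda>(r, x). ?K r x)"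
  proof (rule lborel_pair.Fubini_integrable)
    show Km': "(\<lambda>(r, x). ?K r x) \<in> borel_measurable (lborel \<Otimes>\<^sub>M lborel)" using Km by (simp add: case_prod_unfold)
    show "integrable lborel (\<lambda>r. LINT x|lborel. norm (case (r, x) of (r, x) \<Rightarrow> ?K r x))"
    proof (rule Bochner_Integration.integrable_bound)
      show "integrable lborel (\<lambda>r. indicator {a..b} r * M)" by (intro integrable_mult_left integrable_real_indicator) (simp_all add: ab)
      show "(\<lambda>r. LINT x|lborel. norm (case (r, x) of (r, x) \<Rightarrow> ?K r x)) \<in> borel_measurable lborel"
        by (rule lborel.borel_measurable_lebesgue_integral) (use Km in \<open>simp add: case_prod_unfold\<close>)
      show "AE r in lborel. norm (LINT x|lborel. norm (case (r, x) of (r, x) \<Rightarrow> ?K r x)) \<le> norm (indicator {a..b} r * M)"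
      proof (rule AE_I2)
        fix r
        show "norm (LINT x|lborel. norm (case (r, x) of (r, x) \<Rightarrow> ?K r x)) \<le> norm (indicator {a..b} r * M)"
        proof (cases "r \<in> {a..b}")
          case True
          have "(LINT x|lborel. norm (?K r x)) \<le> (LINT x|lborel. norm (complexify (dt_u r) x) * norm (\<psi> x))"
          proof (rule integral_mono')
            show "integrable lborel (\<lambda>x. norm (complexify (dt_u r) x) * norm (\<psi> x))"
              by (rule square_integrable_norm_mult[OF D[OF True] \<psi>])
            show "norm (?K r x) \<le> norm (complexify (dt_u r) x) * norm (\<psi> x)" for x
              using True Cauchy_Schwarz_ineq2[of "complex_vec (dt_u r x)" "\<psi> x"] by (simp add: complexify_eq)
          qed simp
          also have "\<dots> \<le> M" by (rule bound[OF True])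
          finally show ?thesis using True by simp
        qed simp
      qed
    qed
    show "AE r in lborel. integrable lborel (\<lambda>x. case (r, x) of (r, x) \<Rightarrow> ?K r x)" using Kint by simp
  qed
  have inner: "(LINT x|lborel. ?K r x) = indicator {a..b} r * l2_inner (complexify (dt_u r)) \<psi>" for r
    by (simp add: l2_inner_def complexify_eq)
  show "integrable lborel (\<lambda>r. indicator {a..b} r * l2_inner (complexify (dt_u r)) \<psi>)"
    using lborel_pair.integrable_fst[OF K] by (simp only: inner)
  have FTC: "(LINT r|lborel. ?K r x) = (complexify (u b) x - complexify (u a) x) \<bullet> \<psi> x" for x
  proof -
    let ?\<phi> = "\<lambda>z. complex_vec z \<bullet> \<psi> x"
    have bl: "bounded_linear ?\<phi>"
      by (rule bounded_linear_compose[OF bounded_linear_inner_left bounded_linear_complex_vec])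
    have "(LINT r|lborel. indicator {a..b} r *\<^sub>R ?\<phi> (dt_u r x)) = ?\<phi> (u b x) - ?\<phi> (u a x)"
    proof (rule integral_FTC_Icc[OF ab])
      fix r assume r: "a \<le> r" "r \<le> b"
      then have "r \<in> I" using sub by auto
      from has_vector_derivative_within_subset[OF dt_u_props(1)[OF this] sub]
      have "((\<lambda>r. u r x) has_vector_derivative dt_u r x) (at r within {a..b})" .
      then show "((\<lambda>r. ?\<phi> (u r x)) has_vector_derivative ?\<phi> (dt_u r x)) (at r within {a..b})"
        by (rule bounded_linear.has_vector_derivative[OF bl])
    next
      have "continuous_on {a..b} ((\<lambda>p. dt_u (fst p) (snd p)) \<circ> (\<lambda>r. (r, x)))"
        using sub by (intro continuous_on_compose continuous_on_subset[OF dt_u_props(2)] continuous_intros) auto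
      then have "continuous_on {a..b} (\<lambda>r. dt_u r x)" by (simp add: o_def)
      then show "continuous_on {a..b} (\<lambda>r. ?\<phi> (dt_u r x))" by (rule bounded_linear.continuous_on[OF bl])
    qed
    then show ?thesis by (simp add: complexify_eq inner_diff_left)
  qed
  have "l2_inner (\<lambda>x. complexify (u b) x - complexify (u a) x) \<psi> = (LINT x|lborel. LINT r|lborel. ?K r x)"
    by (simp only: l2_inner_def FTC)
  also have "\<dots> = (LINT r|lborel. LINT x|lborel. ?K r x)"
    by (rule lborel_pair.Fubini_integral[OF K])
  also have "\<dots> = (LINT r|lborel. indicator {a..b} r * l2_inner (complexify (dt_u r)) \<psi>)"
    by (simp only: inner)
  finally show "l2_inner (\<lambda>x. complexify (u b) x - complexify (u a) x) \<psi>
      = (LINT r|lborel. indicator {a..b} r * l2_inner (complexify (dt_u r)) \<psi>)" .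
qed

definition helicity :: "real \<Rightarrow> real" where
  "helicity t = l2_inner (complexify (u t)) (vorticity t)"

definition helicity_dissipation :: "real \<Rightarrow> real" where
  "helicity_dissipation t = l2_inner (curl_vorticity t) (vorticity t)"

text \<open>The mixed terms cancel because curl is symmetric.\<close>

lemma helicity_difference:
  assumes a: "a \<in> I" and b: "b \<in> I"
  shows "helicity b - helicity a
    = l2_inner (\<lambda>x. complexify (u b) x - complexify (u a) x) (\<lambda>x. vorticity b x + vorticity a x)"
proof -
  have sym: "l2_inner (complexify (u b)) (vorticity a) = l2_inner (complexify (u a)) (vorticity b)"
  proof -
    have "l2_inner (complexify (u b)) (vorticity a) = l2_inner (uhat b) (\<lambda>\<xi>. curl_symbol \<xi> *v uhat a \<xi>)"
      unfolding u_field[OF b] vorticity_field[OF a] by (rule field_inner[OF admissible_id admissible_curl b a])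
    also have "\<dots> = l2_inner (uhat a) (\<lambda>\<xi>. curl_symbol \<xi> *v uhat b \<xi>)"
      unfolding l2_inner_def by (intro Bochner_Integration.integral_cong refl) (metis curl_symbol_hermitian inner_commute)
    also have "\<dots> = l2_inner (complexify (u a)) (vorticity b)"
      unfolding u_field[OF a] vorticity_field[OF b] by (rule field_inner[OF admissible_id admissible_curl a b, symmetric])
    finally show ?thesis .
  qed
  show ?thesis
    using u_square_integrable[OF a] u_square_integrable[OF b] vorticity_sq[OF a] vorticity_sq[OF b] sym
    by (simp add: helicity_def l2_inner_simps square_integrable_intros)
qed

text \<open>At each time \<open>r\<close> between \<open>a\<close> and \<open>b\<close> the nonlinearity is orthogonal to the vorticity at the same time, so
  that against \<open>\<omega>(b) + \<omega>(a)\<close> only the small differences \<open>\<omega>(b) - \<omega>(r)\<close> and \<open>\<omega>(a) - \<omega>(r)\<close> contribute. The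
  dissipative term is compared with its value at time \<open>s\<close>.\<close>

lemma helicity_increment_estimate:
  assumes a: "a \<in> I" and b: "b \<in> I" and ab: "a \<le> b" and s: "s \<in> I" and \<eta>: "0 \<le> \<eta>" "\<eta> \<le> 1"
    and close: "\<And>r. r \<in> {a..b} \<Longrightarrow> decay_dist r s \<le> \<eta>"
  defines "M \<equiv> decay_norm (uhat s) + 1"
  shows "\<bar>helicity b - helicity a + 2 * \<nu> * helicity_dissipation s * (b - a)\<bar>
    \<le> (4 * sup_const * M\<^sup>2 + 4 * \<bar>\<nu>\<bar> * M) * \<eta> * (b - a)"
proof -
  have sub: "{a..b} \<subseteq> I" by (rule Icc_subset_I[OF a b])
  let ?\<psi> = "\<lambda>x. vorticity b x + vorticity a x" and ?C = "4 * sup_const * M\<^sup>2 + 4 * \<bar>\<nu>\<bar> * M"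
  let ?g = "helicity_dissipation s"
  have \<psi>: "square_integrable ?\<psi>" "divergence_free ?\<psi>"
    using a b by (auto intro: square_integrable_intros divergence_free_add vorticity_sq vorticity_divergence_free)
  have N: "decay_norm (uhat r) \<le> M" if "r \<in> {a..b}" for r
  proof -
    have "r \<in> I" using sub that by blast
    then show ?thesis using decay_norm_triangle[OF s, of r] close[OF that] \<eta> by (simp add: M_def)
  qed
  have M0: "0 \<le> M" by (simp add: M_def decay_norm_def)
  have W: "l2_norm (\<lambda>x. vorticity p x - vorticity q x) \<le> decay_dist p q" if "p \<in> I" "q \<in> I" for p q
    using field_dist_le[OF admissible_curl that] that by (simp add: vorticity_field)
  have ain: "a \<in> {a..b}" "b \<in> {a..b}" using ab by auto
  have key: "\<bar>l2_inner (complexify (dt_u r)) ?\<psi> + 2 * \<nu> * ?g\<bar> \<le> ?C * \<eta>" if r: "r \<in> {a..b}" for r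
  proof -
    have rI: "r \<in> I" using r sub by blast
    let ?F = "nonlinearity r" and ?Z = "curl_vorticity"
    note F = nonlinearity_square_integrable[OF rI]
    note sq = F(1) vorticity_sq[OF a] vorticity_sq[OF b] vorticity_sq[OF rI] vorticity_sq[OF s]
      curl_vorticity_sq[OF rI] curl_vorticity_sq[OF s]
    have tri: "decay_dist p r \<le> 2 * \<eta>" if "p \<in> {a..b}" for p
    proof -
      have "p \<in> I" using that sub by blast
      then have "decay_dist p r \<le> decay_dist p s + decay_dist s r"
        using l2_norm_triangle_diff[of "\<lambda>\<xi>. bracket \<xi> ^ 7 *\<^sub>R uhat p \<xi>" "\<lambda>\<xi>. bracket \<xi> ^ 7 *\<^sub>R uhat s \<xi>" "\<lambda>\<xi>. bracket \<xi> ^ 7 *\<^sub>R uhat r \<xi>"]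
          uhat_decaying s rI by (simp add: decay_dist_def decay_norm_def decaying_def scaleR_diff_right)
      then show ?thesis using close[OF that] close[OF r] by (simp add: decay_dist_commute[of s r])
    qed
    have "l2_inner ?F ?\<psi> = l2_inner ?F (\<lambda>x. vorticity b x - vorticity r x) + l2_inner ?F (\<lambda>x. vorticity a x - vorticity r x)"
      using sq nonlinearity_orthogonal[of r] by (simp add: l2_inner_simps)
    moreover have nl: "\<bar>l2_inner ?F (\<lambda>x. vorticity p x - vorticity r x)\<bar> \<le> sup_const * M\<^sup>2 * (2 * \<eta>)" if p: "p \<in> {a..b}" for p
    proof -
      have pI: "p \<in> I" using p sub by blast
      have "\<bar>l2_inner ?F (\<lambda>x. vorticity p x - vorticity r x)\<bar> \<le> l2_norm ?F * l2_norm (\<lambda>x. vorticity p x - vorticity r x)"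
        by (intro l2_Cauchy_Schwarz F(1) square_integrable_intros vorticity_sq pI rI)
      also have "\<dots> \<le> (sup_const * M\<^sup>2) * (2 * \<eta>)"
      proof (rule mult_mono)
        have "(decay_norm (uhat r))\<^sup>2 \<le> M\<^sup>2" using N[OF r] by (intro power_mono) (auto simp: decay_norm_def)
        then show "l2_norm ?F \<le> sup_const * M\<^sup>2"
          using F(2) mult_left_mono[OF _ sup_const_nonneg] by (meson order_trans)
        show "l2_norm (\<lambda>x. vorticity p x - vorticity r x) \<le> 2 * \<eta>" using W[OF pI rI] tri[OF p] by linarith
      qed (auto simp: sup_const_nonneg)
      finally show ?thesis .
    qed
    ultimately have part1: "\<bar>l2_inner ?F ?\<psi>\<bar> \<le> 4 * sup_const * M\<^sup>2 * \<eta>"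
      using nl[OF ain(1)] nl[OF ain(2)] by linarith
    have dec: "l2_inner (?Z r) ?\<psi> - 2 * ?g = l2_inner (\<lambda>x. ?Z r x - ?Z s x) (vorticity a) + l2_inner (\<lambda>x. ?Z r x - ?Z s x) (vorticity b)
        + (l2_inner (?Z s) (\<lambda>x. vorticity a x - vorticity s x) + l2_inner (?Z s) (\<lambda>x. vorticity b x - vorticity s x))"
      using sq by (simp add: helicity_dissipation_def l2_inner_simps square_integrable_intros)
    have "\<bar>l2_inner (\<lambda>x. ?Z r x - ?Z s x) (vorticity p)\<bar> \<le> \<eta> * M \<and> \<bar>l2_inner (?Z s) (\<lambda>x. vorticity p x - vorticity s x)\<bar> \<le> M * \<eta>"
      if p: "p \<in> {a..b}" for p
    proof
      have pI: "p \<in> I" using p sub by blast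
      have "\<bar>l2_inner (\<lambda>x. ?Z r x - ?Z s x) (vorticity p)\<bar> \<le> l2_norm (\<lambda>x. ?Z r x - ?Z s x) * l2_norm (vorticity p)"
        by (intro l2_Cauchy_Schwarz square_integrable_intros sq vorticity_sq pI)
      also have "\<dots> \<le> \<eta> * M"
      proof (rule mult_mono)
        show "l2_norm (\<lambda>x. ?Z r x - ?Z s x) \<le> \<eta>"
          using field_dist_le[OF admissible_curl_curl rI s] close[OF r] by (simp add: curl_vorticity_field rI s)
        show "l2_norm (vorticity p) \<le> M"
          using field_norm_le[OF admissible_curl pI] N[OF p] by (simp add: vorticity_field pI)
      qed (use \<eta> in auto)
      finally show "\<bar>l2_inner (\<lambda>x. ?Z r x - ?Z s x) (vorticity p)\<bar> \<le> \<eta> * M" .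
      have "\<bar>l2_inner (?Z s) (\<lambda>x. vorticity p x - vorticity s x)\<bar> \<le> l2_norm (?Z s) * l2_norm (\<lambda>x. vorticity p x - vorticity s x)"
        by (intro l2_Cauchy_Schwarz square_integrable_intros sq vorticity_sq pI)
      also have "\<dots> \<le> M * \<eta>"
      proof (rule mult_mono)
        show "l2_norm (?Z s) \<le> M"
          using field_norm_le[OF admissible_curl_curl s] by (simp add: curl_vorticity_field s M_def)
        show "l2_norm (\<lambda>x. vorticity p x - vorticity s x) \<le> \<eta>"
          using W[OF pI s] close[OF p] by linarith
      qed (use M0 in auto)
      finally show "\<bar>l2_inner (?Z s) (\<lambda>x. vorticity p x - vorticity s x)\<bar> \<le> M * \<eta>" .
    qed
    from this[OF ain(1)] this[OF ain(2)]
    have "\<bar>l2_inner (?Z r) ?\<psi> - 2 * ?g\<bar> \<le> 4 * (M * \<eta>)"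
      unfolding dec by (simp only: mult.commute[of \<eta> M]) linarith
    then have part2: "\<bar>\<nu> * (l2_inner (?Z r) ?\<psi> - 2 * ?g)\<bar> \<le> \<bar>\<nu>\<bar> * (4 * (M * \<eta>))"
      by (simp only: abs_mult) (rule mult_left_mono, auto)
    have "l2_inner (complexify (dt_u r)) ?\<psi> + 2 * \<nu> * ?g = - l2_inner ?F ?\<psi> - \<nu> * (l2_inner (?Z r) ?\<psi> - 2 * ?g)"
      by (simp only: dt_u_equation(3)[OF rI \<psi>]) (simp add: right_diff_distrib)
    then have "\<bar>l2_inner (complexify (dt_u r)) ?\<psi> + 2 * \<nu> * ?g\<bar> \<le> 4 * sup_const * M\<^sup>2 * \<eta> + \<bar>\<nu>\<bar> * (4 * (M * \<eta>))"
      using part1 part2 by linarith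
    also have "\<dots> = ?C * \<eta>" by (simp add: algebra_simps)
    finally show ?thesis .
  qed
  have ind: "integrable lborel (\<lambda>r. indicator {a..b} r * c)" "(LINT r|lborel. indicator {a..b} r * c) = c * (b - a)" for c :: real
    using ab by auto
  have "helicity b - helicity a + 2 * \<nu> * ?g * (b - a)
      = (LINT r|lborel. indicator {a..b} r * l2_inner (complexify (dt_u r)) ?\<psi>) + (LINT r|lborel. indicator {a..b} r * (2 * \<nu> * ?g))"
    unfolding helicity_difference[OF a b] l2_inner_increment(2)[OF a b ab \<psi>(1)] ind(2) by simp
  also have "\<dots> = (LINT r|lborel. indicator {a..b} r * l2_inner (complexify (dt_u r)) ?\<psi> + indicator {a..b} r * (2 * \<nu> * ?g))"
    by (rule Bochner_Integration.integral_add[OF l2_inner_increment(1)[OF a b ab \<psi>(1)] ind(1), symmetric])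
  finally have eq: "helicity b - helicity a + 2 * \<nu> * ?g * (b - a) = \<dots>" .
  have "norm (LINT r|lborel. indicator {a..b} r * l2_inner (complexify (dt_u r)) ?\<psi> + indicator {a..b} r * (2 * \<nu> * ?g))
      \<le> (LINT r|lborel. indicator {a..b} r * (?C * \<eta>))"
  proof (rule Bochner_Integration.integral_norm_bound_integral)
    show "integrable lborel (\<lambda>r. indicator {a..b} r * l2_inner (complexify (dt_u r)) ?\<psi> + indicator {a..b} r * (2 * \<nu> * ?g))"
      by (rule Bochner_Integration.integrable_add[OF l2_inner_increment(1)[OF a b ab \<psi>(1)] ind(1)])
    show "integrable lborel (\<lambda>r. indicator {a..b} r * (?C * \<eta>))" by (rule ind(1))
    show "norm (indicator {a..b} r * l2_inner (complexify (dt_u r)) ?\<psi> + indicator {a..b} r * (2 * \<nu> * ?g)) \<le> indicator {a..b} r * (?C * \<eta>)" for r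
      using key[of r] by (cases "r \<in> {a..b}") auto
  qed
  then show ?thesis by (simp only: eq real_norm_def ind(2))
qed

text \<open>The increment estimate with \<open>s\<close> as an endpoint of the time interval.\<close>

lemma helicity_has_derivative:
  assumes s: "s \<in> I"
  shows "(helicity has_real_derivative - 2 * \<nu> * helicity_dissipation s) (at s within I)"
  unfolding has_field_derivative_def has_derivative_within_alt
proof (intro conjI allI impI)
  let ?g = "helicity_dissipation s"
  show "bounded_linear ((*) (- 2 * \<nu> * ?g))" by (rule bounded_linear_mult_right)
  fix e :: real assume e: "0 < e"
  define M where "M = decay_norm (uhat s) + 1"
  define C where "C = 4 * sup_const * M\<^sup>2 + 4 * \<bar>\<nu>\<bar> * M"
  have "0 \<le> M" by (simp add: M_def decay_norm_def)
  then have C: "0 \<le> C" by (simp add: C_def sup_const_nonneg)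
  \<comment> \<open>adding one to \<open>C\<close> avoids a division by zero\<close>
  define \<eta> where "\<eta> = min 1 (e / (C + 1))"
  have \<eta>: "0 < \<eta>" "\<eta> \<le> 1" using e C by (auto simp: \<eta>_def)
  have C\<eta>: "C * \<eta> \<le> e"
  proof -
    have "C * \<eta> \<le> C * (e / (C + 1))" using C by (intro mult_left_mono) (auto simp: \<eta>_def)
    also have "\<dots> \<le> e" using C e by (simp add: field_simps)
    finally show ?thesis .
  qed
  have "\<forall>\<^sub>F r in at s within I. decay_dist r s < \<eta>"
    by (rule order_tendstoD(2)[OF decay_dist_tendsto[OF s] \<eta>(1)])
  then obtain d where d: "d > 0" "\<And>r. r \<in> I \<Longrightarrow> r \<noteq> s \<Longrightarrow> dist r s < d \<Longrightarrow> decay_dist r s < \<eta>"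
    unfolding eventually_at by blast
  have close: "decay_dist r s \<le> \<eta>" if "r \<in> I" "\<bar>r - s\<bar> < d" for r
  proof (cases "r = s")
    case True
    then show ?thesis using \<eta> by (simp add: decay_dist_def decay_norm_def l2_norm_def)
  next
    case False
    then show ?thesis using d(2)[OF that(1) False] that(2) by (simp add: dist_real_def)
  qed
  show "\<exists>d>0. \<forall>y\<in>I. norm (y - s) < d \<longrightarrow>
      norm (helicity y - helicity s - - 2 * \<nu> * ?g * (y - s)) \<le> e * norm (y - s)"
  proof (intro exI[of _ d] conjI ballI impI d(1))
    fix y assume y: "y \<in> I" "norm (y - s) < d"
    show "norm (helicity y - helicity s - - 2 * \<nu> * ?g * (y - s)) \<le> e * norm (y - s)"
    proof (cases "s \<le> y")
      case True
      have cl: "decay_dist r s \<le> \<eta>" if "r \<in> {s..y}" for r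
        using that y Icc_subset_I[OF s y(1)] by (intro close) auto
      have "\<bar>helicity y - helicity s + 2 * \<nu> * ?g * (y - s)\<bar> \<le> C * \<eta> * (y - s)"
        using helicity_increment_estimate[OF s y(1) True s less_imp_le[OF \<eta>(1)] \<eta>(2) cl] by (simp only: C_def M_def)
      also have "\<dots> \<le> e * (y - s)" using True by (intro mult_right_mono C\<eta>) simp
      finally show ?thesis using True by simp
    next
      case False
      then have ys: "y \<le> s" by simp
      have cl: "decay_dist r s \<le> \<eta>" if "r \<in> {y..s}" for r
        using that y Icc_subset_I[OF y(1) s] by (intro close) auto
      have "\<bar>helicity s - helicity y + 2 * \<nu> * ?g * (s - y)\<bar> \<le> C * \<eta> * (s - y)"
        using helicity_increment_estimate[OF y(1) s ys s less_imp_le[OF \<eta>(1)] \<eta>(2) cl] by (simp only: C_def M_def)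
      also have "\<dots> \<le> e * (s - y)" using ys by (intro mult_right_mono C\<eta>) simp
      finally have "\<bar>helicity s - helicity y + 2 * \<nu> * ?g * (s - y)\<bar> \<le> e * (s - y)" .
      moreover have "helicity y - helicity s - - 2 * \<nu> * ?g * (y - s) = - (helicity s - helicity y + 2 * \<nu> * ?g * (s - y))"
        by (simp add: algebra_simps)
      ultimately show ?thesis using ys by (simp only: real_norm_def abs_minus_cancel abs_minus_commute[of y s] abs_of_nonneg diff_ge_0_iff_ge)
    qed
  qed
qed

lemma admissible_norm_continuous:
  assumes m: "admissible m"
  shows "continuous_on I (\<lambda>t. l2_norm (\<lambda>\<xi>. m \<xi> (uhat t \<xi>)))"
  unfolding continuous_on_def
proof
  fix t assume t: "t \<in> I"
  show "((\<lambda>t. l2_norm (\<lambda>\<xi>. m \<xi> (uhat t \<xi>))) \<longlongrightarrow> l2_norm (\<lambda>\<xi>. m \<xi> (uhat t \<xi>))) (at t within I)"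
  proof (rule LIM_zero_cancel, rule Lim_null_comparison[OF _ decay_dist_tendsto[OF t]])
    have "norm (l2_norm (\<lambda>\<xi>. m \<xi> (uhat r \<xi>)) - l2_norm (\<lambda>\<xi>. m \<xi> (uhat t \<xi>))) \<le> decay_dist r t" if r: "r \<in> I" for r
    proof -
      note a = admissible_props(2)[OF m uhat_decaying]
      have "\<bar>l2_norm (\<lambda>\<xi>. m \<xi> (uhat r \<xi>)) - l2_norm (\<lambda>\<xi>. m \<xi> (uhat t \<xi>))\<bar> \<le> l2_norm (\<lambda>\<xi>. m \<xi> (uhat r \<xi>) - m \<xi> (uhat t \<xi>))"
        by (rule l2_norm_triangle_rev[OF a[OF r] a[OF t]])
      also have "\<dots> \<le> decay_dist r t"
        unfolding decay_dist_def by (rule admissible_lipschitz[OF m uhat_decaying[OF r] uhat_decaying[OF t]])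
      finally show ?thesis by simp
    qed
    then show "\<forall>\<^sub>F r in at t within I. norm (l2_norm (\<lambda>\<xi>. m \<xi> (uhat r \<xi>)) - l2_norm (\<lambda>\<xi>. m \<xi> (uhat t \<xi>))) \<le> decay_dist r t"
      by (simp add: eventually_at_filter)
  qed
qed

section \<open>Helical components\<close>

text \<open>At \<open>\<xi> = 0\<close> the factor \<open>norm \<xi> powr (-1)\<close> is zero, as is the symbol of curl.\<close>

definition helical_symbol :: "real \<Rightarrow> real \<Rightarrow> real^3 \<Rightarrow> complex^3 \<Rightarrow> complex^3" where
  "helical_symbol \<sigma> s \<xi> z = (norm \<xi> powr s / 2) *\<^sub>R (z + \<sigma> *\<^sub>R (norm \<xi> powr (-1) *\<^sub>R (curl_symbol \<xi> *v z)))"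

lemma norm_inverse_curl_symbol_le: "norm (norm \<xi> powr (-1) *\<^sub>R (curl_symbol \<xi> *v z)) \<le> norm z"
proof (cases "\<xi> = 0")
  case False
  have "norm \<xi> powr (-1) * norm (curl_symbol \<xi> *v z) \<le> norm \<xi> powr (-1) * (norm \<xi> * norm z)"
    by (intro mult_left_mono norm_curl_symbol_le) simp
  also have "\<dots> = norm z" using False by (simp add: powr_minus_divide)
  finally show ?thesis by simp
qed simp

lemma admissible_helical:
  assumes \<sigma>: "\<bar>\<sigma>\<bar> = 1" and s: "0 \<le> s" "s \<le> 4"
  shows "admissible (helical_symbol \<sigma> s)"
  unfolding admissible_def
proof (intro conjI allI impI)
  fix f :: cfield assume [measurable]: "f \<in> borel_measurable borel"
  show "(\<lambda>\<xi>. helical_symbol \<sigma> s \<xi> (f \<xi>)) \<in> borel_measurable borel"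
    unfolding helical_symbol_def by measurable
next
  fix \<xi> :: "real^3" and z :: "complex^3"
  have "norm \<xi> powr s \<le> bracket \<xi> powr s" by (rule powr_mono2[OF s(1) _ norm_le_bracket]) simp
  also have "\<dots> \<le> bracket \<xi> powr 4" by (rule powr_mono[OF s(2)]) simp
  finally have p: "norm \<xi> powr s \<le> bracket \<xi> ^ 4" by (simp add: powr_numeral)
  have "norm (z + \<sigma> *\<^sub>R (norm \<xi> powr (-1) *\<^sub>R (curl_symbol \<xi> *v z))) \<le> norm z + norm (norm \<xi> powr (-1) *\<^sub>R (curl_symbol \<xi> *v z))"
    using norm_triangle_ineq[of z "\<sigma> *\<^sub>R (norm \<xi> powr (-1) *\<^sub>R (curl_symbol \<xi> *v z))"] \<sigma> by simp
  also have "\<dots> \<le> 2 * norm z" using norm_inverse_curl_symbol_le[of \<xi> z] by linarith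
  finally have "norm (helical_symbol \<sigma> s \<xi> z) \<le> (norm \<xi> powr s / 2) * (2 * norm z)"
    unfolding helical_symbol_def norm_scaleR[of "norm \<xi> powr s / 2"] by (simp only: abs_of_nonneg powr_ge_zero divide_nonneg_pos zero_less_numeral) (rule mult_left_mono, auto)
  also have "\<dots> \<le> bracket \<xi> ^ 4 * norm z" using mult_right_mono[OF p norm_ge_zero[of z]] by simp
  finally show "norm (helical_symbol \<sigma> s \<xi> z) \<le> bracket \<xi> ^ 4 * norm z" .
next
  fix \<xi> :: "real^3" and a b :: "complex^3"
  show "helical_symbol \<sigma> s \<xi> (a - b) = helical_symbol \<sigma> s \<xi> a - helical_symbol \<sigma> s \<xi> b"
    by (simp add: helical_symbol_def curl_symbol_diff scaleR_diff_right scaleR_add_right)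
qed

lemma scaleR_matrix_mult_vec: "(c *\<^sub>R A) *v z = c *\<^sub>R (A *v (z::complex^3))"
  by (simp add: matrix_vector_mult_def vec_eq_iff scaleR_sum_right)

lemma mat_mult_vec: "mat (complex_of_real c) *v z = c *\<^sub>R (z::complex^3)"
  by (simp add: matrix_vector_mult_def mat_def vec_eq_iff if_distrib[of "\<lambda>x. x * _"] scaleR_conv_of_real[where 'a=complex] cong: if_cong)

text \<open>On a solution the Leray projection acts as the identity, so that the helical component has
  Fourier transform \<open>|\<xi>|\<^sup>s (u + \<sigma> i \<xi> \<times> u / |\<xi>|) / 2\<close>, where \<open>u\<close> stands for the transform of the velocity.\<close>

lemma helical_C_norm:
  assumes t: "t \<in> I" and \<sigma>: "\<bar>\<sigma>\<bar> = 1" and s: "0 \<le> s" "s \<le> 4"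
  shows "L2_norm (helical_C \<sigma> s (complexify (u t))) = l2_norm (\<lambda>\<xi>. helical_symbol \<sigma> s \<xi> (uhat t \<xi>))"
proof -
  let ?f = "complexify (u t)" and ?g = "uhat t"
  let ?R = "\<lambda>\<xi>. norm \<xi> powr (-1) *\<^sub>R (curl_symbol \<xi> *v ?g \<xi>)"
  have f: "square_integrable ?f" by (rule u_square_integrable[OF t])
  have gm [measurable]: "?g \<in> borel_measurable borel" by (rule uhat_measurable[OF t])
  have g: "square_integrable ?g" using admissible_props(2)[OF admissible_id uhat_decaying[OF t]] .
  have R: "square_integrable ?R"
  proof (rule square_integrable_bound[OF _ g])
    show "norm (?R \<xi>) \<le> 1 * norm (?g \<xi>)" for \<xi>
      using norm_inverse_curl_symbol_le[of \<xi> "?g \<xi>"] by simp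
  qed measurable
  have one: "\<bar>1::real\<bar> = 1" "\<bar>-1::real\<bar> = 1" by auto
  have PR: "square_integrable (plancherel 1 ?R)" by (rule plancherel_limit(1)[OF one(1) R])
  define h where "h x = ?f x + \<sigma> *\<^sub>R plancherel 1 ?R x" for x
  have h: "square_integrable h" unfolding h_def by (intro square_integrable_intros f PR)
  have half: "(1/2) *\<^sub>R v = v + (-1/2) *\<^sub>R v" for v :: "complex^3"
    using scaleR_left_distrib[of 1 "-1/2" v] by simp
  have Q: "AE x in lborel. helical_Q \<sigma> ?f x = h x + (-1/2) *\<^sub>R h x"
    using leray_of_divergence_free[OF f u_divergence_free[OF t]]
    by eventually_elim
      (simp only: helical_Q_def curl_inverse_abs_D_def fourier_multiplier_def inverse_fourier_def
        scaleR_matrix_mult_vec uhat_def[symmetric] half h_def)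
  have Qm: "helical_Q \<sigma> ?f \<in> borel_measurable borel"
    unfolding helical_Q_def curl_inverse_abs_D_def fourier_multiplier_def inverse_fourier_def
      scaleR_matrix_mult_vec uhat_def[symmetric]
    by (intro borel_measurable_scaleR borel_measurable_add borel_measurable_const
        square_integrable_measurable[OF leray_properties(1)[OF f]] square_integrable_measurable[OF PR])
  have Q2: "square_integrable (\<lambda>x. h x + (-1/2) *\<^sub>R h x)" by (intro square_integrable_intros h)
  have FQ: "fourier (helical_Q \<sigma> ?f) = fourier (\<lambda>x. h x + (-1/2) *\<^sub>R h x)"
    unfolding fourier_def by (rule plancherel_cong_AE[OF Q Qm square_integrable_measurable[OF Q2]])
  have "AE \<xi> in lborel. fourier (helical_Q \<sigma> ?f) \<xi> = fourier h \<xi> + (-1/2) *\<^sub>R fourier h \<xi>"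
    unfolding FQ unfolding fourier_def by (rule plancherel_linear[OF one(2) h h])
  moreover have "AE \<xi> in lborel. fourier h \<xi> = ?g \<xi> + \<sigma> *\<^sub>R fourier (plancherel 1 ?R) \<xi>"
    unfolding h_def uhat_def fourier_def by (rule plancherel_linear[OF one(2) f PR[unfolded uhat_def fourier_def]])
  moreover have "AE \<xi> in lborel. fourier (plancherel 1 ?R) \<xi> = ?R \<xi>"
    unfolding fourier_def using plancherel_inversion[OF one(1) R] by simp
  ultimately have AE: "AE \<xi> in lborel. mat (complex_of_real (norm \<xi> powr s)) *v fourier (helical_Q \<sigma> ?f) \<xi> = helical_symbol \<sigma> s \<xi> (?g \<xi>)"
  proof eventually_elim
    case (elim \<xi>)
    then have "fourier (helical_Q \<sigma> ?f) \<xi> = (1/2) *\<^sub>R (?g \<xi> + \<sigma> *\<^sub>R ?R \<xi>)" by (simp only: half)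
    then show ?case by (simp only: mat_mult_vec helical_symbol_def scaleR_scaleR) simp
  qed
  have "square_integrable (fourier (\<lambda>x. h x + (-1/2) *\<^sub>R h x))"
    unfolding fourier_def by (rule plancherel_limit(1)[OF one(2) Q2])
  then have [measurable]: "fourier (helical_Q \<sigma> ?f) \<in> borel_measurable borel"
    unfolding FQ by (rule square_integrable_measurable)
  let ?X = "\<lambda>\<xi>. mat (complex_of_real (norm \<xi> powr s)) *v fourier (helical_Q \<sigma> ?f) \<xi>"
  have Xm: "?X \<in> borel_measurable borel" unfolding mat_mult_vec by measurable
  have hs: "square_integrable (\<lambda>\<xi>. helical_symbol \<sigma> s \<xi> (?g \<xi>))"
    by (rule admissible_props(2)[OF admissible_helical[OF \<sigma> s] uhat_decaying[OF t]])
  have AE': "AE \<xi> in lborel. helical_symbol \<sigma> s \<xi> (?g \<xi>) = ?X \<xi>" using AE by eventually_elim simp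
  have X: "square_integrable ?X" by (rule square_integrable_cong_AE[OF AE' hs Xm])
  have "L2_norm (helical_C \<sigma> s ?f) = l2_norm (plancherel 1 ?X)"
    by (simp only: L2_norm_eq helical_C_def abs_D_power_def fourier_multiplier_def inverse_fourier_def)
  also have "\<dots> = l2_norm ?X" by (rule plancherel_norm[OF one(1) X])
  also have "\<dots> = l2_norm (\<lambda>\<xi>. helical_symbol \<sigma> s \<xi> (?g \<xi>))"
    by (rule l2_norm_cong_AE[OF AE Xm square_integrable_measurable[OF hs]])
  finally show ?thesis .
qed

text \<open>Polarization: \<open>|a + b|\<^sup>2 - |a - b|\<^sup>2 = 4 (a \<bullet> b)\<close>.\<close>

lemma helical_norm_difference:
  assumes t: "t \<in> I" and s: "0 \<le> s" "s \<le> 4"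
  shows "(L2_norm (helical_C 1 s (complexify (u t))))\<^sup>2 - (L2_norm (helical_C (-1) s (complexify (u t))))\<^sup>2
    = (LINT \<xi>|lborel. (norm \<xi> powr s)\<^sup>2 * norm \<xi> powr (-1) * (uhat t \<xi> \<bullet> (curl_symbol \<xi> *v uhat t \<xi>)))"
proof -
  let ?p = "\<lambda>\<sigma> \<xi>. helical_symbol \<sigma> s \<xi> (uhat t \<xi>)"
  have sq: "square_integrable (?p 1)" "square_integrable (?p (-1))"
    by (rule admissible_props(2)[OF admissible_helical[OF _ s] uhat_decaying[OF t]]; simp)+
  have pt: "(norm (?p 1 \<xi>))\<^sup>2 - (norm (?p (-1) \<xi>))\<^sup>2
      = (norm \<xi> powr s)\<^sup>2 * norm \<xi> powr (-1) * (uhat t \<xi> \<bullet> (curl_symbol \<xi> *v uhat t \<xi>))" for \<xi>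
  proof -
    have "(norm (c *\<^sub>R (z + 1 *\<^sub>R (k *\<^sub>R w))))\<^sup>2 - (norm (c *\<^sub>R (z + (-1) *\<^sub>R (k *\<^sub>R w))))\<^sup>2 = (2 * c)\<^sup>2 * k * (z \<bullet> w)"
      for c k :: real and z w :: "complex^3"
      unfolding power2_norm_eq_inner
      by (simp add: inner_add_left inner_add_right inner_diff_left inner_diff_right power2_eq_square inner_commute algebra_simps)
    from this[of "norm \<xi> powr s / 2" "uhat t \<xi>" "norm \<xi> powr (-1)" "curl_symbol \<xi> *v uhat t \<xi>"]
    show ?thesis by (simp add: helical_symbol_def)
  qed
  have "(L2_norm (helical_C 1 s (complexify (u t))))\<^sup>2 - (L2_norm (helical_C (-1) s (complexify (u t))))\<^sup>2
      = (LINT \<xi>|lborel. (norm (?p 1 \<xi>))\<^sup>2) - (LINT \<xi>|lborel. (norm (?p (-1) \<xi>))\<^sup>2)"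
    using helical_C_norm[OF t, of 1 s] helical_C_norm[OF t, of "-1" s] s by (simp add: l2_norm_sq)
  also have "\<dots> = (LINT \<xi>|lborel. (norm (?p 1 \<xi>))\<^sup>2 - (norm (?p (-1) \<xi>))\<^sup>2)"
    by (rule Bochner_Integration.integral_diff[symmetric]) (rule square_integrable_integrable[OF sq(1)], rule square_integrable_integrable[OF sq(2)])
  also have "\<dots> = (LINT \<xi>|lborel. (norm \<xi> powr s)\<^sup>2 * norm \<xi> powr (-1) * (uhat t \<xi> \<bullet> (curl_symbol \<xi> *v uhat t \<xi>)))"
    by (simp only: pt)
  finally show ?thesis .
qed

lemma powr_sq: "(norm (\<xi>::real^3) powr s)\<^sup>2 = norm \<xi> powr (2 * s)"
  by (simp add: power2_eq_square powr_add[symmetric])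

lemma helical_difference_half:
  assumes t: "t \<in> I"
  shows "(L2_norm (helical_C 1 (1/2) (complexify (u t))))\<^sup>2 - (L2_norm (helical_C (-1) (1/2) (complexify (u t))))\<^sup>2 = helicity t"
proof -
  have "(norm \<xi> powr (1/2))\<^sup>2 * norm \<xi> powr (-1) * (z \<bullet> (curl_symbol \<xi> *v z)) = z \<bullet> (curl_symbol \<xi> *v z)" for \<xi> and z :: "complex^3"
  proof (cases "\<xi> = 0")
    case True
    then have "curl_symbol \<xi> *v z = 0" using norm_curl_symbol_le[of \<xi> z] by simp
    then show ?thesis by simp
  qed (simp add: powr_sq powr_minus_divide)
  moreover have "helicity t = (LINT \<xi>|lborel. uhat t \<xi> \<bullet> (curl_symbol \<xi> *v uhat t \<xi>))"
    unfolding helicity_def u_field[OF t] vorticity_field[OF t] field_inner[OF admissible_id admissible_curl t t]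
    by (rule l2_inner_def)
  ultimately show ?thesis using helical_norm_difference[OF t, of "1/2"] by simp
qed

lemma helical_difference_three_halves:
  assumes t: "t \<in> I"
  shows "(L2_norm (helical_C 1 (3/2) (complexify (u t))))\<^sup>2 - (L2_norm (helical_C (-1) (3/2) (complexify (u t))))\<^sup>2 = helicity_dissipation t"
proof -
  have "(norm \<xi> powr (3/2))\<^sup>2 * norm \<xi> powr (-1) * c = (norm \<xi>)\<^sup>2 * c" for \<xi> :: "real^3" and c
  proof (cases "\<xi> = 0")
    case False
    have "(norm \<xi> powr (3/2))\<^sup>2 * norm \<xi> powr (-1) = norm \<xi> powr 2"
      by (simp only: powr_sq powr_add[symmetric]) simp
    then show ?thesis using False by (simp add: powr_numeral)
  qed simp
  moreover have "helicity_dissipation t = (LINT \<xi>|lborel. (norm \<xi>)\<^sup>2 * (uhat t \<xi> \<bullet> (curl_symbol \<xi> *v uhat t \<xi>)))"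
    unfolding helicity_dissipation_def curl_vorticity_field[OF t] vorticity_field[OF t]
      field_inner[OF admissible_curl_curl admissible_curl t t]
    by (simp only: l2_inner_def curl_symbol_curl_curl)
  ultimately show ?thesis using helical_norm_difference[OF t, of "3/2"] by simp
qed

lemma helical_norm_continuous:
  assumes "\<bar>\<sigma>\<bar> = 1" "0 \<le> s" "s \<le> 4"
  shows "continuous_on I (\<lambda>t. (L2_norm (helical_C \<sigma> s (complexify (u t))))\<^sup>2)"
  by (rule continuous_on_eq[OF continuous_on_power[OF admissible_norm_continuous[OF admissible_helical[OF assms]]]])
    (simp add: helical_C_norm assms)

text \<open>By the helicity balance, the difference of the two functionals does not depend on time.\<close>

lemma helical_N_difference:
  assumes t: "t \<in> I"
  shows "helical_N 1 \<nu> u t - helical_N (-1) \<nu> u t = helicity 0"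
proof -
  have t0: "0 \<le> t" using t by (simp add: time_interval_def)
  then have "0 \<in> I" using t by (auto simp: time_interval_def intro: le_less_trans[of _ "ereal t"])
  then have sub: "{0..t} \<subseteq> I" using t by (rule Icc_subset_I)
  let ?p = "\<lambda>\<sigma> r. (L2_norm (helical_C \<sigma> (3/2) (complexify (u r))))\<^sup>2"
  have cont: "continuous_on I (?p 1)" "continuous_on I (?p (-1))"
    by (intro helical_norm_continuous; simp)+
  have int: "set_integrable lborel {0..t} (?p 1)" "set_integrable lborel {0..t} (?p (-1))"
    using cont by (auto intro!: borel_integrable_atLeastAtMost' continuous_on_subset[OF _ sub])
  have eq: "?p 1 r - ?p (-1) r = helicity_dissipation r" if "r \<in> I" for r
    by (rule helical_difference_three_halves[OF that])
  have gc: "continuous_on {0..t} (\<lambda>r. - 2 * \<nu> * helicity_dissipation r)"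
    by (rule continuous_on_eq[where f="\<lambda>r. - 2 * \<nu> * (?p 1 r - ?p (-1) r)"])
      (use sub eq in \<open>auto intro!: continuous_intros continuous_on_subset[OF cont(1)] continuous_on_subset[OF cont(2)]\<close>)
  have "(LINT r|lborel. indicator {0..t} r *\<^sub>R (- 2 * \<nu> * helicity_dissipation r)) = helicity t - helicity 0"
  proof (rule integral_FTC_Icc[OF t0 _ gc])
    fix r assume "0 \<le> r" "r \<le> t"
    then have "r \<in> I" using sub by auto
    from has_field_derivative_subset[OF helicity_has_derivative[OF this] sub]
    show "(helicity has_vector_derivative - 2 * \<nu> * helicity_dissipation r) (at r within {0..t})"
      by (simp add: has_real_derivative_iff_has_vector_derivative)
  qed
  moreover have "(\<lambda>r. indicator {0..t} r *\<^sub>R (- 2 * \<nu> * helicity_dissipation r))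
      = (\<lambda>r. - 2 * \<nu> * (indicator {0..t} r *\<^sub>R (?p 1 r - ?p (-1) r)))"
    using sub eq by (auto simp: fun_eq_iff indicator_def)
  ultimately have "- 2 * \<nu> * (LINT r:{0..t}|lborel. ?p 1 r - ?p (-1) r) = helicity t - helicity 0"
    by (simp only: set_lebesgue_integral_def integral_mult_right_zero)
  then have "2 * \<nu> * (LINT r:{0..t}|lborel. ?p 1 r) - 2 * \<nu> * (LINT r:{0..t}|lborel. ?p (-1) r) = helicity 0 - helicity t"
    using set_integral_diff(2)[OF int] by (simp add: algebra_simps)
  with helical_difference_half[OF t] show ?thesis
    unfolding helical_N_def by linarith
qed

end

theorem proposition14:
  fixes \<nu> :: real and T :: ereal and u :: "real \<Rightarrow> real^3 \<Rightarrow> real^3" and t :: real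
  assumes "\<nu> > 0"
    and "smooth_solution \<nu> T u"
    and "0 \<le> t" and "ereal t < T"
  shows "N_plus \<nu> u t - N_minus \<nu> u t = N_plus \<nu> u 0 - N_minus \<nu> u 0"
proof -
  interpret navier_stokes_solution \<nu> T u by standard (rule assms(2))
  have "t \<in> I" "0 \<in> I"
    using assms(3,4) by (auto simp: time_interval_def intro: le_less_trans[of _ "ereal t"])
  then show ?thesis by (simp add: helical_N_difference)
qed

end
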